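(* Let $D \subset \mathbb{C}$ be a domain, let $\mathcal{F}$ be a family of meromorphic functions on $D$, let $a, b \in \mathbb{C}$ with $a \neq 0$ and $b \neq 0$, and let $K \ge 1$ be a real number. Suppose that for every $f \in \mathcal{F}$ and all $z \in D$ $$f(z) = a \Leftrightarrow f'(z) = b \quad \text{and} \quad f(z) = 0 \Rightarrow |f'(z)| \le K.$$ Then $\mathcal{F}$ is a normal family on $D$.
   Context: A family $\mathcal{F}$ of meromorphic functions on a domain $D \subset \mathbb{C}$ is called normal if it is pre-compact with respect to locally uniform convergence in the spherical (chordal) metric, i.e. every sequence in $\mathcal{F}$ has a subsequence that converges, uniformly on compact subsets of $D$ with respect to the spherical metric on $\widehat{\mathbb{C}} = \mathbb{C} \cup \{\infty\}$, to a limit function that is either meromorphic on $D$ or identically $\infty$. *)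

theory Defs
  imports "HOL-Complex_Analysis.Complex_Analysis"
begin

datatype riemann_sphere = Fin complex | Infty

text \<open>Stereographic projection onto the sphere of diameter 1 tangent to the plane at the origin;
  the chordal metric is the Euclidean distance between the projected points.\<close>

fun stereo :: "riemann_sphere \<Rightarrow> complex \<times> real" where
  "stereo (Fin z) = (z /\<^sub>R (1 + (cmod z)\<^sup>2), (cmod z)\<^sup>2 / (1 + (cmod z)\<^sup>2))"
| "stereo Infty = (0, 1)"

fun chordal :: "riemann_sphere \<Rightarrow> riemann_sphere \<Rightarrow> real" where
  "chordal (Fin z) (Fin w) = cmod (z - w) / (sqrt (1 + (cmod z)\<^sup>2) * sqrt (1 + (cmod w)\<^sup>2))"
| "chordal (Fin z) Infty = 1 / sqrt (1 + (cmod z)\<^sup>2)"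
| "chordal Infty (Fin w) = 1 / sqrt (1 + (cmod w)\<^sup>2)"
| "chordal Infty Infty = 0"

lemma chordal_commute: "chordal p q = chordal q p"
  by (cases p; cases q) (simp_all add: norm_minus_commute mult.commute)

lemma chordal_eq_0_iff: "chordal p q = 0 \<longleftrightarrow> p = q"
proof -
  have "1 + (cmod z)\<^sup>2 \<noteq> 0" for z :: complex
    by (smt (verit) zero_le_power2)
  then show ?thesis
    by (cases p; cases q) auto
qed

lemma chordal_conv_stereo: "chordal p q = dist (stereo p) (stereo q)"
proof -
  have pos: "1 + (cmod z)\<^sup>2 > 0" for z :: complex
    by (smt (verit) zero_le_power2)
  have inf: "1 / sqrt (1 + (cmod z)\<^sup>2) = dist (stereo (Fin z)) (stereo Infty)" for z
  proof -
    define A where "A = 1 + (cmod z)\<^sup>2"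
    have A: "A > 0" "(cmod z)\<^sup>2 = A - 1" using pos[of z] by (auto simp: A_def)
    have "(dist (stereo (Fin z)) (stereo Infty))\<^sup>2 = (cmod z)\<^sup>2 / A\<^sup>2 + ((cmod z)\<^sup>2 / A - 1)\<^sup>2"
      using A(1) by (simp add: dist_Pair_Pair A_def[symmetric] dist_complex_def dist_real_def power_divide power_mult_distrib divide_inverse power_inverse mult.commute)
    also have "\<dots> = 1 / A"
      using A(1) unfolding A(2) by (simp add: field_simps power2_eq_square)
    finally have "(dist (stereo (Fin z)) (stereo Infty))\<^sup>2 = 1 / A" .
    then have "dist (stereo (Fin z)) (stereo Infty) = sqrt (1 / A)"
      by (metis real_sqrt_unique zero_le_dist)
    then show ?thesis by (simp add: A_def real_sqrt_divide)
  qed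
  have fin: "chordal (Fin z) (Fin w) = dist (stereo (Fin z)) (stereo (Fin w))" for z w
  proof -
    define A where "A = 1 + (cmod z)\<^sup>2"
    define B where "B = 1 + (cmod w)\<^sup>2"
    have A: "A > 0" "(cmod z)\<^sup>2 = A - 1" using pos[of z] by (auto simp: A_def)
    have B: "B > 0" "(cmod w)\<^sup>2 = B - 1" using pos[of w] by (auto simp: B_def)
    have nd: "(cmod (x - y))\<^sup>2 = (cmod x)\<^sup>2 + (cmod y)\<^sup>2 - 2 * inner x y" for x y
      by (simp add: power2_norm_eq_inner inner_diff_left inner_diff_right inner_commute)
    have n1: "(cmod (z /\<^sub>R A - w /\<^sub>R B))\<^sup>2
               = (A - 1) / A\<^sup>2 + (B - 1) / B\<^sup>2 - 2 * inner z w / (A * B)"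
      unfolding nd using A(1) B(1)
      by (simp add: power_mult_distrib A(2) B(2) divide_inverse power_inverse mult.commute)
    have n2: "(cmod (z - w))\<^sup>2 = (A - 1) + (B - 1) - 2 * inner z w"
      by (simp add: nd A(2) B(2))
    have "(dist (stereo (Fin z)) (stereo (Fin w)))\<^sup>2
        = (cmod (z /\<^sub>R A - w /\<^sub>R B))\<^sup>2 + ((A - 1) / A - (B - 1) / B)\<^sup>2"
      by (simp add: dist_Pair_Pair A_def[symmetric] B_def[symmetric] A(2) B(2) dist_complex_def dist_real_def)
    also have "\<dots> = (cmod (z - w))\<^sup>2 / (A * B)"
      unfolding n1 n2 using A(1) B(1) by (simp add: field_simps power2_eq_square)
    finally have "(dist (stereo (Fin z)) (stereo (Fin w)))\<^sup>2 = (cmod (z - w))\<^sup>2 / (A * B)" .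
    then have "dist (stereo (Fin z)) (stereo (Fin w)) = sqrt ((cmod (z - w))\<^sup>2 / (A * B))"
      by (metis real_sqrt_unique zero_le_dist)
    then show ?thesis by (simp add: A_def B_def real_sqrt_divide real_sqrt_mult)
  qed
  show ?thesis
    using inf fin by (cases p; cases q) (simp_all add: dist_commute del: stereo.simps)
qed

instantiation riemann_sphere :: metric_space
begin

definition dist_riemann_sphere :: "riemann_sphere \<Rightarrow> riemann_sphere \<Rightarrow> real" where
  "dist_riemann_sphere = chordal"

definition uniformity_riemann_sphere :: "(riemann_sphere \<times> riemann_sphere) filter" where
  "uniformity_riemann_sphere = (INF e\<in>{0<..}. principal {(p, q). dist p q < e})"

definition open_riemann_sphere :: "riemann_sphere set \<Rightarrow> bool" where
  "open_riemann_sphere U \<longleftrightarrow>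
     (\<forall>p\<in>U. eventually (\<lambda>(p', q). p' = p \<longrightarrow> q \<in> U) uniformity)"

instance
proof
  fix p q r :: riemann_sphere
  show "dist p q = 0 \<longleftrightarrow> p = q"
    by (simp add: dist_riemann_sphere_def chordal_eq_0_iff)
  show "dist p q \<le> dist p r + dist q r"
    by (simp add: dist_riemann_sphere_def chordal_conv_stereo dist_triangle2)
qed (simp_all add: uniformity_riemann_sphere_def open_riemann_sphere_def)

end

text \<open>The sphere-valued map of a meromorphic function. The library's
  \<open>nicely_meromorphic_on\<close> stores the dummy value 0 at a pole, which must not be mistaken for a zero.\<close>

definition sphere_value :: "(complex \<Rightarrow> complex) \<Rightarrow> complex \<Rightarrow> riemann_sphere" where
  "sphere_value f z = (if is_pole f z then Infty else Fin (f z))"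

definition normal_family :: "complex set \<Rightarrow> (complex \<Rightarrow> complex) set \<Rightarrow> bool" where
  "normal_family D \<F> \<longleftrightarrow>
     (\<forall>f :: nat \<Rightarrow> complex \<Rightarrow> complex. range f \<subseteq> \<F> \<longrightarrow>
       (\<exists>(r :: nat \<Rightarrow> nat) (g :: complex \<Rightarrow> riemann_sphere).
          strict_mono r \<and>
          ((\<exists>h. h nicely_meromorphic_on D \<and> (\<forall>z\<in>D. g z = sphere_value h z)) \<or>
           (\<forall>z\<in>D. g z = Infty)) \<and>
          (\<forall>C. compact C \<and> C \<subseteq> D \<longrightarrow>
             uniform_limit C (\<lambda>n. sphere_value (f (r n))) g sequentially)))"

end

theory Submission imports Defs "HOL-Real_Asymp.Real_Asymp" begin

text \<open>
  Suppose the spherical derivatives of the family are not locally bounded. A Zalcman--Pang rescaling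
  \<open>g n w = f n (z n + \<rho> n * w) / \<rho> n\<close> converges spherically, with bounded spherical derivatives that
  exceed \<open>\<bar>b\<bar>\<close> and \<open>K\<close> at the origin. Where \<open>g n\<close> takes the value \<open>a / \<rho> n\<close> its derivative is
  \<open>b\<close>, so with \<open>k = 1 / g\<close> the quotient \<open>(k n' + b (k n)\<^sup>2) / (k n - \<rho> n / a)\<close> is holomorphic
  near a pole of the limit; its limit \<open>k' / k + b k\<close> would have a pole there, so the limit \<open>g\<close> is
  entire. Since \<open>a / \<rho> n\<close> tends to infinity, \<open>g'\<close> omits \<open>b\<close>, and \<open>g\<close> has exponential type, hence
  \<open>g' = b + exp (\<alpha> z + \<beta>)\<close>. A bounded spherical derivative forces \<open>\<alpha> = 0\<close>; then \<open>g\<close> is linear,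
  has a zero, and the bound \<open>K\<close> on the derivative at zeros contradicts the normalisation at the origin.
\<close>

section \<open>Spherical Lipschitz bounds and subsequences\<close>

text \<open>Dividing the rescaled function by \<rho> leaves its first derivative unchanged, so the
  conditions on \<open>f'\<close> survive the rescaling while the shared value \<open>a\<close> is
  pushed to infinity. The price is that the natural measure of concentration could blow up at zeros
  of \<open>f\<close>; the bound on the derivative at zeros is what prevents this
  (\<open>concentration_continuous\<close>), and it is needed a second time at the zero of the
  linear limit. Both bounds are merged into one constant \<open>L = max K (cmod b)\<close>, and the
  normalisation at the origin is \<open>L + 1\<close>. The gap between the two serves three times:
  it makes the concentration vanish near zeros of \<open>f\<close>, it keeps the derivative of the
  limit from being identically \<open>b\<close>, and it refutes the linear limit. Poles are treated
  through reciprocals. Since inversion is an isometry of the sphere, every local statement is proved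
  in the finite chart and transported to the chart at infinity. The exponential type of the limit is
  the Clunie-Hayman theorem, proved here from a Harnack estimate.\<close>

fun sphere_inverse :: "riemann_sphere \<Rightarrow> riemann_sphere" where
  "sphere_inverse (Fin z) = (if z = 0 then Infty else Fin (inverse z))"
| "sphere_inverse Infty = Fin 0"

text \<open>The value 0 at \<open>Infty\<close> matches the convention of \<open>nicely_meromorphic_on\<close> for poles.\<close>

fun fin_part :: "riemann_sphere \<Rightarrow> complex" where
  "fin_part (Fin z) = z"
| "fin_part Infty = 0"

lemma fin_part_sphere_inverse: "fin_part (sphere_inverse p) = inverse (fin_part p)"
  by (cases p) auto

lemma one_plus_cmod_pos [simp]: "0 < 1 + (cmod z)\<^sup>2"
  by (simp add: add_pos_nonneg)

lemma sqrt_one_plus_inverse: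
  assumes "z \<noteq> 0"
  shows "sqrt (1 + (cmod (inverse z))\<^sup>2) = sqrt (1 + (cmod z)\<^sup>2) / cmod z"
proof -
  have *: "(cmod (inverse z))\<^sup>2 * (cmod z)\<^sup>2 = 1"
    by (simp only: power_mult_distrib [symmetric] norm_mult [symmetric] left_inverse [OF assms] norm_one power_one)
  have "1 + (cmod (inverse z))\<^sup>2 = (1 + (cmod z)\<^sup>2) / (cmod z)\<^sup>2"
    using * assms by (simp add: nonzero_eq_divide_eq distrib_right)
  then show ?thesis by (simp add: real_sqrt_divide)
qed

lemma dist_Fin: "dist (Fin z) (Fin w) = cmod (z - w) / (sqrt (1 + (cmod z)\<^sup>2) * sqrt (1 + (cmod w)\<^sup>2))"
  by (simp add: dist_riemann_sphere_def)

text \<open>Inversion is a rotation of the sphere. Limits and dilatations near a pole therefore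
  reduce to those of the reciprocal near a zero.\<close>

lemma dist_sphere_inverse [simp]: "dist (sphere_inverse p) (sphere_inverse q) = dist p q"
proof -
  have fin: "dist (sphere_inverse (Fin z)) (sphere_inverse (Fin w)) = dist (Fin z) (Fin w)" for z w
  proof (cases "z = 0 \<or> w = 0")
    case False
    have "cmod (inverse z - inverse w) = cmod (z - w) / (cmod z * cmod w)"
      using False by (simp add: inverse_diff_inverse norm_mult norm_inverse norm_minus_commute divide_inverse)
    moreover have "dist (sphere_inverse (Fin z)) (sphere_inverse (Fin w)) = cmod (inverse z - inverse w) /
        ((sqrt (1 + (cmod z)\<^sup>2) / cmod z) * (sqrt (1 + (cmod w)\<^sup>2) / cmod w))"
      using False sqrt_one_plus_inverse[of z] sqrt_one_plus_inverse[of w] by (simp add: dist_Fin)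
    ultimately show ?thesis using False by (simp add: dist_Fin)
  qed (auto simp: dist_riemann_sphere_def sqrt_one_plus_inverse simp del: norm_inverse)
  have inf: "dist (sphere_inverse (Fin z)) (sphere_inverse Infty) = dist (Fin z) Infty" for z
  proof (cases "z = 0")
    case False
    have "dist (sphere_inverse (Fin z)) (sphere_inverse Infty) = cmod (inverse z) / sqrt (1 + (cmod (inverse z))\<^sup>2)"
      using False by (simp add: dist_riemann_sphere_def)
    also have "\<dots> = dist (Fin z) Infty"
      unfolding sqrt_one_plus_inverse [OF False] using False by (simp add: dist_riemann_sphere_def norm_inverse)
    finally show ?thesis .
  qed (simp add: dist_riemann_sphere_def)
  show ?thesis
    using fin inf by (cases p; cases q) (simp_all add: dist_commute del: sphere_inverse.simps)
qed

lemma uniform_limit_sphere_inverse: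
  "uniform_limit S F G L \<Longrightarrow> uniform_limit S (\<lambda>n z. sphere_inverse (F n z)) (\<lambda>z. sphere_inverse (G z)) L"
  by (simp add: uniform_limit_iff)

section \<open>Compactness of the sphere\<close>

lemma dist_stereo: "dist (stereo p) (stereo q) = dist p q"
  by (simp add: dist_riemann_sphere_def chordal_conv_stereo)

lemma sq_le_self_imp_le_one:
  fixes t :: real
  assumes "t\<^sup>2 \<le> t"
  shows "t \<le> 1"
proof (rule ccontr)
  assume "\<not> t \<le> 1"
  then have "t * 1 < t * t" by (intro mult_strict_left_mono) auto
  then show False using assms by (simp add: power2_eq_square)
qed

text \<open>The equation describes the sphere with centre \<open>(0, 1/2)\<close> and radius 1/2;
  the north pole \<open>(0, 1)\<close> is the image of \<open>Infty\<close>.\<close>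

lemma range_stereo: "range stereo = {(w, t). (cmod w)\<^sup>2 + t\<^sup>2 = t}"
proof (intro set_eqI iffI)
  fix x assume "x \<in> range stereo"
  then obtain p where p: "x = stereo p" by auto
  show "x \<in> {(w, t). (cmod w)\<^sup>2 + t\<^sup>2 = t}"
  proof (cases p)
    case (Fin z)
    define A where "A = 1 + (cmod z)\<^sup>2"
    have A: "A > 0" "(cmod z)\<^sup>2 = A - 1" by (auto simp: A_def)
    show ?thesis
      unfolding p Fin stereo.simps A_def[symmetric]
      using A(1) unfolding A(2) by (simp add: A(2) power_mult_distrib power_inverse) (simp add: field_simps power2_eq_square)
  qed (simp add: p)
next
  fix x :: "complex \<times> real" assume "x \<in> {(w, t). (cmod w)\<^sup>2 + t\<^sup>2 = t}"
  then obtain w t where x: "x = (w, t)" and wt: "(cmod w)\<^sup>2 + t\<^sup>2 = t" by auto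
  show "x \<in> range stereo"
  proof (cases "t = 1")
    case True
    then have "x = stereo Infty" using wt x by simp
    then show ?thesis by blast
  next
    case False
    have t: "t < 1" using sq_le_self_imp_le_one [of t] wt False zero_le_power2 [of "cmod w"] by linarith
    \<comment> \<open>The line from the north pole through \<open>(w, t)\<close> meets the plane in
      this point.\<close>
    define z where "z = w /\<^sub>R (1 - t)"
    have "(cmod z)\<^sup>2 = (cmod w)\<^sup>2 / (1 - t)\<^sup>2"
      by (simp add: z_def power_mult_distrib divide_inverse power_inverse mult.commute)
    also have "(cmod w)\<^sup>2 = t * (1 - t)" using wt by (simp add: algebra_simps power2_eq_square)
    finally have z2: "(cmod z)\<^sup>2 = t / (1 - t)" using t by (simp add: power2_eq_square)
    then have "1 + (cmod z)\<^sup>2 = 1 / (1 - t)" using t by (simp add: field_simps)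
    then have "stereo (Fin z) = x" using t z2 by (simp add: x) (simp add: z_def)
    then show ?thesis by blast
  qed
qed

text \<open>Closedness ensures that limits formed in the ambient Euclidean space are again points of
  the sphere.\<close>

lemma closed_range_stereo: "closed (range stereo)"
proof -
  have "range stereo = {x. (cmod (fst x))\<^sup>2 + (snd x)\<^sup>2 = snd x}"
    unfolding range_stereo by auto
  then show ?thesis
    by (simp add: closed_Collect_eq continuous_intros)
qed

lemma norm_stereo_le: "norm (stereo p) \<le> 1"
proof -
  have "stereo p \<in> range stereo" by blast
  then obtain w t where s: "stereo p = (w, t)" and wt: "(cmod w)\<^sup>2 + t\<^sup>2 = t"
    unfolding range_stereo by auto
  have "t \<le> 1" using sq_le_self_imp_le_one [of t] wt zero_le_power2 [of "cmod w"] by linarith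
  then show ?thesis using s wt by (simp add: norm_Pair)
qed

text \<open>Arzela-Ascoli is applied to the projected maps, which are uniformly bounded, and the
  limit is pulled back to the sphere. The Lipschitz bound is asked only for close pairs because
  \<open>C\<close> need not be convex.\<close>

lemma equi_Lipschitz_subsequence:
  fixes H :: "nat \<Rightarrow> complex \<Rightarrow> riemann_sphere"
  assumes "compact C" "\<delta> > 0"
    and lip: "\<And>n x y. x \<in> C \<Longrightarrow> y \<in> C \<Longrightarrow> dist x y < \<delta> \<Longrightarrow> dist (H n x) (H n y) \<le> M * dist x y"
  shows "\<exists>k g. strict_mono (k :: nat \<Rightarrow> nat) \<and> uniform_limit C (\<lambda>n. H (k n)) g sequentially"
proof -
  obtain g k where k: "continuous_on C g" "strict_mono (k :: nat \<Rightarrow> nat)"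
    and lim: "\<And>e. 0 < e \<Longrightarrow> \<exists>N. \<forall>n x. n \<ge> N \<and> x \<in> C \<longrightarrow> norm (stereo (H (k n) x) - g x) < e"
  proof (rule Arzela_Ascoli [of C "\<lambda>n x. stereo (H n x)" 1])
    fix x and e :: real assume x: "x \<in> C" "0 < e"
    \<comment> \<open>The denominator \<open>\<bar>M\<bar> + 1\<close> covers
      \<open>M \<le> 0\<close> as well.\<close>
    define d where "d = min \<delta> (e / (\<bar>M\<bar> + 1))"
    have "norm (stereo (H n x) - stereo (H n y)) < e" if "y \<in> C" "norm (x - y) < d" for n y
    proof -
      have "dist (H n x) (H n y) \<le> M * dist x y"
        using lip x that by (simp add: d_def dist_norm)
      also have "\<dots> \<le> (\<bar>M\<bar> + 1) * dist x y" by (intro mult_right_mono) auto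
      also have "\<dots> < e" using that by (simp add: d_def dist_norm field_simps)
      finally show ?thesis by (simp add: dist_stereo flip: dist_norm)
    qed
    moreover have "d > 0" using x assms by (simp add: d_def)
    ultimately show "\<exists>d>0. \<forall>n y. y \<in> C \<and> norm (x - y) < d \<longrightarrow> norm (stereo (H n x) - stereo (H n y)) < e"
      by blast
  qed (use assms norm_stereo_le in auto)
  have "\<exists>p. stereo p = g x" if "x \<in> C" for x
  proof -
    have "(\<lambda>n. stereo (H (k n) x)) \<longlonglongrightarrow> g x"
      using lim that unfolding LIMSEQ_iff by blast
    then have "g x \<in> range stereo"
      by (rule closed_sequentially [OF closed_range_stereo, rotated]) auto
    then show ?thesis by auto
  qed
  then obtain g' where g': "\<And>x. x \<in> C \<Longrightarrow> stereo (g' x) = g x" by metis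
  have "uniform_limit C (\<lambda>n. H (k n)) g' sequentially"
    unfolding uniform_limit_iff
  proof (intro allI impI)
    fix e :: real assume "e > 0"
    then obtain N where N: "\<And>n x. n \<ge> N \<Longrightarrow> x \<in> C \<Longrightarrow> norm (stereo (H (k n) x) - g x) < e"
      using lim by blast
    show "\<forall>\<^sub>F n in sequentially. \<forall>x\<in>C. dist (H (k n) x) (g' x) < e"
    proof (intro eventually_sequentiallyI [of N] ballI)
      fix n x assume "N \<le> n" "x \<in> C"
      then show "dist (H (k n) x) (g' x) < e"
        using N[of n x] g'[of x] dist_stereo [of "H (k n) x" "g' x"] by (simp add: dist_norm)
    qed
  qed
  then show ?thesis using k by blast
qed

section \<open>Metric form of the spherical derivative and Marty's criterion\<close>

text \<open>For a meromorphic function this bounds the spherical derivative by \<open>M\<close>. The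
  metric formulation needs no separate formula at poles and is invariant under
  \<open>sphere_inverse\<close>.\<close>

definition dilatation_le :: "(complex \<Rightarrow> riemann_sphere) \<Rightarrow> complex \<Rightarrow> real \<Rightarrow> bool" where
  "dilatation_le G z M \<longleftrightarrow> (\<forall>e>0. \<forall>\<^sub>F w in at z. dist (G w) (G z) \<le> (M + e) * dist w z)"

lemma dilatation_le_mono: "dilatation_le G z M \<Longrightarrow> M \<le> M' \<Longrightarrow> dilatation_le G z M'"
  unfolding dilatation_le_def
proof (intro allI impI)
  fix e :: real
  assume *: "\<forall>e>0. \<forall>\<^sub>F w in at z. dist (G w) (G z) \<le> (M + e) * dist w z" "M \<le> M'" "e > 0"
  then have "\<forall>\<^sub>F w in at z. dist (G w) (G z) \<le> (M + e) * dist w z" by blast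
  then show "\<forall>\<^sub>F w in at z. dist (G w) (G z) \<le> (M' + e) * dist w z"
  proof eventually_elim
    case (elim w)
    also have "(M + e) * dist w z \<le> (M' + e) * dist w z" using * by (intro mult_right_mono) auto
    finally show ?case .
  qed
qed

lemma dilatation_le_cong:
  assumes "\<forall>\<^sub>F w in nhds z. G w = H w"
  shows "dilatation_le G z M \<longleftrightarrow> dilatation_le H z M"
proof -
  have "G z = H z" using assms by (rule eventually_nhds_x_imp_x)
  moreover have "\<forall>\<^sub>F w in at z. G w = H w"
    using assms by (simp add: eventually_nhds_conv_at)
  ultimately show ?thesis
    unfolding dilatation_le_def
    by (intro all_cong1 imp_cong refl eventually_subst) (auto elim: eventually_mono)
qed

lemma dilatation_le_sphere_inverse:
  "dilatation_le (\<lambda>z. sphere_inverse (G z)) z M \<longleftrightarrow> dilatation_le G z M"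
  by (simp add: dilatation_le_def)

text \<open>The chordal metric has the line element
  \<open>\<bar>dz\<bar> / (1 + \<bar>z\<bar>\<^sup>2)\<close>, so the difference quotient tends to
  the usual spherical derivative.\<close>

lemma dilatation_le_Fin:
  assumes "(u has_field_derivative u') (at z)"
  shows "dilatation_le (\<lambda>w. Fin (u w)) z (cmod u' / (1 + (cmod (u z))\<^sup>2))"
  unfolding dilatation_le_def
proof (intro allI impI)
  fix e :: real assume "e > 0"
  have cont: "isCont u z" using assms DERIV_isCont by blast
  have "((\<lambda>w. cmod ((u w - u z) / (w - z)) / (sqrt (1 + (cmod (u w))\<^sup>2) * sqrt (1 + (cmod (u z))\<^sup>2)))
     \<longlongrightarrow> cmod u' / (sqrt (1 + (cmod (u z))\<^sup>2) * sqrt (1 + (cmod (u z))\<^sup>2))) (at z)"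
    using assms cont
    by (intro tendsto_intros) (auto simp: has_field_derivative_iff isCont_def add_nonneg_eq_0_iff)
  then have "((\<lambda>w. dist (Fin (u w)) (Fin (u z)) / dist w z)
     \<longlongrightarrow> cmod u' / (1 + (cmod (u z))\<^sup>2)) (at z)"
    by (simp add: dist_Fin norm_divide dist_norm divide_simps mult.commute)
  then have "\<forall>\<^sub>F w in at z. dist (Fin (u w)) (Fin (u z)) / dist w z < cmod u' / (1 + (cmod (u z))\<^sup>2) + e"
    using \<open>e > 0\<close> by (intro order_tendstoD) auto
  moreover have "\<forall>\<^sub>F w in at z. w \<noteq> z" by (simp add: eventually_at_filter)
  ultimately show "\<forall>\<^sub>F w in at z. dist (Fin (u w)) (Fin (u z)) \<le> (cmod u' / (1 + (cmod (u z))\<^sup>2) + e) * dist w z"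
  proof eventually_elim
    case (elim w)
    then have "dist w z > 0" by simp
    then show "dist (Fin (u w)) (Fin (u z)) \<le> (cmod u' / (1 + (cmod (u z))\<^sup>2) + e) * dist w z"
      using elim(1) by (metis pos_divide_less_eq less_imp_le)
  qed
qed

text \<open>The pointwise bound is added up along the segment from \<open>x\<close> to
  \<open>y\<close>. As \<open>G\<close> takes values in a metric space, bisection replaces the mean
  value theorem; the slack \<open>e\<close> makes each local estimate hold on a whole
  neighbourhood.\<close>

lemma dilatation_le_imp_Lipschitz:
  assumes "convex S" "\<And>z. z \<in> S \<Longrightarrow> dilatation_le G z M" and xy: "x \<in> S" "y \<in> S"
  shows "dist (G x) (G y) \<le> M * dist x y"
proof (cases "x = y")
  case False
  define p where "p = (\<lambda>t. x + t *\<^sub>R (y - x))"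
  have pd: "dist (p s) (p t) = \<bar>s - t\<bar> * dist x y" for s t
  proof -
    have "p s - p t = (s - t) *\<^sub>R (y - x)" by (simp add: p_def algebra_simps)
    then show ?thesis by (simp add: dist_norm norm_minus_commute)
  qed
  have pS: "p t \<in> S" if "0 \<le> t" "t \<le> 1" for t
  proof -
    have "p t = (1 - t) *\<^sub>R x + t *\<^sub>R y" by (simp add: p_def algebra_simps)
    then show ?thesis using assms that by (simp add: convexD)
  qed
  have *: "dist (G x) (G y) \<le> (M + e) * dist x y" if "e > 0" for e
  proof -
    have "dist (G (p 0)) (G (p 1)) \<le> (M + e) * (1 - 0) * dist x y"
    \<comment> \<open>The inequality is additive over adjacent parameter intervals. On a short
      interval containing \<open>t\<close> it holds because both endpoints are compared with
      \<open>p t\<close>, and their distances to it add up to the length.\<close>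
    proof (rule Bolzano [where P = "\<lambda>a b. dist (G (p a)) (G (p b)) \<le> (M + e) * (b - a) * dist x y"])
      fix a b c :: real
      assume "dist (G (p a)) (G (p b)) \<le> (M + e) * (b - a) * dist x y"
        "dist (G (p b)) (G (p c)) \<le> (M + e) * (c - b) * dist x y"
      then have "dist (G (p a)) (G (p c)) \<le> (M + e) * (b - a) * dist x y + (M + e) * (c - b) * dist x y"
        using dist_triangle [of "G (p a)" "G (p c)" "G (p b)"] by linarith
      then show "dist (G (p a)) (G (p c)) \<le> (M + e) * (c - a) * dist x y"
        by (simp add: algebra_simps)
    next
      fix t :: real
      assume "0 \<le> t" "t \<le> 1"
      then have "dilatation_le G (p t) M" using assms pS by auto
      then have "\<forall>\<^sub>F w in at (p t). dist (G w) (G (p t)) \<le> (M + e) * dist w (p t)"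
        using that by (simp add: dilatation_le_def)
      then obtain d where d: "d > 0"
        "\<And>w. w \<noteq> p t \<Longrightarrow> dist w (p t) < d \<Longrightarrow> dist (G w) (G (p t)) \<le> (M + e) * dist w (p t)"
        unfolding eventually_at by blast
      then have d': "dist (G w) (G (p t)) \<le> (M + e) * dist w (p t)" if "dist w (p t) < d" for w
        using that by (cases "w = p t") auto
      have "dist (G (p a)) (G (p b)) \<le> (M + e) * (b - a) * dist x y"
        if "a \<le> t" "t \<le> b" "b - a < d / dist x y" for a b
      proof -
        have bd: "(b - a) * dist x y < d" using that False by (simp add: pos_less_divide_eq)
        have "dist (p a) (p t) \<le> (b - a) * dist x y" "dist (p b) (p t) \<le> (b - a) * dist x y"
          using that unfolding pd by (intro mult_right_mono; simp)+
        then have "dist (p a) (p t) < d" "dist (p b) (p t) < d" using bd by auto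
        then have "dist (G (p a)) (G (p t)) \<le> (M + e) * dist (p a) (p t)"
          "dist (G (p b)) (G (p t)) \<le> (M + e) * dist (p b) (p t)"
          using d' by blast+
        moreover have "dist (G (p a)) (G (p b)) \<le> dist (G (p a)) (G (p t)) + dist (G (p b)) (G (p t))"
          by (rule dist_triangle2)
        ultimately have "dist (G (p a)) (G (p b)) \<le> (M + e) * dist (p a) (p t) + (M + e) * dist (p b) (p t)"
          by linarith
        also have "\<dots> = (M + e) * (b - a) * dist x y"
          using that unfolding pd by (simp add: algebra_simps)
        finally show ?thesis .
      qed
      moreover have "d / dist x y > 0" using d False by simp
      ultimately show "\<exists>d>0. \<forall>a b. a \<le> t \<and> t \<le> b \<and> b - a < d \<longrightarrow>
          dist (G (p a)) (G (p b)) \<le> (M + e) * (b - a) * dist x y"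
        by blast
    qed simp
    moreover have "p 0 = x" "p 1 = y" by (auto simp: p_def)
    ultimately show ?thesis by simp
  qed
  show ?thesis
  proof (rule field_le_epsilon)
    fix e :: real assume "e > 0"
    then have "dist (G x) (G y) \<le> (M + e / dist x y) * dist x y"
      using False by (intro *) auto
    then show "dist (G x) (G y) \<le> M * dist x y + e"
      using False by (simp add: algebra_simps)
  qed
qed auto

text \<open>The bound is required only for large \<open>n\<close>, depending on \<open>C\<close>:
  rescaled functions are controlled on a given compact set only from some index on.\<close>

theorem Marty_subsequence:
  fixes G :: "nat \<Rightarrow> complex \<Rightarrow> riemann_sphere"
  assumes "open D"
    and bound: "\<And>C. compact C \<Longrightarrow> C \<subseteq> D \<Longrightarrow> \<exists>M. \<forall>\<^sub>F n in sequentially. \<forall>z\<in>C. dilatation_le (G n) z M"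
  obtains r g where "strict_mono (r :: nat \<Rightarrow> nat)"
    "\<And>C. compact C \<Longrightarrow> C \<subseteq> D \<Longrightarrow> uniform_limit C (\<lambda>n. G (r n)) g sequentially"
proof -
  obtain K where K: "\<And>i::nat. compact (K i)" "\<And>i. K i \<subseteq> D"
    and subK: "\<And>X. compact X \<Longrightarrow> X \<subseteq> D \<Longrightarrow> \<exists>N. \<forall>n\<ge>N. X \<subseteq> K n"
    using open_Union_compact_subsets [OF \<open>open D\<close>] by metis
  have "\<exists>\<delta> M N. \<delta> > 0 \<and> (\<forall>n\<ge>N. \<forall>x\<in>K i. \<forall>y\<in>K i. dist x y < \<delta> \<longrightarrow> dist (G n x) (G n y) \<le> M * dist x y)" for i
  proof -
    obtain d where d: "d > 0" "\<And>x y. x \<in> K i \<Longrightarrow> y \<in> - D \<Longrightarrow> d \<le> dist x y"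
    proof -
      have "\<exists>d>0. \<forall>x\<in>K i. \<forall>y\<in>- D. d \<le> dist x y"
        using K[of i] \<open>open D\<close> by (intro separate_compact_closed) auto
      then show ?thesis using that by auto
    qed
    \<comment> \<open>A compact neighbourhood of \<open>K i\<close> inside \<open>D\<close>. It
      contains the discs of radius \<open>d / 2\<close> about points of \<open>K i\<close>, and
      these are convex, so the dilatation bound becomes a Lipschitz bound.\<close>
    define C where "C = {x + y | x y. x \<in> K i \<and> y \<in> cball 0 (d / 2)}"
    have "compact C" unfolding C_def by (intro compact_sums K compact_cball)
    moreover have "C \<subseteq> D"
    proof
      fix z assume "z \<in> C"
      then obtain x y where "x \<in> K i" "norm y \<le> d / 2" "z = x + y" by (auto simp: C_def)
      then have "dist x z < d" using d(1) by (simp add: dist_norm)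
      then show "z \<in> D" using d(2)[of x z] \<open>x \<in> K i\<close> by fastforce
    qed
    ultimately obtain M N where MN: "\<And>n z. n \<ge> N \<Longrightarrow> z \<in> C \<Longrightarrow> dilatation_le (G n) z M"
      using bound unfolding eventually_sequentially by metis
    have "dist (G n x) (G n y) \<le> M * dist x y"
      if n: "n \<ge> N" and xy: "x \<in> K i" "y \<in> K i" "dist x y < d / 2" for n x y
    proof (rule dilatation_le_imp_Lipschitz [of "cball x (d / 2)"])
      fix z assume "z \<in> cball x (d / 2)"
      then have "z = x + (z - x) \<and> x \<in> K i \<and> z - x \<in> cball 0 (d / 2)"
        using xy by (auto simp: dist_norm norm_minus_commute)
      then have "z \<in> C" unfolding C_def by blast
      then show "dilatation_le (G n) z M" using MN n by blast
    qed (use xy d in auto)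
    then show ?thesis using d(1) by (intro exI [of _ "d / 2"] exI [of _ M] exI [of _ N]) auto
  qed
  then obtain \<delta> M N where \<delta>: "\<And>i. \<delta> i > 0"
    and lip: "\<And>i n x y. n \<ge> N i \<Longrightarrow> x \<in> K i \<Longrightarrow> y \<in> K i \<Longrightarrow> dist x y < \<delta> i \<Longrightarrow>
        dist (G n x) (G n y) \<le> M i * dist x y"
    by metis
  \<comment> \<open>The finitely many functions without a bound on \<open>K i\<close> are replaced
    by a constant, so that the Lipschitz estimate holds for every index.\<close>
  define H where "H = (\<lambda>i n. if N i \<le> n then G n else (\<lambda>_. Infty))"
  have lipH: "dist (H i n x) (H i n y) \<le> max 0 (M i) * dist x y"
    if "x \<in> K i" "y \<in> K i" "dist x y < \<delta> i" for i n x y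
  proof (cases "N i \<le> n")
    case True
    have "dist (G n x) (G n y) \<le> M i * dist x y" using lip that True by blast
    also have "\<dots> \<le> max 0 (M i) * dist x y" by (intro mult_right_mono) auto
    finally show ?thesis using True by (simp add: H_def)
  qed (simp add: H_def)
  obtain k where k: "strict_mono (k :: nat \<Rightarrow> nat)"
    "\<And>i. \<exists>g. uniform_limit (K i) (\<lambda>n. H i ((id \<circ> k) n)) g sequentially"
  proof (rule subsequence_diagonalization_lemma
      [of "\<lambda>i r. \<exists>g. uniform_limit (K i) (\<lambda>n. H i (r n)) g sequentially" id])
    fix i and r :: "nat \<Rightarrow> nat"
    show "\<exists>k. strict_mono (k :: nat \<Rightarrow> nat) \<and> (\<exists>g. uniform_limit (K i) (\<lambda>n. H i ((r \<circ> k) n)) g sequentially)"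
      using equi_Lipschitz_subsequence [of "K i" "\<delta> i" "\<lambda>n. H i (r n)", OF K(1) \<delta> lipH]
      by (auto simp: o_def)
  next
    fix i N and r k1 k2 :: "nat \<Rightarrow> nat"
    assume "\<exists>g. uniform_limit (K i) (\<lambda>n. H i ((r \<circ> k1) n)) g sequentially"
      and k12: "\<And>j. N \<le> j \<Longrightarrow> \<exists>j'\<ge>j. k2 j = k1 j'"
    then obtain g where g: "uniform_limit (K i) (\<lambda>n. H i ((r \<circ> k1) n)) g sequentially" by blast
    have "uniform_limit (K i) (\<lambda>n. H i ((r \<circ> k2) n)) g sequentially"
      unfolding uniform_limit_iff
    proof (intro allI impI)
      fix e :: real assume "e > 0"
      then obtain N' where N': "\<And>n. n \<ge> N' \<Longrightarrow> \<forall>x\<in>K i. dist (H i ((r \<circ> k1) n) x) (g x) < e"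
        using g unfolding uniform_limit_iff eventually_sequentially by blast
      show "\<forall>\<^sub>F n in sequentially. \<forall>x\<in>K i. dist (H i ((r \<circ> k2) n) x) (g x) < e"
      proof (rule eventually_sequentiallyI [of "max N N'"])
        fix n assume n: "max N N' \<le> n"
        then obtain n' where "n' \<ge> n" "k2 n = k1 n'" using k12[of n] by auto
        then show "\<forall>x\<in>K i. dist (H i ((r \<circ> k2) n) x) (g x) < e" using N'[of n'] n by simp
      qed
    qed
    then show "\<exists>g. uniform_limit (K i) (\<lambda>n. H i ((r \<circ> k2) n)) g sequentially" by blast
  qed blast
  have "\<exists>g. uniform_limit (K i) (\<lambda>n. G (k n)) g sequentially" for i
  proof -
    obtain g where g: "uniform_limit (K i) (\<lambda>n. H i (k n)) g sequentially"
      using k(2)[of i] by (simp only: o_def id_def) blast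
    have "\<forall>\<^sub>F n in sequentially. \<forall>x\<in>K i. H i (k n) x = G (k n) x"
      using seq_suble [OF k(1)] by (intro eventually_sequentiallyI [of "N i"]) (auto simp: H_def intro: order_trans)
    then have "uniform_limit (K i) (\<lambda>n. G (k n)) g sequentially"
      by (rule uniform_limit_cong [THEN iffD1, OF _ _ g]) auto
    then show ?thesis by blast
  qed
  then obtain g where g: "\<And>i. uniform_limit (K i) (\<lambda>n. G (k n)) (g i) sequentially" by metis
  \<comment> \<open>The limits on the sets \<open>K i\<close> are all pointwise limits of one
    sequence, hence they fit together.\<close>
  define g' where "g' = (\<lambda>z. lim (\<lambda>n. G (k n) z))"
  have g': "g i z = g' z" if "z \<in> K i" for i z
    using tendsto_uniform_limitI [OF g that] by (simp add: g'_def limI)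
  have lim: "uniform_limit C (\<lambda>n. G (k n)) g' sequentially" if cC: "compact C" "C \<subseteq> D" for C
  proof -
    obtain i where i: "C \<subseteq> K i" using subK [of C] \<open>compact C\<close> \<open>C \<subseteq> D\<close> by blast
    have "uniform_limit (K i) (\<lambda>n. G (k n)) g' sequentially"
      by (rule uniform_limit_cong' [THEN iffD1, OF _ _ g]) (use g' in auto)
    then show ?thesis using i by (rule uniform_limit_on_subset)
  qed
  show ?thesis by (rule that [OF k(1), of g']) (rule lim)
qed

section \<open>Limits of meromorphic functions in the spherical metric\<close>

lemma sphere_value_eq_Infty_iff [simp]: "sphere_value f z = Infty \<longleftrightarrow> is_pole f z"
  by (simp add: sphere_value_def)

lemma sphere_value_eq_Fin_iff: "sphere_value f z = Fin c \<longleftrightarrow> \<not> is_pole f z \<and> f z = c"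
  by (simp add: sphere_value_def)

lemma nicely_meromorphic_on_pole_eq_0:
  assumes "f nicely_meromorphic_on A" "z \<in> A" "is_pole f z"
  shows "f z = 0"
  using assms not_tendsto_and_filterlim_at_infinity [of "at z" f]
  by (auto simp: nicely_meromorphic_on_def is_pole_def)

lemma fin_part_sphere_value:
  assumes "f nicely_meromorphic_on A" "z \<in> A"
  shows "fin_part (sphere_value f z) = f z"
  using nicely_meromorphic_on_pole_eq_0 [OF assms] by (auto simp: sphere_value_def)

text \<open>At a pole the stored value 0 gives the reciprocal the value 0, which is its limit there.
  The convention thus makes the reciprocal analytic without redefinition.\<close>

lemma analytic_at_inverse_nicely_meromorphic:
  assumes "f nicely_meromorphic_on A" "z \<in> A" "sphere_value f z \<noteq> Fin 0"
  shows "(\<lambda>w. inverse (f w)) analytic_on {z}"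
proof (rule nicely_meromorphic_on_imp_analytic_at [OF nicely_meromorphic_on_inverse [OF assms(1)] assms(2)])
  show "\<not> is_pole (\<lambda>w. inverse (f w)) z"
  proof (cases "is_pole f z")
    case True
    then have "((\<lambda>w. inverse (f w)) \<longlongrightarrow> 0) (at z)" using is_pole_tendsto by (fastforce simp: o_def)
    then show ?thesis using not_tendsto_and_filterlim_at_infinity [of "at z"] by (auto simp: is_pole_def)
  next
    case False
    then have "f analytic_on {z}" using assms(1,2) nicely_meromorphic_on_imp_analytic_at by blast
    moreover have "f z \<noteq> 0" using False assms(3) by (simp add: sphere_value_def)
    ultimately have "(\<lambda>w. inverse (f w)) analytic_on {z}" by (intro analytic_intros) auto
    then show ?thesis by (rule analytic_at_imp_no_pole)
  qed
qed

lemma eventually_sphere_value_eq_Fin: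
  assumes "f analytic_on {z}"
  shows "\<forall>\<^sub>F w in nhds z. sphere_value f w = Fin (f w)"
proof -
  obtain S where S: "open S" "z \<in> S" "f analytic_on S"
    using assms by (metis analytic_on_holomorphic analytic_on_open insert_subset)
  then have "\<not> is_pole f w" if "w \<in> S" for w
    using that by (meson analytic_at_imp_no_pole analytic_on_analytic_at)
  then show ?thesis
    unfolding eventually_nhds using S by (auto simp: sphere_value_def)
qed

text \<open>This is the chart at infinity: away from zeros the sphere-valued map is the inversion of
  an analytic function.\<close>

lemma eventually_sphere_value_eq_inverse:
  assumes "f nicely_meromorphic_on A" "z \<in> A" "sphere_value f z \<noteq> Fin 0"
  shows "\<forall>\<^sub>F w in nhds z. sphere_value f w = sphere_inverse (Fin (inverse (f w)))"
proof (cases "is_pole f z")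
  case True
  have "isolated_singularity_at f z"
    using assms(1,2) unfolding nicely_meromorphic_on_def
    by (meson meromorphic_on_isolated_singularity meromorphic_on_subset empty_subsetI insert_subset)
  then obtain r where r: "r > 0" "f analytic_on ball z r - {z}"
    by (auto simp: isolated_singularity_at_def)
  have "\<forall>\<^sub>F w in at z. f w \<noteq> 0" using True by (rule non_zero_neighbour_pole)
  moreover have "\<forall>\<^sub>F w in at z. w \<in> ball z r - {z}" using r(1)
    using eventually_at_in_open [of "ball z r" z] by simp
  ultimately have "\<forall>\<^sub>F w in at z. sphere_value f w = sphere_inverse (Fin (inverse (f w)))"
  proof eventually_elim
    case (elim w)
    then have "\<not> is_pole f w" using r(2) by (meson analytic_at_imp_no_pole analytic_on_analytic_at)
    then show ?case using elim by (simp add: sphere_value_def)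
  qed
  moreover have "sphere_value f z = sphere_inverse (Fin (inverse (f z)))"
    using nicely_meromorphic_on_pole_eq_0 [OF assms(1,2) True] True by (simp add: sphere_value_def)
  ultimately show ?thesis by (simp add: eventually_nhds_conv_at)
next
  case False
  then have an: "f analytic_on {z}" using assms(1,2) nicely_meromorphic_on_imp_analytic_at by blast
  have "f z \<noteq> 0" using False assms(3) by (simp add: sphere_value_def)
  then have "\<forall>\<^sub>F w in nhds z. f w \<noteq> 0"
    using analytic_at_imp_isCont [OF an] by (simp add: isCont_def eventually_nhds_conv_at tendsto_imp_eventually_ne)
  with eventually_sphere_value_eq_Fin [OF an] show ?thesis
    by eventually_elim simp
qed

lemma dist_Fin_le: "dist (Fin z) (Fin w) \<le> dist z w"
proof -
  have "1 \<le> sqrt (1 + (cmod z)\<^sup>2)" "1 \<le> sqrt (1 + (cmod w)\<^sup>2)" by auto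
  then have "1 * 1 \<le> sqrt (1 + (cmod z)\<^sup>2) * sqrt (1 + (cmod w)\<^sup>2)" by (intro mult_mono) auto
  then have "cmod (z - w) \<le> cmod (z - w) * (sqrt (1 + (cmod z)\<^sup>2) * sqrt (1 + (cmod w)\<^sup>2))"
    using mult_left_mono [of 1 "sqrt (1 + (cmod z)\<^sup>2) * sqrt (1 + (cmod w)\<^sup>2)" "cmod (z - w)"] by simp
  moreover have "0 < sqrt (1 + (cmod z)\<^sup>2) * sqrt (1 + (cmod w)\<^sup>2)" by simp
  ultimately show ?thesis unfolding dist_Fin dist_norm by (simp only: pos_divide_le_eq)
qed

lemma tendsto_Fin: "(f \<longlongrightarrow> c) F \<Longrightarrow> ((\<lambda>x. Fin (f x)) \<longlongrightarrow> Fin c) F"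
  by (rule metric_tendsto_imp_tendsto) (auto simp: dist_Fin_le intro: always_eventually)

lemma isCont_sphere_value:
  assumes "f nicely_meromorphic_on A" "z \<in> A"
  shows "isCont (sphere_value f) z"
proof (cases "sphere_value f z = Fin 0")
  case True
  then have an: "f analytic_on {z}"
    using assms nicely_meromorphic_on_imp_analytic_at by (simp add: sphere_value_eq_Fin_iff)
  have "isCont (\<lambda>w. Fin (f w)) z"
    using analytic_at_imp_isCont [OF an] by (simp add: isCont_def tendsto_Fin)
  then show ?thesis
    using isCont_cong [OF eventually_sphere_value_eq_Fin [OF an]] by blast
next
  case False
  have "isCont (\<lambda>w. Fin (inverse (f w))) z"
    using analytic_at_imp_isCont [OF analytic_at_inverse_nicely_meromorphic [OF assms False]]
    by (simp add: isCont_def tendsto_Fin)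
  then have "isCont (\<lambda>w. sphere_inverse (Fin (inverse (f w)))) z"
    unfolding isCont_def by (simp add: tendsto_iff del: sphere_inverse.simps)
  then show ?thesis
    using isCont_cong [OF eventually_sphere_value_eq_inverse [OF assms False]] by blast
qed

section \<open>From spherical to ordinary uniform convergence\<close>

text \<open>\<open>1 / A\<close> is the distance from \<open>Fin c\<close> to \<open>Infty\<close>.
  Points within half of it stay farther than \<open>1 / (2 * A)\<close> from \<open>Infty\<close>,
  so their factor \<open>sqrt (1 + \<bar>w\<bar>\<^sup>2)\<close> is at most \<open>2 * A\<close>;
  two such factors give \<open>4 * A\<^sup>2\<close>.\<close>

lemma fin_part_Lipschitz_near_Fin:
  fixes c :: complex
  defines "A \<equiv> sqrt (1 + (cmod c)\<^sup>2)"
  assumes p: "dist p (Fin c) < 1 / (2 * A)" and q: "dist q (Fin c) < 1 / (2 * A)"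
  shows "p \<noteq> Infty" "dist (fin_part p) (fin_part q) \<le> 4 * A\<^sup>2 * dist p q"
proof -
  have A: "A > 0" by (simp add: A_def)
  have *: "\<exists>w. x = Fin w \<and> sqrt (1 + (cmod w)\<^sup>2) \<le> 2 * A" if "dist x (Fin c) < 1 / (2 * A)" for x
  proof -
    have "1 / A = dist (Fin c) Infty" by (simp add: A_def dist_riemann_sphere_def)
    also have "\<dots> \<le> dist x (Fin c) + dist x Infty" by (rule dist_triangle3)
    finally have "1 / A - 1 / (2 * A) < dist x Infty" using that by linarith
    moreover have "1 / A - 1 / (2 * A) = 1 / (2 * A)" using A by (simp add: field_simps)
    ultimately have d: "1 / (2 * A) < dist x Infty" by simp
    then have "x \<noteq> Infty" using A by (auto simp: not_less)
    then obtain w where w: "x = Fin w" by (cases x) auto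
    have pos: "0 < sqrt (1 + (cmod w)\<^sup>2)" by simp
    have "1 / (2 * A) < 1 / sqrt (1 + (cmod w)\<^sup>2)" using d by (simp add: w dist_riemann_sphere_def)
    then have "sqrt (1 + (cmod w)\<^sup>2) < 2 * A"
      using A frac_le [of 1 1 "2 * A" "sqrt (1 + (cmod w)\<^sup>2)"] by linarith
    then show ?thesis using w by auto
  qed
  obtain u v where u: "p = Fin u" "sqrt (1 + (cmod u)\<^sup>2) \<le> 2 * A"
    and v: "q = Fin v" "sqrt (1 + (cmod v)\<^sup>2) \<le> 2 * A" using *[OF p] *[OF q] by blast
  show "p \<noteq> Infty" by (simp add: u)
  have pos: "sqrt (1 + (cmod u)\<^sup>2) * sqrt (1 + (cmod v)\<^sup>2) > 0" by simp
  then have "dist u v = dist p q * (sqrt (1 + (cmod u)\<^sup>2) * sqrt (1 + (cmod v)\<^sup>2))"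
    unfolding u(1) v(1) dist_Fin dist_norm by (metis less_irrefl nonzero_divide_eq_eq)
  also have "\<dots> \<le> dist p q * ((2 * A) * (2 * A))"
    using u v A by (intro mult_left_mono mult_mono) auto
  finally show "dist (fin_part p) (fin_part q) \<le> 4 * A\<^sup>2 * dist p q"
    by (simp add: u v power2_eq_square mult_ac)
qed

lemma uniform_limit_fin_part:
  assumes lim: "uniform_limit (ball z0 e) F G sequentially" and "isCont G z0" "G z0 \<noteq> Infty" "e > 0"
  obtains \<delta> where "\<delta> > 0" "\<delta> \<le> e" "\<And>w. w \<in> ball z0 \<delta> \<Longrightarrow> G w \<noteq> Infty"
    "\<forall>\<^sub>F n in sequentially. \<forall>w\<in>ball z0 \<delta>. F n w \<noteq> Infty"
    "uniform_limit (ball z0 \<delta>) (\<lambda>n w. fin_part (F n w)) (\<lambda>w. fin_part (G w)) sequentially"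
proof -
  obtain c where c: "G z0 = Fin c" using assms by (cases "G z0") auto
  define A where "A = sqrt (1 + (cmod c)\<^sup>2)"
  have A: "A > 0" by (simp add: A_def)
  \<comment> \<open>A quarter is spent on the oscillation of \<open>G\<close> and a quarter on the
    distance from \<open>F n\<close> to \<open>G\<close>; together they stay within the radius
    \<open>1 / (2 * A)\<close> of the Lipschitz estimate.\<close>
  obtain \<delta>' where \<delta>': "\<delta>' > 0" "\<And>w. dist w z0 < \<delta>' \<Longrightarrow> dist (G w) (G z0) < 1 / (4 * A)"
    using \<open>isCont G z0\<close> A unfolding continuous_at_eps_delta by (metis divide_pos_pos mult_pos_pos zero_less_numeral zero_less_one)
  define \<delta> where "\<delta> = min \<delta>' e"
  have G: "dist (G w) (Fin c) < 1 / (4 * A)" if "w \<in> ball z0 \<delta>" for w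
    using \<delta>'(2)[of w] that c by (simp add: \<delta>_def dist_commute)
  have G2: "dist (G w) (Fin c) < 1 / (2 * A)" if "w \<in> ball z0 \<delta>" for w
    using G[OF that] A frac_le [of 1 1 "2 * A" "4 * A"] by linarith
  have "\<forall>\<^sub>F n in sequentially. \<forall>w\<in>ball z0 e. dist (F n w) (G w) < 1 / (4 * A)"
    using lim A unfolding uniform_limit_iff by simp
  then have F: "\<forall>\<^sub>F n in sequentially. \<forall>w\<in>ball z0 \<delta>. dist (F n w) (Fin c) < 1 / (2 * A)"
  proof eventually_elim
    case (elim n)
    show ?case
    proof
      fix w assume w: "w \<in> ball z0 \<delta>"
      then have "dist (F n w) (G w) < 1 / (4 * A)" using elim by (auto simp: \<delta>_def)
      then have "dist (F n w) (Fin c) < 1 / (4 * A) + 1 / (4 * A)"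
        using G[OF w] dist_triangle[of "F n w" "Fin c" "G w"] by linarith
      also have "\<dots> = 1 / (2 * A)" by (simp add: field_simps)
      finally show "dist (F n w) (Fin c) < 1 / (2 * A)" .
    qed
  qed
  show ?thesis
  proof
    show "\<delta> > 0" "\<delta> \<le> e" using \<delta>' assms by (auto simp: \<delta>_def)
    show "G w \<noteq> Infty" if "w \<in> ball z0 \<delta>" for w
      using G2[OF that] fin_part_Lipschitz_near_Fin(1) unfolding A_def by blast
    show "\<forall>\<^sub>F n in sequentially. \<forall>w\<in>ball z0 \<delta>. F n w \<noteq> Infty"
      using F by eventually_elim (use fin_part_Lipschitz_near_Fin(1) in \<open>unfold A_def, blast\<close>)
    show "uniform_limit (ball z0 \<delta>) (\<lambda>n w. fin_part (F n w)) (\<lambda>w. fin_part (G w)) sequentially"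
      unfolding uniform_limit_iff
    proof (intro allI impI)
      fix \<epsilon> :: real assume "\<epsilon> > 0"
      then have "\<epsilon> / (4 * A\<^sup>2) > 0" using A by simp
      then have "\<forall>\<^sub>F n in sequentially. \<forall>w\<in>ball z0 e. dist (F n w) (G w) < \<epsilon> / (4 * A\<^sup>2)"
        using lim unfolding uniform_limit_iff by blast
      with F show "\<forall>\<^sub>F n in sequentially. \<forall>w\<in>ball z0 \<delta>. dist (fin_part (F n w)) (fin_part (G w)) < \<epsilon>"
      proof eventually_elim
        case (elim n)
        show ?case
        proof
          fix w assume w: "w \<in> ball z0 \<delta>"
          then have "dist (F n w) (G w) < \<epsilon> / (4 * A\<^sup>2)" using elim by (auto simp: \<delta>_def)
          then have "4 * A\<^sup>2 * dist (F n w) (G w) < \<epsilon>" using A by (simp add: pos_less_divide_eq mult.commute)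
          moreover have "dist (fin_part (F n w)) (fin_part (G w)) \<le> 4 * A\<^sup>2 * dist (F n w) (G w)"
            using elim w G2[OF w] unfolding A_def by (intro fin_part_Lipschitz_near_Fin(2)) auto
          ultimately show "dist (fin_part (F n w)) (fin_part (G w)) < \<epsilon>" by linarith
        qed
      qed
    qed
  qed
qed

lemma holomorphic_on_uniform_limit_open:
  assumes "open S" "\<forall>\<^sub>F n in F. f n holomorphic_on S" "uniform_limit S f g F" "F \<noteq> bot"
  shows "g holomorphic_on S"
proof -
  have "g field_differentiable at z" if "z \<in> S" for z
  proof -
    obtain r where r: "r > 0" "cball z r \<subseteq> S" using assms(1) \<open>z \<in> S\<close> by (metis open_contains_cball)
    have "\<forall>\<^sub>F n in F. continuous_on (cball z r) (f n) \<and> f n holomorphic_on ball z r"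
      using assms(2)
    proof eventually_elim
      case (elim n)
      then have "f n holomorphic_on cball z r" using r(2) by (rule holomorphic_on_subset)
      then show ?case
        using holomorphic_on_subset [OF _ ball_subset_cball] by (auto intro: holomorphic_on_imp_continuous_on)
    qed
    moreover have "uniform_limit (cball z r) f g F" using assms(3) r(2) by (rule uniform_limit_on_subset)
    ultimately have "g holomorphic_on ball z r" using assms(4) by (rule holomorphic_uniform_limit) auto
    then show ?thesis using r(1) by (meson centre_in_ball holomorphic_on_imp_differentiable_at open_ball)
  qed
  then show ?thesis by (simp add: holomorphic_on_def field_differentiable_at_within)
qed

section \<open>Structure of spherical limits\<close>

text \<open>Meromorphy is required on each compact set only from some index on, because the domains
  of the rescaled functions merely exhaust the plane.\<close>

locale spherical_limit =
  fixes D :: "complex set" and f :: "nat \<Rightarrow> complex \<Rightarrow> complex" and G :: "complex \<Rightarrow> riemann_sphere"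
  assumes open_D: "open D"
    and nice: "\<And>C. compact C \<Longrightarrow> C \<subseteq> D \<Longrightarrow> \<forall>\<^sub>F n in sequentially. f n nicely_meromorphic_on C"
    and lim: "\<And>C. compact C \<Longrightarrow> C \<subseteq> D \<Longrightarrow> uniform_limit C (\<lambda>n. sphere_value (f n)) G sequentially"
begin

lemma continuous: "continuous_on D G"
  unfolding continuous_on_eq_continuous_at [OF open_D]
proof
  fix z assume "z \<in> D"
  then obtain e where e: "e > 0" "cball z e \<subseteq> D" using open_D open_contains_cball by blast
  have "continuous_on (cball z e) G"
  proof (rule uniform_limit_theorem)
    show "\<forall>\<^sub>F n in sequentially. continuous_on (cball z e) (sphere_value (f n))"
      using nice [OF compact_cball e(2)]
      by eventually_elim (auto intro!: continuous_at_imp_continuous_on isCont_sphere_value)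
    show "uniform_limit (cball z e) (\<lambda>n. sphere_value (f n)) G sequentially"
      using lim [OF compact_cball e(2)] .
  qed auto
  then have "continuous_on (ball z e) G" by (rule continuous_on_subset) auto
  then show "isCont G z" using e(1) by (simp add: continuous_on_eq_continuous_at)
qed

lemma local_finite:
  assumes "z0 \<in> D" "G z0 \<noteq> Infty"
  obtains \<delta> where "\<delta> > 0" "ball z0 \<delta> \<subseteq> D" "\<And>w. w \<in> ball z0 \<delta> \<Longrightarrow> G w \<noteq> Infty"
    "\<forall>\<^sub>F n in sequentially. f n holomorphic_on ball z0 \<delta>"
    "\<forall>\<^sub>F n in sequentially. \<forall>w\<in>ball z0 \<delta>. \<not> is_pole (f n) w"
    "uniform_limit (ball z0 \<delta>) f (\<lambda>w. fin_part (G w)) sequentially"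
    "(\<lambda>w. fin_part (G w)) holomorphic_on ball z0 \<delta>"
proof -
  obtain e where e: "e > 0" "cball z0 e \<subseteq> D" using assms open_D open_contains_cball by blast
  have c: "isCont G z0" using continuous assms open_D by (simp add: continuous_on_eq_continuous_at)
  have "uniform_limit (ball z0 e) (\<lambda>n. sphere_value (f n)) G sequentially"
    using lim [OF compact_cball e(2)] by (rule uniform_limit_on_subset) auto
  then obtain \<delta> where \<delta>: "\<delta> > 0" "\<delta> \<le> e" "\<And>w. w \<in> ball z0 \<delta> \<Longrightarrow> G w \<noteq> Infty"
    "\<forall>\<^sub>F n in sequentially. \<forall>w\<in>ball z0 \<delta>. sphere_value (f n) w \<noteq> Infty"
    "uniform_limit (ball z0 \<delta>) (\<lambda>n w. fin_part (sphere_value (f n) w)) (\<lambda>w. fin_part (G w)) sequentially"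
    using c assms(2) e(1) by (rule uniform_limit_fin_part) blast
  have sub: "ball z0 \<delta> \<subseteq> cball z0 e" using \<delta>(2) by auto
  have nice': "\<forall>\<^sub>F n in sequentially. f n nicely_meromorphic_on cball z0 e"
    using nice e by simp
  have np: "\<forall>\<^sub>F n in sequentially. \<forall>w\<in>ball z0 \<delta>. \<not> is_pole (f n) w"
    using \<delta>(4) by simp
  have hol: "\<forall>\<^sub>F n in sequentially. f n holomorphic_on ball z0 \<delta>"
    using nice' np
  proof eventually_elim
    case (elim n)
    then have "f n analytic_on ball z0 \<delta>"
      using sub nicely_meromorphic_on_subset nicely_meromorphic_without_singularities by blast
    then show ?case by (rule analytic_imp_holomorphic)
  qed
  have "\<forall>\<^sub>F n in sequentially. \<forall>w\<in>ball z0 \<delta>. fin_part (sphere_value (f n) w) = f n w"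
    using nice' by eventually_elim (use sub fin_part_sphere_value in blast)
  then have ul: "uniform_limit (ball z0 \<delta>) f (\<lambda>w. fin_part (G w)) sequentially"
    by (rule uniform_limit_cong [THEN iffD1, OF _ _ \<delta>(5)]) auto
  have "(\<lambda>w. fin_part (G w)) holomorphic_on ball z0 \<delta>"
    by (rule holomorphic_on_uniform_limit_open [OF _ hol ul]) auto
  then show ?thesis using \<delta>(1,3) np hol ul sub e that by blast
qed

text \<open>This is \<open>local_finite\<close> in the chart at infinity, obtained by applying the
  same argument to the spherically inverted sequence.\<close>

lemma local_inverse:
  assumes "z0 \<in> D" "G z0 \<noteq> Fin 0"
  obtains \<delta> where "\<delta> > 0" "ball z0 \<delta> \<subseteq> D" "\<And>w. w \<in> ball z0 \<delta> \<Longrightarrow> G w \<noteq> Fin 0"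
    "\<forall>\<^sub>F n in sequentially. (\<lambda>w. inverse (f n w)) holomorphic_on ball z0 \<delta>"
    "\<forall>\<^sub>F n in sequentially. \<forall>w\<in>ball z0 \<delta>. sphere_value (f n) w \<noteq> Fin 0"
    "uniform_limit (ball z0 \<delta>) (\<lambda>n w. inverse (f n w)) (\<lambda>w. inverse (fin_part (G w))) sequentially"
    "(\<lambda>w. inverse (fin_part (G w))) holomorphic_on ball z0 \<delta>"
proof -
  obtain e where e: "e > 0" "cball z0 e \<subseteq> D" using assms open_D open_contains_cball by blast
  have inv_Infty: "sphere_inverse p = Infty \<longleftrightarrow> p = Fin 0" for p by (cases p) auto
  have "isCont G z0" using continuous assms open_D by (simp add: continuous_on_eq_continuous_at)
  then have c: "isCont (\<lambda>z. sphere_inverse (G z)) z0" by (simp add: isCont_def tendsto_iff)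
  have "uniform_limit (ball z0 e) (\<lambda>n. sphere_value (f n)) G sequentially"
    using lim [OF compact_cball e(2)] by (rule uniform_limit_on_subset) auto
  then have "uniform_limit (ball z0 e) (\<lambda>n z. sphere_inverse (sphere_value (f n) z))
      (\<lambda>z. sphere_inverse (G z)) sequentially"
    by (rule uniform_limit_sphere_inverse)
  then obtain \<delta> where \<delta>: "\<delta> > 0" "\<delta> \<le> e" "\<And>w. w \<in> ball z0 \<delta> \<Longrightarrow> sphere_inverse (G w) \<noteq> Infty"
    "\<forall>\<^sub>F n in sequentially. \<forall>w\<in>ball z0 \<delta>. sphere_inverse (sphere_value (f n) w) \<noteq> Infty"
    "uniform_limit (ball z0 \<delta>) (\<lambda>n w. fin_part (sphere_inverse (sphere_value (f n) w)))
      (\<lambda>w. fin_part (sphere_inverse (G w))) sequentially"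
    by (rule uniform_limit_fin_part) (use c assms(2) e(1) in \<open>simp_all add: inv_Infty\<close>)
  have sub: "ball z0 \<delta> \<subseteq> cball z0 e" using \<delta>(2) by auto
  have nice': "\<forall>\<^sub>F n in sequentially. f n nicely_meromorphic_on cball z0 e"
    using nice e by simp
  have nz: "\<forall>\<^sub>F n in sequentially. \<forall>w\<in>ball z0 \<delta>. sphere_value (f n) w \<noteq> Fin 0"
    using \<delta>(4) by (simp add: inv_Infty)
  have hol: "\<forall>\<^sub>F n in sequentially. (\<lambda>w. inverse (f n w)) holomorphic_on ball z0 \<delta>"
    using nice' nz
  proof eventually_elim
    case (elim n)
    have "(\<lambda>w. inverse (f n w)) analytic_on ball z0 \<delta>"
    proof (subst analytic_on_analytic_at, intro ballI)
      fix w assume "w \<in> ball z0 \<delta>"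
      then show "(\<lambda>w. inverse (f n w)) analytic_on {w}"
        using elim sub by (intro analytic_at_inverse_nicely_meromorphic [of _ "cball z0 e"]) auto
    qed
    then show ?case by (rule analytic_imp_holomorphic)
  qed
  have "\<forall>\<^sub>F n in sequentially. \<forall>w\<in>ball z0 \<delta>. fin_part (sphere_inverse (sphere_value (f n) w)) = inverse (f n w)"
    using nice'
  proof eventually_elim
    case (elim n)
    then show ?case using fin_part_sphere_value [OF elim] sub by (auto simp: fin_part_sphere_inverse)
  qed
  then have ul: "uniform_limit (ball z0 \<delta>) (\<lambda>n w. inverse (f n w)) (\<lambda>w. inverse (fin_part (G w))) sequentially"
    by (rule uniform_limit_cong [THEN iffD1, OF _ _ \<delta>(5)]) (rule fin_part_sphere_inverse)
  have "(\<lambda>w. inverse (fin_part (G w))) holomorphic_on ball z0 \<delta>"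
    by (rule holomorphic_on_uniform_limit_open [OF _ hol ul]) auto
  then show ?thesis using that [OF \<delta>(1) _ _ hol nz ul] \<delta>(3) sub e by (auto simp: inv_Infty)
qed

text \<open>Near such a point \<open>1 / G\<close> is holomorphic and vanishes exactly where
  \<open>G\<close> is infinite, so the zeros are isolated or fill a neighbourhood.\<close>

lemma Infty_dichotomy:
  assumes "z0 \<in> D" "G z0 = Infty"
  shows "(\<forall>\<^sub>F w in nhds z0. G w = Infty) \<or> (\<forall>\<^sub>F w in at z0. G w \<noteq> Infty)"
proof -
  define k where "k = (\<lambda>w. inverse (fin_part (G w)))"
  have ne: "G z0 \<noteq> Fin 0" using assms by simp
  obtain \<delta> where \<delta>: "\<delta> > 0" "\<And>w. w \<in> ball z0 \<delta> \<Longrightarrow> G w \<noteq> Fin 0" "k holomorphic_on ball z0 \<delta>"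
    by (rule local_inverse [OF assms(1) ne], rule that) (auto simp: k_def)
  have k0: "k w = 0 \<longleftrightarrow> G w = Infty" if "w \<in> ball z0 \<delta>" for w
    using \<delta>(2)[OF that] unfolding k_def by (cases "G w") auto
  show ?thesis
  proof (cases "\<exists>w\<in>ball z0 \<delta>. k w \<noteq> 0")
    case False
    then show ?thesis using k0 \<delta>(1) eventually_nhds_in_open [of "ball z0 \<delta>" z0]
      by (auto elim: eventually_mono)
  next
    case True
    then obtain w where "w \<in> ball z0 \<delta>" "k w \<noteq> 0" by blast
    moreover have "k z0 = 0" using assms(2) by (simp add: k_def)
    ultimately obtain r where r: "0 < r" "ball z0 r \<subseteq> ball z0 \<delta>" "\<And>z. z \<in> ball z0 r - {z0} \<Longrightarrow> k z \<noteq> 0"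
      using isolated_zeros [OF \<delta>(3)] \<delta>(1) by (metis open_ball connected_ball centre_in_ball)
    have "\<forall>\<^sub>F z in at z0. z \<in> ball z0 r - {z0}"
      using eventually_at_in_open [of "ball z0 r" z0] r(1) by simp
    then have "\<forall>\<^sub>F z in at z0. G z \<noteq> Infty"
      by eventually_elim (use k0 r in blast)
    then show ?thesis by blast
  qed
qed

theorem limit_nicely_meromorphic:
  assumes "connected D"
  shows "(\<exists>h. h nicely_meromorphic_on D \<and> (\<forall>z\<in>D. G z = sphere_value h z)) \<or> (\<forall>z\<in>D. G z = Infty)"
proof -
  \<comment> \<open>By the dichotomy, \<open>A\<close> and \<open>B\<close> partition
    \<open>D\<close> into two open sets, and connectedness leaves only one of them.\<close>
  define A where "A = {z \<in> D. \<forall>\<^sub>F w in nhds z. G w = Infty}"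
  define B where "B = {z \<in> D. \<forall>\<^sub>F w in at z. G w \<noteq> Infty}"
  have fin_near: "\<forall>\<^sub>F w in nhds z. G w \<noteq> Infty" if "z \<in> D" "G z \<noteq> Infty" for z
  proof (rule local_finite [OF that])
    fix \<delta> assume "\<delta> > 0" "\<And>w. w \<in> ball z \<delta> \<Longrightarrow> G w \<noteq> Infty"
    then show ?thesis using eventually_nhds_in_open [of "ball z \<delta>" z] by (auto elim: eventually_mono)
  qed
  have AB: "A \<union> B = D"
    using Infty_dichotomy fin_near unfolding A_def B_def by (auto simp: eventually_nhds_conv_at)
  have "A \<inter> B = {}"
  proof -
    have False if "\<forall>\<^sub>F w in nhds z. G w = Infty" "\<forall>\<^sub>F w in at z. G w \<noteq> Infty" for z
    proof -
      have "\<forall>\<^sub>F w in at z. G w = Infty" using that(1) by (simp add: eventually_nhds_conv_at)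
      then have "\<forall>\<^sub>F w in at z. False" using that(2) by eventually_elim auto
      then show False by simp
    qed
    then show ?thesis unfolding A_def B_def by blast
  qed
  moreover have "open A"
  proof (rule Topological_Spaces.openI)
    fix z assume z: "z \<in> A"
    then obtain S where S: "open S" "z \<in> S" "\<And>w. w \<in> S \<Longrightarrow> G w = Infty"
      unfolding A_def eventually_nhds by auto
    then have "S \<inter> D \<subseteq> A" unfolding A_def eventually_nhds by auto
    then show "\<exists>T. open T \<and> z \<in> T \<and> T \<subseteq> A" using S z open_D by (intro exI [of _ "S \<inter> D"]) (auto simp: A_def)
  qed
  moreover have "open B"
  proof (rule Topological_Spaces.openI)
    fix z assume z: "z \<in> B"
    then obtain S where S: "open S" "z \<in> S" "\<And>w. w \<in> S \<Longrightarrow> w \<noteq> z \<Longrightarrow> G w \<noteq> Infty"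
      unfolding B_def eventually_at_topological by auto
    have "w \<in> B" if "w \<in> S \<inter> D" for w
    proof (cases "w = z")
      case False
      then show ?thesis using fin_near S that by (auto simp: B_def eventually_nhds_conv_at)
    qed (use z in simp)
    then show "\<exists>T. open T \<and> z \<in> T \<and> T \<subseteq> B" using S z open_D by (intro exI [of _ "S \<inter> D"]) (auto simp: B_def)
  qed
  ultimately have "A = {} \<or> B = {}"
    using assms AB connectedD [of D A B] by blast
  then show ?thesis
  proof
    assume "B = {}"
    then have "\<forall>z\<in>D. G z = Infty" using AB unfolding A_def by (auto dest: eventually_nhds_x_imp_x)
    then show ?thesis by blast
  next
    assume "A = {}"
    then have near: "\<forall>\<^sub>F w in at z. G w \<noteq> Infty" if "z \<in> D" for z using AB that unfolding B_def by blast
    define h where "h = (\<lambda>w. fin_part (G w))"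
    define pts where "pts = {z \<in> D. G z = Infty}"
    have an: "h analytic_on {z}" if "z \<in> D" "G z \<noteq> Infty" for z
    proof (rule local_finite [OF that])
      fix \<delta> assume "\<delta> > 0" "(\<lambda>w. fin_part (G w)) holomorphic_on ball z \<delta>"
      then show ?thesis unfolding h_def by (auto simp: analytic_at_ball)
    qed
    have pole: "is_pole h z" if zD: "z \<in> D" and zInf: "G z = Infty" for z
    proof -
      have ne: "G z \<noteq> Fin 0" using zInf by simp
      obtain \<delta> where \<delta>: "\<delta> > 0" "(\<lambda>w. inverse (h w)) holomorphic_on ball z \<delta>" "\<And>w. w \<in> ball z \<delta> \<Longrightarrow> G w \<noteq> Fin 0"
        by (rule local_inverse [OF zD ne], rule that) (auto simp: h_def)
      then have "isCont (\<lambda>w. inverse (h w)) z"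
        by (metis centre_in_ball continuous_on_interior holomorphic_on_imp_continuous_on interior_open open_ball)
      then have "((\<lambda>w. inverse (h w)) \<longlongrightarrow> 0) (at z)" by (simp add: isCont_def h_def zInf)
      moreover have "\<forall>\<^sub>F w in at z. w \<in> ball z \<delta> - {z}"
        using \<delta>(1) eventually_at_in_open [of "ball z \<delta>" z] by simp
      then have "\<forall>\<^sub>F w in at z. inverse (h w) \<noteq> 0" using near [OF zD]
      proof eventually_elim
        case (elim w)
        then show ?case using \<delta>(3)[of w] unfolding h_def by (cases "G w") auto
      qed
      ultimately have "filterlim (\<lambda>w. inverse (h w)) (at 0) (at z)" by (simp add: filterlim_at)
      then have "filterlim (\<lambda>w. inverse (inverse (h w))) at_infinity (at z)"
        by (rule filterlim_compose [OF filterlim_inverse_at_infinity])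
      then show ?thesis by (simp add: is_pole_def)
    qed
    have "h nicely_meromorphic_on D"
    proof (rule nicely_meromorphic_onI_open [OF open_D, of _ pts])
      show "h analytic_on D - pts" using an by (subst analytic_on_analytic_at) (auto simp: pts_def)
      show "is_pole h x \<and> h x = 0" if "x \<in> pts" for x using pole that by (auto simp: pts_def h_def)
      show "isolated_singularity_at h x" if "x \<in> D" for x
      proof -
        have "\<forall>\<^sub>F w in at x. w \<in> D" using open_D that by (simp add: eventually_at_in_open')
        with near [OF that] have "\<forall>\<^sub>F w in at x. h analytic_on {w}" by eventually_elim (rule an)
        then obtain r where "r > 0" "\<And>w. w \<noteq> x \<Longrightarrow> dist w x < r \<Longrightarrow> h analytic_on {w}"
          unfolding eventually_at by blast
        then have "h analytic_on ball x r - {x}" by (subst analytic_on_analytic_at) (auto simp: dist_commute)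
        then show ?thesis using \<open>r > 0\<close> by (auto simp: isolated_singularity_at_def)
      qed
    qed
    moreover have "G z = sphere_value h z" if "z \<in> D" for z
    proof (cases "G z = Infty")
      case True
      then show ?thesis using pole that by (simp add: sphere_value_def)
    next
      case False
      then have "\<not> is_pole h z" using an that analytic_at_imp_no_pole by blast
      then show ?thesis using False by (cases "G z") (auto simp: sphere_value_def h_def)
    qed
    ultimately show ?thesis by blast
  qed
qed

end

section \<open>Entire functions with bounded spherical derivative\<close>

text \<open>The Schwarz lemma is applied to \<open>W\<close>, the composition of \<open>F\<close>
  with the Cayley map of the right half-plane onto the unit disc that sends \<open>F z0\<close> to
  0.\<close>

lemma Schwarz_half_plane:
  assumes hol: "F holomorphic_on ball z0 d" and pos: "\<And>z. z \<in> ball z0 d \<Longrightarrow> Re (F z) > 0"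
    and z: "z \<in> ball z0 d"
  shows "cmod (F z - F z0) \<le> cmod (z - z0) / d * cmod (F z + cnj (F z0))"
proof -
  have d: "d > 0" using z zero_le_dist [of z0 z] unfolding mem_ball by linarith
  have in_ball: "z0 + d * \<zeta> \<in> ball z0 d" if "cmod \<zeta> < 1" for \<zeta> :: complex
    using that d by (simp add: dist_norm norm_mult)
  have pos0: "Re (F z0) > 0" using pos d by simp
  have nz: "F w + cnj (F z0) \<noteq> 0" if "w \<in> ball z0 d" for w
    using pos[OF that] pos0 by (auto simp: complex_eq_iff)
  define W where "W = (\<lambda>\<zeta>::complex. (F (z0 + d * \<zeta>) - F z0) / (F (z0 + d * \<zeta>) + cnj (F z0)))"
  have "(F \<circ> (\<lambda>\<zeta>. z0 + d * \<zeta>)) holomorphic_on ball 0 1"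
    by (rule holomorphic_on_compose_gen [OF _ hol]) (use in_ball in \<open>auto intro!: holomorphic_intros\<close>)
  then have "W holomorphic_on ball 0 1"
    unfolding W_def o_def using nz in_ball by (intro holomorphic_intros) auto
  moreover have "W 0 = 0" by (simp add: W_def)
  moreover have "cmod (W \<zeta>) < 1" if "cmod \<zeta> < 1" for \<zeta>
  proof -
    let ?P = "F (z0 + d * \<zeta>)"
    have P: "Re ?P > 0" using pos in_ball that by blast
    \<comment> \<open>The two squares differ by \<open>4 * Re ?P * Re (F z0)\<close>.\<close>
    have "(cmod (?P - F z0))\<^sup>2 < (cmod (?P + cnj (F z0)))\<^sup>2"
      using mult_pos_pos [OF P pos0] unfolding cmod_power2 by (simp add: power2_eq_square algebra_simps)
    then have "cmod (?P - F z0) < cmod (?P + cnj (F z0))" by (rule power2_less_imp_less) auto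
    then show ?thesis using nz[OF in_ball[OF that]] by (simp add: W_def norm_divide)
  qed
  moreover have "cmod ((z - z0) / d) < 1" using z d by (simp add: norm_divide dist_norm norm_minus_commute)
  ultimately have "cmod (W ((z - z0) / d)) \<le> cmod ((z - z0) / d)"
    by (rule Schwarz_Lemma(1))
  then have "cmod (F z - F z0) / cmod (F z + cnj (F z0)) \<le> cmod (z - z0) / d"
    using d by (simp add: W_def norm_divide)
  moreover have "0 < cmod (F z + cnj (F z0))" using nz[OF z] by simp
  ultimately show ?thesis by (simp only: pos_divide_le_eq)
qed

lemma Harnack_lower_bound:
  assumes "F holomorphic_on ball z0 d" and pos: "\<And>z. z \<in> ball z0 d \<Longrightarrow> Re (F z) > 0"
    and z: "z \<in> ball z0 d"
  shows "Re (F z0) * (1 - cmod (z - z0) / d) / 2 \<le> Re (F z)"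
proof -
  have d: "d > 0" using z zero_le_dist [of z0 z] unfolding mem_ball by linarith
  define s where "s = cmod (z - z0) / d"
  have s: "0 \<le> s" "s < 1" using z d by (auto simp: s_def dist_norm norm_minus_commute)
  define c x t where "c = Re (F z0)" and "x = Re (F z)" and "t = (Im (F z) - Im (F z0))\<^sup>2"
  have cx: "c > 0" "x > 0" and t: "t \<ge> 0" using pos d z by (auto simp: c_def x_def t_def)
  have "(cmod (F z - F z0))\<^sup>2 \<le> (s * cmod (F z + cnj (F z0)))\<^sup>2"
    using Schwarz_half_plane [OF assms] unfolding s_def by (intro power_mono) auto
  then have "(x - c)\<^sup>2 + t \<le> s\<^sup>2 * ((x + c)\<^sup>2 + t)"
    by (simp add: power_mult_distrib cmod_power2 c_def x_def t_def)
  moreover have "s\<^sup>2 * t \<le> t" using s t by (simp add: mult_left_le_one_le power_le_one)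
  ultimately have "(c - x)\<^sup>2 \<le> (s * (x + c))\<^sup>2"
    unfolding power_mult_distrib [of s] power2_commute [of c x]
    using distrib_left [of "s\<^sup>2" "(x + c)\<^sup>2" t] by linarith
  then have "c - x \<le> s * (x + c)" by (rule power2_le_imp_le) (use s cx in simp)
  moreover have "s * x \<le> x" using s cx by simp
  ultimately show ?thesis unfolding s_def[symmetric] c_def[symmetric] x_def[symmetric]
    by (simp add: algebra_simps)
qed

text \<open>The half-plane estimate for \<open>T - q\<close>, whose value at 0 is \<open>T\<close>,
  yields \<open>\<bar>q\<bar> \<le> T + \<bar>q\<bar> / 2\<close> at half the radius; the last term
  is absorbed on the left.\<close>

lemma Borel_Caratheodory_half:
  assumes hol: "q holomorphic_on ball 0 R" and bound: "\<And>z. z \<in> ball 0 R \<Longrightarrow> Re (q z) < T"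
    and "q 0 = 0" "cmod z \<le> R / 2" "R > 0"
  shows "cmod (q z) \<le> 2 * T"
proof -
  have T: "T > 0" using bound[of 0] assms by simp
  have z: "z \<in> ball 0 R" using assms by auto
  have "cmod (T - q z - (T - q 0)) \<le> cmod (z - 0) / R * cmod (T - q z + cnj (T - q 0))"
    by (rule Schwarz_half_plane) (use hol bound z in \<open>auto intro!: holomorphic_intros\<close>)
  then have "cmod (q z) \<le> cmod z / R * cmod (2 * T - q z)" using assms(3) by (simp add: algebra_simps)
  also have "\<dots> \<le> 1 / 2 * (2 * T + cmod (q z))"
  proof (rule mult_mono)
    show "cmod z / R \<le> 1 / 2" using assms by (simp add: field_simps)
    show "cmod (2 * T - q z) \<le> 2 * T + cmod (q z)"
      using norm_triangle_ineq4 [of "2 * of_real T" "q z"] T by (simp add: norm_mult)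
  qed auto
  finally show ?thesis by simp
qed

text \<open>Borel-Caratheodory on the disc of radius \<open>2 * \<bar>z\<bar>\<close> turns the
  one-sided bound into linear growth of the modulus, and Liouville makes \<open>q\<close> a
  polynomial of degree at most one.\<close>

lemma entire_linear_real_part_bound:
  assumes hol: "q holomorphic_on UNIV" and bound: "\<And>z. Re (q z) \<le> A * cmod z + B"
  obtains \<alpha> \<beta> where "\<And>z. q z = \<alpha> * z + \<beta>"
proof -
  define C where "C = 2 * (\<bar>A\<bar> * 2 + \<bar>B\<bar> + cmod (q 0) + 1) + cmod (q 0)"
  have "cmod (q z) \<le> C * cmod z ^ 1" if "1 \<le> cmod z" for z
  proof -
    define T where "T = \<bar>A\<bar> * (2 * cmod z) + \<bar>B\<bar> + cmod (q 0) + 1"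
    have "cmod (q z - q 0) \<le> 2 * T"
    proof (rule Borel_Caratheodory_half [of "\<lambda>z. q z - q 0" "2 * cmod z"])
      fix w :: complex assume "w \<in> ball 0 (2 * cmod z)"
      then have "A * cmod w \<le> \<bar>A\<bar> * (2 * cmod z)" by (intro mult_mono) auto
      then show "Re (q w - q 0) < T"
        using bound[of w] abs_Re_le_cmod[of "q 0"] by (simp add: T_def)
    qed (use that in \<open>auto intro!: holomorphic_intros holomorphic_on_subset [OF hol]\<close>)
    then have "cmod (q z) \<le> 2 * T + cmod (q 0)" using norm_triangle_sub[of "q z" "q 0"] by linarith
    also have "\<dots> \<le> C * cmod z"
    proof -
      have "\<bar>B\<bar> * 1 \<le> \<bar>B\<bar> * cmod z" "cmod (q 0) * 1 \<le> cmod (q 0) * cmod z"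
        using that by (intro mult_left_mono; simp)+
      then show ?thesis using that unfolding C_def T_def by (simp add: algebra_simps)
    qed
    finally show ?thesis by simp
  qed
  then have *: "q z = (\<Sum>k\<le>1. (deriv ^^ k) q 0 / fact k * z ^ k)" for z
    using Liouville_polynomial [OF hol, of 1 C 1] by blast
  have "q z = deriv q 0 * z + q 0" for z
    using *[of z] by simp
  then show ?thesis by (rule that)
qed

section \<open>Exponential type from a bounded spherical derivative\<close>

lemma spherical_derivative_bound_nonneg:
  assumes "cmod d \<le> M * (1 + (cmod z)\<^sup>2)"
  shows "M \<ge> 0"
proof (rule ccontr)
  assume "\<not> M \<ge> 0"
  then have "M * (1 + (cmod z)\<^sup>2) < 0" by (intro mult_neg_pos) auto
  then show False using assms norm_ge_zero [of d] by linarith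
qed

text \<open>If \<open>\<bar>g\<bar> > 1\<close> on the largest disc around \<open>z0\<close> free of points with \<open>\<bar>g\<bar> \<le> 1\<close>, then \<open>ln \<bar>g\<bar>\<close> is a
  positive harmonic function there; as in Hopf's lemma, its value at the centre is controlled by
  its slope at the boundary point where \<open>\<bar>g\<bar> = 1\<close>, and there \<open>\<bar>g'\<bar> \<le> 2 M\<close>.\<close>

lemma spherical_derivative_bound_imp_exponential_type:
  assumes hol: "g holomorphic_on UNIV" and M: "\<And>z. cmod (deriv g z) \<le> M * (1 + (cmod (g z))\<^sup>2)"
  obtains A B where "A \<ge> 0" "B \<ge> 0" "\<And>z. cmod (g z) \<le> exp (A * cmod z + B)"
proof -
  have M0: "M \<ge> 0" using M [of 0] by (rule spherical_derivative_bound_nonneg)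
  show ?thesis
  proof (cases "\<exists>z. cmod (g z) \<le> 1")
    case False
    then have g1: "cmod (g z) > 1" for z by (simp add: not_le)
    then have "g z \<noteq> 0" for z by (metis norm_zero not_one_less_zero)
    then have "(\<lambda>z. inverse (g z)) holomorphic_on UNIV" by (intro holomorphic_intros hol) auto
    moreover have "bounded (range (\<lambda>z. inverse (g z)))"
      using g1 by (intro boundedI [of _ 1]) (force simp: norm_inverse inverse_le_1_iff intro: less_imp_le)
    ultimately have "(\<lambda>z. inverse (g z)) constant_on UNIV" by (rule Liouville_theorem)
    then obtain c where "\<And>z. inverse (g z) = c" by (auto simp: constant_on_def)
    then have c: "g z = inverse c" for z by (metis inverse_inverse_eq)
    show ?thesis
    proof (rule that [of 0 "cmod (inverse c)"])
      show "cmod (g z) \<le> exp (0 * cmod z + cmod (inverse c))" for z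
        using exp_ge_add_one_self [of "cmod (inverse c)"] unfolding c mult_zero_left add_0_left by linarith
    qed auto
  next
    case True
    then obtain zs where zs: "cmod (g zs) \<le> 1" by blast
    define S where "S = {z. cmod (g z) \<le> 1}"
    have cont: "continuous_on UNIV g" using hol by (rule holomorphic_on_imp_continuous_on)
    then have "closed S" unfolding S_def by (intro closed_Collect_le continuous_intros)
    moreover have "S \<noteq> {}" using zs by (auto simp: S_def)
    ultimately have near: "\<exists>z1\<in>S. \<forall>y\<in>S. dist z0 z1 \<le> dist z0 y" for z0
      using distance_attains_inf by metis
    have "cmod (g z0) \<le> exp (4 * M * cmod z0 + 4 * M * cmod zs)" for z0
    proof (cases "cmod (g z0) \<le> 1")
      case True
      have "0 \<le> 4 * M * cmod z0 + 4 * M * cmod zs" using M0 by simp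
      then have "1 \<le> exp (4 * M * cmod z0 + 4 * M * cmod zs)" by simp
      then show ?thesis using True by linarith
    next
      case False
      obtain z1 where z1: "z1 \<in> S" "\<And>y. y \<in> S \<Longrightarrow> dist z0 z1 \<le> dist z0 y" using near by blast
      define d where "d = dist z0 z1"
      have d: "d > 0" using False z1 by (auto simp: d_def S_def)
      have big: "cmod (g z) > 1" if "z \<in> ball z0 d" for z
        using z1(2)[of z] that by (force simp: d_def S_def)
      have "g z \<noteq> 0" if "z \<in> ball z0 d" for z
        using big[OF that] by auto
      then obtain F where F: "F holomorphic_on ball z0 d" "\<And>z. z \<in> ball z0 d \<Longrightarrow> exp (F z) = g z"
        using holomorphic_logarithm_exists [of "ball z0 d" g z0] hol d
        by (metis centre_in_ball convex_ball holomorphic_on_subset open_ball subset_UNIV)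
      have ReF: "Re (F z) = ln (cmod (g z))" if "z \<in> ball z0 d" for z
        using F(2)[OF that] by (metis ln_exp norm_exp_eq_Re)
      have posF: "Re (F z) > 0" if "z \<in> ball z0 d" for z
        unfolding ReF [OF that] using big [OF that] by (rule ln_gt_zero)
      \<comment> \<open>The point at distance \<open>t * d\<close> from \<open>z1\<close> on the
        segment to \<open>z0\<close> lies at \<open>(1 - t) * d\<close> from the centre, so Harnack
        gives \<open>ln \<bar>g\<bar>\<close> at least \<open>t / 2\<close> times its central value.
        Division by \<open>t * d\<close> leaves the factor \<open>1 / (2 * d)\<close>.\<close>
      have lower: "ln (cmod (g z0)) / (2 * d) \<le> cmod ((g (z1 + of_real t * (z0 - z1)) - g z1) / (z1 + of_real t * (z0 - z1) - z1))"
        if t: "0 < t" "t < 1" for t :: real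
      proof -
        define z where "z = z1 + of_real t * (z0 - z1)"
        have "z - z0 = of_real (1 - t) * (z1 - z0)" by (simp add: z_def algebra_simps)
        then have zz0: "cmod (z - z0) = (1 - t) * d" using t by (simp add: norm_mult d_def dist_norm norm_minus_commute flip: of_real_diff)
        have zz1: "cmod (z - z1) = t * d" using t by (simp add: z_def norm_mult d_def dist_norm)
        have zb: "z \<in> ball z0 d" using zz0 t d by (simp add: dist_norm norm_minus_commute)
        have "Re (F z0) * (1 - cmod (z - z0) / d) / 2 \<le> Re (F z)"
          using F(1) posF zb by (rule Harnack_lower_bound)
        then have "ln (cmod (g z0)) * t / 2 \<le> ln (cmod (g z))"
          using ReF[of z0] ReF[OF zb] d by (simp add: zz0)
        \<comment> \<open>Growth of \<open>ln \<bar>g\<bar>\<close> becomes growth of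
          \<open>\<bar>g\<bar>\<close> itself, and \<open>\<bar>g z1\<bar> \<le> 1\<close> lets the
          increment be measured from \<open>z1\<close>.\<close>
        also have "\<dots> \<le> cmod (g z) - 1" using big[OF zb] by (intro ln_le_minus_one) auto
        also have "\<dots> \<le> cmod (g z) - cmod (g z1)" using z1 by (simp add: S_def)
        also have "\<dots> \<le> cmod (g z - g z1)" by (rule norm_triangle_ineq2)
        finally have "ln (cmod (g z0)) * t / 2 / (t * d) \<le> cmod (g z - g z1) / (t * d)"
          using t d by (intro divide_right_mono) auto
        then show ?thesis using t d by (simp add: zz1 norm_divide flip: z_def)
      qed
      have "(g has_field_derivative deriv g z1) (at z1)"
        using hol by (metis DERIV_deriv_iff_field_differentiable UNIV_I holomorphic_on_imp_differentiable_at open_UNIV)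
      then have lim: "((\<lambda>w. (g w - g z1) / (w - z1)) \<longlongrightarrow> deriv g z1) (at z1)"
        by (simp add: has_field_derivative_iff)
      have "((\<lambda>t::real. z1 + of_real t * (z0 - z1)) \<longlongrightarrow> z1 + of_real 0 * (z0 - z1)) (at_right 0)"
        by (intro tendsto_intros)
      moreover have "z0 \<noteq> z1" using d by (auto simp: d_def)
      ultimately have "filterlim (\<lambda>t::real. z1 + of_real t * (z0 - z1)) (at z1) (at_right 0)"
        by (auto simp: filterlim_at eventually_at_filter)
      then have "((\<lambda>t::real. (g (z1 + of_real t * (z0 - z1)) - g z1) / (z1 + of_real t * (z0 - z1) - z1)) \<longlongrightarrow> deriv g z1) (at_right 0)"
        by (rule filterlim_compose [OF lim])
      then have "ln (cmod (g z0)) / (2 * d) \<le> cmod (deriv g z1)"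
      proof (rule tendsto_lowerbound [OF tendsto_norm])
        show "\<forall>\<^sub>F t in at_right 0. ln (cmod (g z0)) / (2 * d)
            \<le> cmod ((g (z1 + of_real t * (z0 - z1)) - g z1) / (z1 + of_real t * (z0 - z1) - z1))"
        proof (rule eventually_mono [OF eventually_at_right_real [of 0 "1::real"]])
          fix t :: real assume "t \<in> {0<..<1}"
          then have "0 < t" "t < 1" by auto
          then show "ln (cmod (g z0)) / (2 * d)
              \<le> cmod ((g (z1 + of_real t * (z0 - z1)) - g z1) / (z1 + of_real t * (z0 - z1) - z1))"
            by (rule lower)
        qed simp
      qed auto
      also have "\<dots> \<le> M * (1 + (cmod (g z1))\<^sup>2)" by (rule M)
      also have "\<dots> \<le> M * (1 + 1)" using M0 z1 by (intro mult_left_mono add_left_mono power_le_one) (auto simp: S_def)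
      finally have "ln (cmod (g z0)) \<le> 4 * M * d" using d by (simp add: pos_divide_le_eq)
      also have "\<dots> \<le> 4 * M * (cmod z0 + cmod zs)"
      proof (rule mult_left_mono)
        have "d \<le> dist z0 zs" using z1(2)[of zs] zs by (simp add: d_def S_def)
        then show "d \<le> cmod z0 + cmod zs" using norm_triangle_ineq4[of z0 zs] by (simp add: dist_norm)
      qed (use M0 in simp)
      finally have "exp (ln (cmod (g z0))) \<le> exp (4 * M * cmod z0 + 4 * M * cmod zs)" by (simp add: distrib_left)
      moreover have "exp (ln (cmod (g z0))) = cmod (g z0)" using False by (intro exp_ln) linarith
      ultimately show ?thesis by simp
    qed
    then show ?thesis using M0 by (intro that [of "4 * M" "4 * M * cmod zs"]) auto
  qed
qed

section \<open>Entire functions whose derivative omits a nonzero value\<close>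

text \<open>Points are chosen where the linear and the exponential term of the function nearly
  cancel. Writing \<open>w = \<alpha> z + \<beta>\<close> with \<open>w = ln (m Y) + \<i> Y\<close>
  and \<open>exp w = - \<i> b Y\<close>, the terms in \<open>Y\<close> drop out of
  \<open>(b w + exp w) / \<alpha>\<close>. The function then grows like \<open>ln Y\<close> and its
  derivative like \<open>Y\<close>, which beats any multiple of
  \<open>(ln Y)\<^sup>2\<close>.\<close>

lemma entire_derivative_affine_exp_unbounded:
  fixes b c \<alpha> \<beta> :: complex and M :: real
  assumes "b \<noteq> 0" "\<alpha> \<noteq> 0"
  obtains z where "M * (1 + (cmod (b * z + exp (\<alpha> * z + \<beta>) / \<alpha> + c))\<^sup>2) < cmod (b + exp (\<alpha> * z + \<beta>))"
proof -
  define m where "m = cmod b"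
  have m: "m > 0" using assms by (simp add: m_def)
  define C where "C = cmod (c - b * \<beta> / \<alpha>)"
  define p where "p = cmod (b / \<alpha>)"
  \<comment> \<open>These are the heights at which \<open>exp (\<i> * y)\<close> points in the
    direction of \<open>- \<i> * b\<close>; adding multiples of \<open>2 * pi\<close> makes them
    arbitrarily large.\<close>
  define y where "y = (\<lambda>k::nat. Arg (- \<i> * b) + 2 * pi * k)"
  have p: "p > 0" using assms by (simp add: p_def)
  have "eventually (\<lambda>y::real. M * (1 + (p * ln (m * y) + C)\<^sup>2) < m * y) at_top"
    using p m by real_asymp
  moreover have "eventually (\<lambda>y::real. y > 1 / m) at_top" by (rule eventually_gt_at_top)
  moreover have "eventually (\<lambda>y::real. y > 0) at_top" by (rule eventually_gt_at_top)
  moreover have "filterlim y at_top sequentially" unfolding y_def by real_asymp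
  ultimately have "\<forall>\<^sub>F k in sequentially. M * (1 + (p * ln (m * y k) + C)\<^sup>2) < m * y k"
    "\<forall>\<^sub>F k in sequentially. y k > 1 / m" "\<forall>\<^sub>F k in sequentially. y k > 0"
    unfolding filterlim_iff by blast+
  then have "\<forall>\<^sub>F k in sequentially. M * (1 + (p * ln (m * y k) + C)\<^sup>2) < m * y k \<and> y k > 1 / m \<and> y k > 0"
    by (intro eventually_conj)
  then obtain k where k: "M * (1 + (p * ln (m * y k) + C)\<^sup>2) < m * y k" "y k > 1 / m" "y k > 0"
    using eventually_happens by fastforce
  define Y where "Y = y k"
  have lnpos: "ln (m * Y) > 0" using k(2) m by (intro ln_gt_zero) (simp add: Y_def field_simps)
  define w where "w = complex_of_real (ln (m * Y)) + \<i> * complex_of_real Y"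
  define z where "z = (w - \<beta>) / \<alpha>"
  have az: "\<alpha> * z + \<beta> = w" using assms by (simp add: z_def)
  have "exp (\<i> * of_real Y) = exp (\<i> * of_real (Arg (- \<i> * b))) * exp (of_nat k * (2 * of_real pi * \<i>))"
    by (simp add: Y_def y_def ring_distribs exp_add mult_ac)
  also have "exp (of_nat k * (2 * of_real pi * \<i>)) = 1"
    by (metis exp_two_pi_i exp_of_nat_mult mult.commute power_one)
  finally have "of_real (cmod (- \<i> * b)) * exp (\<i> * of_real Y) = - \<i> * b"
    using Arg_eq [of "- \<i> * b"] assms by simp
  then have expY: "of_real m * exp (\<i> * of_real Y) = - \<i> * b" by (simp add: m_def norm_mult)
  have mY: "m * Y > 0" using m k(3) by (simp add: Y_def)
  have "exp w = of_real (m * Y) * exp (\<i> * of_real Y)"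
    using mY unfolding w_def exp_add by (metis exp_ln exp_of_real)
  also have "\<dots> = of_real Y * (- \<i> * b)" using expY by (simp add: mult_ac)
  finally have expw: "exp w = - \<i> * b * of_real Y" by (simp add: mult_ac)
  \<comment> \<open>Here the contributions \<open>\<i> b Y / \<alpha>\<close> and
    \<open>- \<i> b Y / \<alpha>\<close> cancel.\<close>
  have "b * z + exp (\<alpha> * z + \<beta>) / \<alpha> + c = b / \<alpha> * of_real (ln (m * Y)) + (c - b * \<beta> / \<alpha>)"
    unfolding az expw using assms by (simp add: z_def w_def field_simps)
  then have "cmod (b * z + exp (\<alpha> * z + \<beta>) / \<alpha> + c) \<le> p * ln (m * Y) + C"
  proof (elim ssubst)
    show "cmod (b / \<alpha> * of_real (ln (m * Y)) + (c - b * \<beta> / \<alpha>)) \<le> p * ln (m * Y) + C"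
      using norm_triangle_ineq [of "b / \<alpha> * of_real (ln (m * Y))" "c - b * \<beta> / \<alpha>"] lnpos
      by (simp add: p_def C_def norm_mult norm_divide)
  qed
  then have sq: "(cmod (b * z + exp (\<alpha> * z + \<beta>) / \<alpha> + c))\<^sup>2 \<le> (p * ln (m * Y) + C)\<^sup>2"
    by (intro power_mono) auto
  have "b + exp w = b * (1 - \<i> * of_real Y)" by (simp add: expw algebra_simps)
  then have "cmod (b + exp w) = m * cmod (1 - \<i> * of_real Y)" by (simp add: norm_mult m_def)
  moreover have "Y \<le> cmod (1 - \<i> * of_real Y)" using abs_Im_le_cmod [of "1 - \<i> * of_real Y"] by simp
  ultimately have low: "m * Y \<le> cmod (b + exp w)" using m by simp
  show ?thesis
  proof (cases "M \<ge> 0")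
    case True
    have "M * (1 + (cmod (b * z + exp (\<alpha> * z + \<beta>) / \<alpha> + c))\<^sup>2) \<le> M * (1 + (p * ln (m * Y) + C)\<^sup>2)"
      using sq True by (intro mult_left_mono) auto
    then show ?thesis using k(1) low by (intro that [of z]) (auto simp: Y_def az)
  next
    case False
    then have "M * (1 + (cmod (b * z + exp (\<alpha> * z + \<beta>) / \<alpha> + c))\<^sup>2) < 0"
      by (intro mult_neg_pos) (auto simp: add_pos_nonneg)
    then show ?thesis using low mY by (intro that [of z]) (auto simp: az)
  qed
qed

theorem entire_bounded_spherical_derivative_omitting:
  assumes hol: "g holomorphic_on UNIV" and M: "\<And>z. cmod (deriv g z) \<le> M * (1 + (cmod (g z))\<^sup>2)"
    and "b \<noteq> 0" and omit: "\<And>z. deriv g z \<noteq> b"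
  obtains c d where "\<And>z. g z = c * z + d"
proof -
  have M0: "M \<ge> 0" using M [of 0] by (rule spherical_derivative_bound_nonneg)
  have der: "(g has_field_derivative deriv g z) (at z)" for z
    using hol by (metis DERIV_deriv_iff_field_differentiable UNIV_I holomorphic_on_imp_differentiable_at open_UNIV)
  obtain A B where AB: "A \<ge> 0" "B \<ge> 0" "\<And>z. cmod (g z) \<le> exp (A * cmod z + B)"
    using spherical_derivative_bound_imp_exponential_type [OF hol M] by blast
  have "(\<lambda>z. deriv g z - b) holomorphic_on UNIV" by (intro holomorphic_intros holomorphic_deriv hol) auto
  then obtain q where q: "q holomorphic_on UNIV" "\<And>z. exp (q z) = deriv g z - b"
    using holomorphic_logarithm_exists [of UNIV "\<lambda>z. deriv g z - b" 0] omit by auto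
  \<comment> \<open>The hypothesis on the spherical derivative bounds \<open>\<bar>g'\<bar>\<close>
    by the square of \<open>\<bar>g\<bar>\<close>, so \<open>g'\<close> inherits exponential type
    with doubled constants. This makes \<open>q\<close> affine.\<close>
  have "Re (q z) \<le> (2 * A) * cmod z + (2 * B + ln (2 * M + cmod b))" for z
  proof -
    define E where "E = exp (A * cmod z + B)"
    have E: "E \<ge> 1" using AB by (simp add: E_def)
    have "exp (Re (q z)) = cmod (deriv g z - b)" by (metis norm_exp_eq_Re q(2))
    also have "\<dots> \<le> cmod (deriv g z) + cmod b" by (rule norm_triangle_ineq4)
    also have "\<dots> \<le> M * (1 + (cmod (g z))\<^sup>2) + cmod b" using M by simp
    also have "\<dots> \<le> M * (E\<^sup>2 + E\<^sup>2) + cmod b * E\<^sup>2"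
    proof (intro add_mono mult_left_mono)
      show "1 \<le> E\<^sup>2" using E by (simp add: one_le_power)
      show "(cmod (g z))\<^sup>2 \<le> E\<^sup>2" using AB(3) unfolding E_def by (intro power_mono) auto
      show "cmod b \<le> cmod b * E\<^sup>2" using E by (simp add: mult_le_cancel_left1 one_le_power)
    qed (use M0 in auto)
    also have "\<dots> = (2 * M + cmod b) * E\<^sup>2" by (simp add: algebra_simps)
    also have "\<dots> = exp (ln (2 * M + cmod b) + 2 * (A * cmod z + B))"
    proof -
      have "2 * M + cmod b > 0" using M0 \<open>b \<noteq> 0\<close> by (simp add: add_nonneg_pos)
      then show ?thesis by (simp add: E_def exp_add exp_double power_mult_distrib)
    qed
    finally show ?thesis by (simp add: algebra_simps)
  qed
  then obtain \<alpha> \<beta> where ab: "\<And>z. q z = \<alpha> * z + \<beta>" using entire_linear_real_part_bound [OF q(1)] by blast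
  have dg: "deriv g z = b + exp (\<alpha> * z + \<beta>)" for z using q(2)[of z] ab by (simp add: algebra_simps)
  have *: "\<exists>c. \<forall>z. g z = H z + c" if "\<And>z. (H has_field_derivative deriv g z) (at z)" for H
  proof -
    have "((\<lambda>z. g z - H z) has_field_derivative 0) (at z)" for z
      using DERIV_diff [OF der that] by simp
    then obtain c where "\<And>z. g z - H z = c"
      using has_field_derivative_zero_constant [of UNIV "\<lambda>z. g z - H z"] by auto
    then show ?thesis by (metis add.commute diff_add_cancel)
  qed
  show ?thesis
  proof (cases "\<alpha> = 0")
    case True
    have "\<exists>c. \<forall>z. g z = (b + exp \<beta>) * z + c"
      using True dg by (intro *) (auto intro!: derivative_eq_intros)
    then show ?thesis using that by blast
  next
    case False
    have "\<exists>c. \<forall>z. g z = (b * z + exp (\<alpha> * z + \<beta>) / \<alpha>) + c"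
      using False dg by (intro *) (auto intro!: derivative_eq_intros)
    then obtain c where c: "\<And>z. g z = b * z + exp (\<alpha> * z + \<beta>) / \<alpha> + c" by blast
    obtain z where "M * (1 + (cmod (b * z + exp (\<alpha> * z + \<beta>) / \<alpha> + c))\<^sup>2) < cmod (b + exp (\<alpha> * z + \<beta>))"
      using entire_derivative_affine_exp_unbounded [OF \<open>b \<noteq> 0\<close> False] .
    then show ?thesis using M[of z] dg[of z] c[of z] by auto
  qed
qed

section \<open>Limits of rescaled functions\<close>

lemma uniform_limit_deriv:
  assumes ul: "uniform_limit (ball z0 \<delta>) f g F" and hol: "\<forall>\<^sub>F n in F. f n holomorphic_on ball z0 \<delta>"
    and g: "g holomorphic_on ball z0 \<delta>" and r: "r < \<delta>"
  shows "uniform_limit (cball z0 r) (\<lambda>n. deriv (f n)) (deriv g) F"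
  unfolding uniform_limit_iff
proof (intro allI impI)
  fix e :: real assume e: "e > 0"
  \<comment> \<open>Discs of radius \<open>s\<close> about points of \<open>cball z0 r\<close> still
    lie in \<open>ball z0 \<delta>\<close>. An error below \<open>e * s / 2\<close> there gives, by
    Cauchy, a derivative error of at most \<open>e / 2\<close>.\<close>
  define s where "s = (\<delta> - r) / 2"
  have s: "s > 0" using r by (simp add: s_def)
  have sub: "cball w s \<subseteq> ball z0 \<delta>" if "w \<in> cball z0 r" for w
  proof
    fix x assume "x \<in> cball w s"
    then have "dist z0 x \<le> r + s" using that dist_triangle[of z0 x w] by simp
    also have "\<dots> < \<delta>" using r by (simp add: s_def field_simps)
    finally show "x \<in> ball z0 \<delta>" by simp
  qed
  have "\<forall>\<^sub>F n in F. \<forall>x\<in>ball z0 \<delta>. dist (f n x) (g x) < e * s / 2"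
    by (rule uniform_limitD [OF ul]) (use e s in simp)
  with hol show "\<forall>\<^sub>F n in F. \<forall>w\<in>cball z0 r. dist (deriv (f n) w) (deriv g w) < e"
  proof eventually_elim
    case (elim n)
    show ?case
    proof
      fix w assume w: "w \<in> cball z0 r"
      have h: "(\<lambda>x. f n x - g x) holomorphic_on cball w s"
        using elim g sub[OF w] by (intro holomorphic_intros) (auto intro: holomorphic_on_subset)
      have "cmod ((deriv ^^ 1) (\<lambda>x. f n x - g x) w) \<le> fact 1 * (e * s / 2) / s ^ 1"
      proof (rule Cauchy_inequality)
        show "(\<lambda>x. f n x - g x) holomorphic_on ball w s" using h by (rule holomorphic_on_subset) auto
        show "continuous_on (cball w s) (\<lambda>x. f n x - g x)" using h by (rule holomorphic_on_imp_continuous_on)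
        fix x assume "cmod (w - x) = s"
        then have "x \<in> ball z0 \<delta>" using sub[OF w] by (auto simp: dist_norm)
        then show "cmod (f n x - g x) \<le> e * s / 2" using elim by (auto simp: dist_norm intro: less_imp_le)
      qed (rule s)
      then have "cmod (deriv (\<lambda>x. f n x - g x) w) \<le> e / 2" using s by simp
      moreover have "w \<in> ball z0 \<delta>" using w r by simp
      then have "deriv (\<lambda>x. f n x - g x) w = deriv (f n) w - deriv g w"
        using elim g by (intro deriv_diff) (auto intro: holomorphic_on_imp_differentiable_at)
      ultimately show "dist (deriv (f n) w) (deriv g w) < e" using e by (simp add: dist_norm)
    qed
  qed
qed

lemma Hurwitz_eventually_no_zeros:
  assumes S: "open S" "connected S"
    and hol: "\<forall>\<^sub>F n in sequentially. f n holomorphic_on S" and "g holomorphic_on S"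
    and ul: "\<And>K. compact K \<Longrightarrow> K \<subseteq> S \<Longrightarrow> uniform_limit K f g sequentially"
    and "\<not> g constant_on S" and nz: "\<forall>\<^sub>F n in sequentially. \<forall>z\<in>S. f n z \<noteq> 0" and "z0 \<in> S"
  shows "g z0 \<noteq> 0"
proof -
  from hol nz have "\<forall>\<^sub>F n in sequentially. f n holomorphic_on S \<and> (\<forall>z\<in>S. f n z \<noteq> 0)"
    by (rule eventually_conj)
  then obtain N where N: "\<And>n. n \<ge> N \<Longrightarrow> f n holomorphic_on S \<and> (\<forall>z\<in>S. f n z \<noteq> 0)"
    unfolding eventually_sequentially by blast
  show ?thesis
  proof (rule Hurwitz_no_zeros [OF S, of "\<lambda>n. f (n + N)" g])
    show "uniform_limit K (\<lambda>n. f (n + N)) g sequentially" if "compact K" "K \<subseteq> S" for K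
      unfolding uniform_limit_iff
    proof (intro allI impI)
      fix e :: real assume "e > 0"
      then have "\<forall>\<^sub>F n in sequentially. \<forall>x\<in>K. dist (f n x) (g x) < e"
        using ul [OF that] unfolding uniform_limit_iff by blast
      then show "\<forall>\<^sub>F n in sequentially. \<forall>x\<in>K. dist (f (n + N) x) (g x) < e"
        by (rule sequentially_offset)
    qed
  qed (use N assms in auto)
qed

section \<open>Exclusion of isolated poles of the limit\<close>

text \<open>The zeros of \<open>P\<close> are simple and are also zeros of \<open>N\<close>, so the
  singularities of \<open>N / P\<close> are removable, with value
  \<open>deriv N / deriv P\<close>.\<close>

lemma holomorphic_quotient_simple_zeros:
  assumes S: "open S" and N: "N holomorphic_on S" and P: "P holomorphic_on S"
    and zeros: "\<And>z. z \<in> S \<Longrightarrow> P z = 0 \<Longrightarrow> N z = 0 \<and> deriv P z \<noteq> 0"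
  obtains Q where "Q holomorphic_on S" "\<And>z. z \<in> S \<Longrightarrow> N z = Q z * P z"
proof -
  define Q where "Q = (\<lambda>z. if P z = 0 then deriv N z / deriv P z else N z / P z)"
  have "\<exists>T. open T \<and> p \<in> T \<and> Q holomorphic_on T" if p: "p \<in> S" for p
  proof (cases "P p = 0")
    case False
    define T where "T = S \<inter> P -` (- {0})"
    have "open T" unfolding T_def
      using S P holomorphic_on_imp_continuous_on by (metis continuous_open_preimage open_Compl closed_singleton)
    moreover have "(\<lambda>z. N z / P z) holomorphic_on T"
      by (intro holomorphic_intros holomorphic_on_subset [OF N] holomorphic_on_subset [OF P]) (auto simp: T_def)
    then have "Q holomorphic_on T" by (rule holomorphic_transform) (auto simp: T_def Q_def)
    ultimately show ?thesis using False p by (auto simp: T_def)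
  next
    case True
    \<comment> \<open>Near \<open>p\<close> the quotient equals \<open>N1 / P1\<close>, in which the
      common zero has been divided out and \<open>P1 p = deriv P p\<close> is nonzero.\<close>
    define N1 where "N1 = (\<lambda>z. if z = p then deriv N p else (N z - N p) / (z - p))"
    define P1 where "P1 = (\<lambda>z. if z = p then deriv P p else (P z - P p) / (z - p))"
    have N1: "N1 holomorphic_on S" unfolding N1_def using N S by (rule pole_lemma_open)
    have P1: "P1 holomorphic_on S" unfolding P1_def using P S by (rule pole_lemma_open)
    have Np: "N p = 0" "deriv P p \<noteq> 0" using zeros p True by auto
    define T where "T = S \<inter> P1 -` (- {0})"
    have "open T" unfolding T_def
      using S P1 holomorphic_on_imp_continuous_on by (metis continuous_open_preimage open_Compl closed_singleton)
    moreover have "(\<lambda>z. N1 z / P1 z) holomorphic_on T"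
      by (intro holomorphic_intros holomorphic_on_subset [OF N1] holomorphic_on_subset [OF P1]) (auto simp: T_def)
    then have "Q holomorphic_on T"
      by (rule holomorphic_transform) (auto simp: T_def Q_def N1_def P1_def True Np split: if_splits)
    ultimately show ?thesis using Np p by (auto simp: T_def P1_def)
  qed
  then have "Q holomorphic_on S"
    by (meson holomorphic_on_def holomorphic_on_imp_differentiable_at field_differentiable_at_within)
  moreover have "N z = Q z * P z" if "z \<in> S" for z
    using zeros[OF that] by (auto simp: Q_def)
  ultimately show ?thesis by (rule that)
qed

text \<open>The maximum modulus principle is applied to the holomorphic extension of
  \<open>N / P\<close>.\<close>

lemma boundary_bound_imp_interior_bound:
  assumes N: "N holomorphic_on S" and P: "P holomorphic_on S" and S: "open S" "cball z0 r \<subseteq> S"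
    and zeros: "\<And>z. z \<in> S \<Longrightarrow> P z = 0 \<Longrightarrow> N z = 0 \<and> deriv P z \<noteq> 0"
    and bound: "\<And>z. z \<in> sphere z0 r \<Longrightarrow> P z \<noteq> 0 \<and> cmod (N z) \<le> C * cmod (P z)"
    and z: "z \<in> ball z0 r"
  shows "cmod (N z) \<le> C * cmod (P z)"
proof -
  obtain Q where Q: "Q holomorphic_on S" "\<And>z. z \<in> S \<Longrightarrow> N z = Q z * P z"
    using holomorphic_quotient_simple_zeros [OF S(1) N P zeros] by blast
  have r: "r > 0" using z zero_le_dist [of z0 z] unfolding mem_ball by linarith
  have Qc: "Q holomorphic_on cball z0 r" using Q(1) S(2) by (rule holomorphic_on_subset)
  have "cmod (Q z) \<le> C"
  proof (rule maximum_modulus_frontier [of Q "ball z0 r"])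
    show "Q holomorphic_on interior (ball z0 r)" using Qc by (auto intro: holomorphic_on_subset)
    show "continuous_on (closure (ball z0 r)) Q"
      using Qc r by (simp add: holomorphic_on_imp_continuous_on)
    fix w assume "w \<in> frontier (ball z0 r)"
    then have w: "w \<in> sphere z0 r" using r by simp
    then have "w \<in> S" using S(2) by auto
    have "cmod (Q w) * cmod (P w) \<le> C * cmod (P w)"
      using bound[OF w] Q(2)[OF \<open>w \<in> S\<close>] by (simp add: norm_mult)
    then show "cmod (Q w) \<le> C" using bound[OF w] by simp
  qed (use z in auto)
  moreover have "z \<in> S" using z S(2) by auto
  ultimately show ?thesis using Q(2) by (simp add: norm_mult mult_right_mono)
qed

text \<open>If \<open>k = (w - z0) ^ n * g\<close> with \<open>g z0 \<noteq> 0\<close>, then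
  \<open>k'\<close> vanishes to order \<open>n - 1\<close> only, whereas \<open>k\<close> and its
  square vanish to order at least \<open>n\<close>. Cancelling \<open>(w - z0) ^ (n - 1)\<close> and
  letting \<open>w\<close> tend to \<open>z0\<close> would give
  \<open>n * \<bar>g z0\<bar> \<le> 0\<close>.\<close>

lemma logarithmic_derivative_bounded_imp_zero:
  assumes k: "k holomorphic_on ball z0 r" "k z0 = 0" and "r > 0"
    and bound: "\<And>z. z \<in> ball z0 r \<Longrightarrow> cmod (deriv k z + b * (k z)\<^sup>2) \<le> C * cmod (k z)"
    and z: "z \<in> ball z0 r"
  shows "k z = 0"
proof (rule ccontr)
  assume "k z \<noteq> 0"
  have "\<not> k constant_on ball z0 r"
    using k(2) z \<open>k z \<noteq> 0\<close> \<open>r > 0\<close> unfolding constant_on_def by (metis centre_in_ball)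
  then obtain g s n where n: "0 < n" and s: "0 < s" "ball z0 s \<subseteq> ball z0 r" and g: "g holomorphic_on ball z0 s"
    and kg: "\<And>w. w \<in> ball z0 s \<Longrightarrow> k w = (w - z0) ^ n * g w"
    and gnz: "\<And>w. w \<in> ball z0 s \<Longrightarrow> g w \<noteq> 0"
    using holomorphic_factor_zero_nonconstant [OF k(1) open_ball connected_ball _ k(2)] \<open>r > 0\<close>
    by (metis centre_in_ball)
  obtain m where m: "n = Suc m" using n gr0_implies_Suc by blast
  have dg: "(g has_field_derivative deriv g w) (at w)" if "w \<in> ball z0 s" for w
    using g that by (meson holomorphic_derivI open_ball)
  have est: "cmod (of_nat n * g w + (w - z0) * deriv g w + b * (w - z0) ^ Suc n * (g w)\<^sup>2) \<le> C * cmod ((w - z0) * g w)"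
    if w: "w \<in> ball z0 s" "w \<noteq> z0" for w
  proof -
    have "((\<lambda>w. (w - z0) ^ n * g w) has_field_derivative
        of_nat n * (w - z0) ^ m * g w + (w - z0) ^ n * deriv g w) (at w)"
    proof -
      have "((\<lambda>w. (w - z0) ^ Suc m) has_field_derivative of_nat (Suc m) * (w - z0) ^ m) (at w)"
        by (auto intro!: derivative_eq_intros simp del: power_Suc)
      from DERIV_mult [OF this dg[OF w(1)]] show ?thesis by (simp add: m algebra_simps)
    qed
    then have "(k has_field_derivative of_nat n * (w - z0) ^ m * g w + (w - z0) ^ n * deriv g w) (at w)"
      by (rule has_field_derivative_transform_within_open [OF _ open_ball w(1)]) (simp add: kg)
    then have "deriv k w = of_nat n * (w - z0) ^ m * g w + (w - z0) ^ n * deriv g w"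
      by (rule DERIV_imp_deriv)
    then have "deriv k w + b * (k w)\<^sup>2
      = (w - z0) ^ m * (of_nat n * g w + (w - z0) * deriv g w + b * (w - z0) ^ Suc n * (g w)\<^sup>2)"
      unfolding kg[OF w(1)] m power2_eq_square by (simp add: distrib_left distrib_right mult_ac)
    moreover have "k w = (w - z0) ^ m * ((w - z0) * g w)" using kg[OF w(1)] by (simp add: m)
    moreover have "cmod (deriv k w + b * (k w)\<^sup>2) \<le> C * cmod (k w)" using bound w s by blast
    ultimately have "cmod ((w - z0) ^ m) * cmod (of_nat n * g w + (w - z0) * deriv g w + b * (w - z0) ^ Suc n * (g w)\<^sup>2)
      \<le> cmod ((w - z0) ^ m) * (C * cmod ((w - z0) * g w))"
      by (simp only: norm_mult mult_ac)
    then show ?thesis using w(2) by simp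
  qed
  have z0s: "z0 \<in> ball z0 s" using s by simp
  have cg: "g \<midarrow>z0\<rightarrow> g z0" "deriv g \<midarrow>z0\<rightarrow> deriv g z0"
    using g z0s holomorphic_deriv [OF g open_ball]
    by (metis continuous_on_eq_continuous_at holomorphic_on_imp_continuous_on isContD open_ball)+
  have "cmod (of_nat n * g z0 + (z0 - z0) * deriv g z0 + b * (z0 - z0) ^ Suc n * (g z0)\<^sup>2) \<le> C * cmod ((z0 - z0) * g z0)"
  proof (rule tendsto_le)
    show "((\<lambda>w. C * cmod ((w - z0) * g w)) \<longlongrightarrow> C * cmod ((z0 - z0) * g z0)) (at z0)"
      by (intro tendsto_intros cg)
    show "((\<lambda>w. cmod (of_nat n * g w + (w - z0) * deriv g w + b * (w - z0) ^ Suc n * (g w)\<^sup>2)) \<longlongrightarrow>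
       cmod (of_nat n * g z0 + (z0 - z0) * deriv g z0 + b * (z0 - z0) ^ Suc n * (g z0)\<^sup>2)) (at z0)"
      by (intro tendsto_intros cg)
    have "\<forall>\<^sub>F w in at z0. w \<in> ball z0 s - {z0}"
      using eventually_at_in_open [of "ball z0 s" z0] s by simp
    then show "\<forall>\<^sub>F w in at z0. cmod (of_nat n * g w + (w - z0) * deriv g w + b * (w - z0) ^ Suc n * (g w)\<^sup>2) \<le> C * cmod ((w - z0) * g w)"
      by eventually_elim (use est in blast)
  qed simp
  then show False using n gnz[OF z0s] by simp
qed

text \<open>The quotient \<open>(k n' + b (k n)\<^sup>2) / (k n - \<epsilon> n)\<close> has only removable singularities, so a bound on a circle
  propagates to its interior; in the limit it bounds the logarithmic derivative of \<open>k\<close> at a zero of \<open>k\<close>.\<close>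

lemma no_isolated_zero_in_limit:
  fixes \<epsilon> :: "nat \<Rightarrow> complex"
  assumes ul: "uniform_limit (ball z0 \<delta>) kn k sequentially" and "\<delta> > 0"
    and hol: "\<forall>\<^sub>F n in sequentially. kn n holomorphic_on ball z0 \<delta>" and k: "k holomorphic_on ball z0 \<delta>" "k z0 = 0"
    and \<epsilon>: "\<epsilon> \<longlonglongrightarrow> 0" "\<And>n. \<epsilon> n \<noteq> 0" and "b \<noteq> 0"
    and hit: "\<forall>\<^sub>F n in sequentially. \<forall>w\<in>ball z0 \<delta>. kn n w = \<epsilon> n \<longrightarrow> deriv (kn n) w = - b * (\<epsilon> n)\<^sup>2"
  obtains r where "r > 0" "\<And>w. w \<in> ball z0 r \<Longrightarrow> k w = 0"
proof (cases "\<exists>w\<in>ball z0 \<delta>. k w \<noteq> 0")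
  case False
  then show ?thesis using that \<open>\<delta> > 0\<close> by blast
next
  case True
  then obtain w where "w \<in> ball z0 \<delta>" "k w \<noteq> 0" by blast
  then obtain r0 where r0: "0 < r0" "ball z0 r0 \<subseteq> ball z0 \<delta>" "\<And>z. z \<in> ball z0 r0 - {z0} \<Longrightarrow> k z \<noteq> 0"
    using isolated_zeros [OF k(1) open_ball connected_ball _ k(2)] \<open>\<delta> > 0\<close> by (metis centre_in_ball)
  \<comment> \<open>Halving places the whole closed disc where \<open>k\<close> is holomorphic and
    has no zero other than \<open>z0\<close>, so \<open>\<bar>k\<bar>\<close> has a positive minimum
    on the circle.\<close>
  define r where "r = min r0 \<delta> / 2"
  have r: "r > 0" "r < \<delta>" "r < r0" using r0 \<open>\<delta> > 0\<close> by (auto simp: r_def)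
  have sub: "cball z0 r \<subseteq> ball z0 \<delta>" using r by auto
  have contk: "continuous_on (cball z0 r) k"
    using k(1) sub by (meson continuous_on_subset holomorphic_on_imp_continuous_on)
  have contk': "continuous_on (cball z0 r) (deriv k)"
    using holomorphic_deriv [OF k(1)] sub by (meson continuous_on_subset holomorphic_on_imp_continuous_on open_ball)
  have "k z \<noteq> 0" if "z \<in> sphere z0 r" for z
    using r0(3)[of z] that r by auto
  moreover have "continuous_on (sphere z0 r) (\<lambda>z. cmod (k z))"
    using contk by (intro continuous_intros) (auto intro: continuous_on_subset)
  then obtain x where "x \<in> sphere z0 r" "\<And>y. y \<in> sphere z0 r \<Longrightarrow> cmod (k x) \<le> cmod (k y)"
    using continuous_attains_inf [of "sphere z0 r" "\<lambda>z. cmod (k z)"] r by auto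
  ultimately obtain m where m: "m > 0" "\<And>z. z \<in> sphere z0 r \<Longrightarrow> m \<le> cmod (k z)"
    by (metis zero_less_norm_iff)
  have "bounded (k ` cball z0 r)" "bounded (deriv k ` cball z0 r)"
    using contk contk' by (simp_all add: compact_continuous_image compact_imp_bounded)
  then obtain B1 B2 where B: "\<And>z. z \<in> cball z0 r \<Longrightarrow> cmod (k z) \<le> B1" "\<And>z. z \<in> cball z0 r \<Longrightarrow> cmod (deriv k z) \<le> B2"
    unfolding bounded_iff by (metis imageI)
  define B where "B = (B2 + 1) + cmod b * (B1 + 1)\<^sup>2"
  \<comment> \<open>On the circle the numerator is at most \<open>B\<close>. The denominator exceeds
    \<open>m / 3\<close>, since both the error of \<open>kn n\<close> and
    \<open>\<epsilon> n\<close> are below a third of the minimum \<open>m\<close>.\<close>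
  define C where "C = B / (m / 3)"
  have ul': "uniform_limit (cball z0 r) (\<lambda>n. deriv (kn n)) (deriv k) sequentially"
    using ul hol k(1) r(2) by (rule uniform_limit_deriv)
  have ulr: "uniform_limit (cball z0 r) kn k sequentially" using ul sub by (rule uniform_limit_on_subset)
  have ev1: "\<forall>\<^sub>F n in sequentially. \<forall>z\<in>cball z0 r. dist (kn n z) (k z) < min 1 (m / 3)"
    by (rule uniform_limitD [OF ulr]) (use m in simp)
  have ev2: "\<forall>\<^sub>F n in sequentially. \<forall>z\<in>cball z0 r. dist (deriv (kn n) z) (deriv k z) < 1"
    by (rule uniform_limitD [OF ul']) simp
  have ev3: "\<forall>\<^sub>F n in sequentially. cmod (\<epsilon> n) < m / 3"
    using tendsto_norm_zero [OF \<epsilon>(1)] by (rule order_tendstoD(2)) (use m(1) in simp)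
  have ev: "\<forall>\<^sub>F n in sequentially. \<forall>z\<in>ball z0 r. cmod (deriv (kn n) z + b * (kn n z)\<^sup>2) \<le> C * cmod (kn n z - \<epsilon> n)"
    using ev1 ev2 ev3 hol hit
  proof eventually_elim
    case (elim n)
    have "(\<lambda>z. deriv (kn n) z + b * (kn n z)\<^sup>2) holomorphic_on ball z0 \<delta>"
      using elim by (intro holomorphic_intros holomorphic_deriv) auto
    moreover have "(\<lambda>z. kn n z - \<epsilon> n) holomorphic_on ball z0 \<delta>"
      using elim by (intro holomorphic_intros) auto
    \<comment> \<open>Where \<open>kn n = \<epsilon> n\<close> the derivative is
      \<open>- b * (\<epsilon> n)\<^sup>2\<close>. This cancels the numerator and, being nonzero,
      makes the zero of the denominator simple.\<close>
    moreover have "deriv (kn n) z + b * (kn n z)\<^sup>2 = 0 \<and> deriv (\<lambda>z. kn n z - \<epsilon> n) z \<noteq> 0"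
      if "z \<in> ball z0 \<delta>" "kn n z - \<epsilon> n = 0" for z
    proof -
      have "deriv (kn n) z = - b * (\<epsilon> n)\<^sup>2" using elim that by simp
      moreover have "deriv (\<lambda>z. kn n z - \<epsilon> n) z = deriv (kn n) z"
        using elim(4) that by (subst deriv_diff) (auto intro: holomorphic_on_imp_differentiable_at)
      ultimately show ?thesis using that \<epsilon>(2)[of n] \<open>b \<noteq> 0\<close> by simp
    qed
    moreover have "kn n z - \<epsilon> n \<noteq> 0 \<and> cmod (deriv (kn n) z + b * (kn n z)\<^sup>2) \<le> C * cmod (kn n z - \<epsilon> n)"
      if z: "z \<in> sphere z0 r" for z
    proof -
      have zc: "z \<in> cball z0 r" using z by auto
      have 1: "cmod (kn n z - k z) < 1" "cmod (kn n z - k z) < m / 3" "cmod (deriv (kn n) z - deriv k z) < 1"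
        using elim zc by (auto simp: dist_norm)
      have "m \<le> cmod (k z)" using m(2) z by blast
      also have "\<dots> \<le> cmod (kn n z - \<epsilon> n) + cmod (\<epsilon> n) + cmod (kn n z - k z)"
        using norm_triangle_ineq4 [of "kn n z - \<epsilon> n" "kn n z - k z - \<epsilon> n"] norm_triangle_ineq4 [of "kn n z - k z" "\<epsilon> n"]
        by simp
      finally have low: "m / 3 < cmod (kn n z - \<epsilon> n)" using 1 elim by simp
      have "cmod (kn n z) \<le> B1 + 1" using 1 B(1)[OF zc] norm_triangle_sub[of "kn n z" "k z"] by linarith
      then have "cmod (b * (kn n z)\<^sup>2) \<le> cmod b * (B1 + 1)\<^sup>2"
        by (simp add: norm_mult norm_power mult_left_mono power_mono)
      moreover have "cmod (deriv (kn n) z) \<le> B2 + 1"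
        using 1 B(2)[OF zc] norm_triangle_sub[of "deriv (kn n) z" "deriv k z"] by linarith
      ultimately have up: "cmod (deriv (kn n) z + b * (kn n z)\<^sup>2) \<le> B"
        unfolding B_def by (rule norm_triangle_mono [rotated])
      then have "0 \<le> B" using norm_ge_zero order_trans by blast
      then have "B \<le> C * cmod (kn n z - \<epsilon> n)"
        unfolding C_def using low m(1) by (simp add: field_simps mult_left_mono)
      then show ?thesis using low up m(1) by auto
    qed
    ultimately show ?case
      using boundary_bound_imp_interior_bound [OF _ _ open_ball sub] by blast
  qed
  have "cmod (deriv k z + b * (k z)\<^sup>2) \<le> C * cmod (k z)" if z: "z \<in> ball z0 r" for z
  proof -
    have zc: "z \<in> cball z0 r" using z by auto
    have t: "(\<lambda>n. kn n z) \<longlonglongrightarrow> k z" "(\<lambda>n. deriv (kn n) z) \<longlonglongrightarrow> deriv k z"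
      using tendsto_uniform_limitI [OF ulr zc] tendsto_uniform_limitI [OF ul' zc] .
    have "cmod (deriv k z + b * (k z)\<^sup>2) \<le> C * cmod (k z - 0)"
    proof (rule tendsto_le [OF sequentially_bot])
      show "(\<lambda>n. C * cmod (kn n z - \<epsilon> n)) \<longlonglongrightarrow> C * cmod (k z - 0)" by (intro tendsto_intros t \<epsilon>)
      show "(\<lambda>n. cmod (deriv (kn n) z + b * (kn n z)\<^sup>2)) \<longlonglongrightarrow> cmod (deriv k z + b * (k z)\<^sup>2)"
        by (intro tendsto_intros t)
      show "\<forall>\<^sub>F n in sequentially. cmod (deriv (kn n) z + b * (kn n z)\<^sup>2) \<le> C * cmod (kn n z - \<epsilon> n)"
        using ev by eventually_elim (use z in blast)
    qed
    then show ?thesis by simp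
  qed
  moreover have "k holomorphic_on ball z0 r" using k(1) by (rule holomorphic_on_subset) (use r in auto)
  ultimately have "k z = 0" if "z \<in> ball z0 r" for z
    using logarithmic_derivative_bounded_imp_zero [of k z0 r b C z] k(2) r(1) that by blast
  then show ?thesis using that r(1) by blast
qed

section \<open>The limit of the rescaled functions\<close>

text \<open>The assumptions turn out to be contradictory. The factor \<open>c > 1\<close> in
  \<open>deriv_bound\<close> is there because rescaling bounds the spherical derivative by
  \<open>L + 1\<close> only asymptotically; \<open>inverse_at_0\<close> keeps a normalisation
  available when the functions tend to infinity.\<close>

locale rescaled_limit = spherical_limit UNIV g G for g :: "nat \<Rightarrow> complex \<Rightarrow> complex" and G +
  fixes a b :: complex and \<rho> :: "nat \<Rightarrow> real" and L :: real
  assumes ab: "a \<noteq> 0" "b \<noteq> 0" and \<rho>: "\<And>n. \<rho> n > 0" "\<rho> \<longlonglongrightarrow> 0" and L: "cmod b \<le> L"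
    and value_imp: "\<And>C. compact C \<Longrightarrow> \<forall>\<^sub>F n in sequentially. \<forall>w\<in>C.
      \<not> is_pole (g n) w \<longrightarrow> g n w = a / \<rho> n \<longrightarrow> deriv (g n) w = b"
    and deriv_imp: "\<And>C. compact C \<Longrightarrow> \<forall>\<^sub>F n in sequentially. \<forall>w\<in>C.
      \<not> is_pole (g n) w \<longrightarrow> deriv (g n) w = b \<longrightarrow> g n w = a / \<rho> n"
    and zero_imp: "\<And>C. compact C \<Longrightarrow> \<forall>\<^sub>F n in sequentially. \<forall>w\<in>C.
      \<not> is_pole (g n) w \<longrightarrow> g n w = 0 \<longrightarrow> cmod (deriv (g n) w) \<le> L"
    and deriv_bound: "\<And>C c. compact C \<Longrightarrow> c > 1 \<Longrightarrow> \<forall>\<^sub>F n in sequentially. \<forall>w\<in>C.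
      \<not> is_pole (g n) w \<longrightarrow> cmod (deriv (g n) w) \<le> c * (L + 1) * (1 + (cmod (g n w))\<^sup>2)"
    and at_0: "\<And>n. \<not> is_pole (g n) 0 \<Longrightarrow> L + 1 \<le> cmod (deriv (g n) 0)"
    and inverse_at_0: "\<And>n. L + 1 \<le> cmod (deriv (\<lambda>w. inverse (g n w)) 0)"
begin

text \<open>The derivative of \<open>1 / g\<close> at a point with \<open>g = a / \<rho>\<close> and
  \<open>g' = b\<close> is \<open>- b * (\<rho> / a)\<^sup>2\<close>. This is the hypothesis of
  \<open>no_isolated_zero_in_limit\<close> with \<open>\<epsilon> = \<rho> / a\<close>, so a zero of
  \<open>1 / G\<close> cannot be isolated.\<close>

lemma Infty_open:
  assumes "G z0 = Infty"
  shows "\<forall>\<^sub>F w in nhds z0. G w = Infty"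
proof -
  have ne: "G z0 \<noteq> Fin 0" using assms by simp
  show ?thesis
  proof (rule local_inverse [OF UNIV_I ne])
    fix \<delta> :: real
    define k where "k = (\<lambda>w. inverse (fin_part (G w)))"
    assume \<delta>: "\<delta> > 0" and G0: "\<And>w. w \<in> ball z0 \<delta> \<Longrightarrow> G w \<noteq> Fin 0"
      and hol: "\<forall>\<^sub>F n in sequentially. (\<lambda>w. inverse (g n w)) holomorphic_on ball z0 \<delta>"
      and "uniform_limit (ball z0 \<delta>) (\<lambda>n w. inverse (g n w)) (\<lambda>w. inverse (fin_part (G w))) sequentially"
      and "(\<lambda>w. inverse (fin_part (G w))) holomorphic_on ball z0 \<delta>"
    then have ul: "uniform_limit (ball z0 \<delta>) (\<lambda>n w. inverse (g n w)) k sequentially"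
      and k: "k holomorphic_on ball z0 \<delta>" by (simp_all add: k_def)
    have "k z0 = 0" by (simp add: k_def assms)
    have "(\<lambda>n. \<rho> n / a) \<longlonglongrightarrow> of_real 0 / a" using ab by (intro tendsto_intros \<rho>) auto
    then have \<epsilon>: "(\<lambda>n. \<rho> n / a) \<longlonglongrightarrow> 0" by simp
    have hit: "\<forall>\<^sub>F n in sequentially. \<forall>w\<in>ball z0 \<delta>. inverse (g n w) = \<rho> n / a \<longrightarrow>
        deriv (\<lambda>w. inverse (g n w)) w = - b * (\<rho> n / a)\<^sup>2"
      using value_imp [OF compact_cball [of z0 \<delta>]] nice [OF compact_cball [of z0 \<delta>] subset_UNIV]
    proof eventually_elim
      case (elim n)
      show ?case
      proof (intro ballI impI)
        fix w assume w: "w \<in> ball z0 \<delta>" and eq: "inverse (g n w) = \<rho> n / a"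
        have wc: "w \<in> cball z0 \<delta>" using w by auto
        have nz: "g n w \<noteq> 0" using eq \<rho>(1)[of n] ab by auto
        have np: "\<not> is_pole (g n) w" using nicely_meromorphic_on_pole_eq_0 [OF elim(2) wc] nz by blast
        have val: "g n w = a / \<rho> n" using eq by (metis inverse_divide inverse_inverse_eq)
        then have "deriv (g n) w = b" using elim(1) wc np by blast
        moreover have "g n analytic_on {w}"
          using nicely_meromorphic_on_imp_analytic_at [OF elim(2) wc np] .
        then have "g n field_differentiable at w" by (simp add: analytic_on_imp_differentiable_at)
        ultimately have "(g n has_field_derivative b) (at w)" by (simp add: DERIV_deriv_iff_field_differentiable [symmetric])
        then have "((\<lambda>w. inverse (g n w)) has_field_derivative - (inverse (g n w) * b * inverse (g n w))) (at w)"
          using nz by (rule DERIV_inverse')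
        then have "deriv (\<lambda>w. inverse (g n w)) w = - (inverse (g n w) * b * inverse (g n w))"
          by (rule DERIV_imp_deriv)
        then show "deriv (\<lambda>w. inverse (g n w)) w = - b * (\<rho> n / a)\<^sup>2"
          by (simp add: eq power2_eq_square)
      qed
    qed
    have \<epsilon>0: "of_real (\<rho> n) / a \<noteq> 0" for n using \<rho>(1)[of n] ab by simp
    obtain r where r: "r > 0" "\<And>w. w \<in> ball z0 r \<Longrightarrow> k w = 0"
      using no_isolated_zero_in_limit [OF ul \<delta> hol k \<open>k z0 = 0\<close> \<epsilon> \<epsilon>0 ab(2) hit] by blast
    have "G w = Infty" if "w \<in> ball z0 (min r \<delta>)" for w
      using r(2)[of w] G0[of w] that by (cases "G w") (auto simp: k_def)
    then show ?thesis
      using eventually_nhds_in_open [of "ball z0 (min r \<delta>)" z0] r \<delta> by (auto elim: eventually_mono)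
  qed
qed

text \<open>Otherwise the reciprocals tend uniformly to 0 near the origin and so do their
  derivatives, against the lower bound \<open>L + 1\<close> in \<open>inverse_at_0\<close>.\<close>

lemma not_identically_Infty: "\<not> (\<forall>w. G w = Infty)"
proof
  assume Inf: "\<forall>w. G w = Infty"
  then have ne: "G 0 \<noteq> Fin 0" by simp
  show False
  proof (rule local_inverse [OF UNIV_I ne])
    fix \<delta> :: real
    assume \<delta>: "\<delta> > 0" and hol: "\<forall>\<^sub>F n in sequentially. (\<lambda>w. inverse (g n w)) holomorphic_on ball 0 \<delta>"
      and ul: "uniform_limit (ball 0 \<delta>) (\<lambda>n w. inverse (g n w)) (\<lambda>w. inverse (fin_part (G w))) sequentially"
    have "uniform_limit (cball 0 (\<delta>/2)) (\<lambda>n. deriv (\<lambda>w. inverse (g n w))) (deriv (\<lambda>w. inverse (fin_part (G w)))) sequentially"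
      using ul hol \<delta> by (intro uniform_limit_deriv [where \<delta> = \<delta>]) (auto simp: Inf)
    then have "(\<lambda>n. deriv (\<lambda>w. inverse (g n w)) 0) \<longlonglongrightarrow> deriv (\<lambda>w. inverse (fin_part (G w))) 0"
      by (rule tendsto_uniform_limitI) (use \<delta> in simp)
    then have "(\<lambda>n. cmod (deriv (\<lambda>w. inverse (g n w)) 0)) \<longlonglongrightarrow> cmod 0"
      using Inf by (intro tendsto_norm) simp
    then have "L + 1 \<le> cmod 0"
      by (rule tendsto_lowerbound) (use inverse_at_0 in auto)
    then show False using L norm_ge_zero [of b] by simp
  qed
qed

lemma finite_everywhere: "G w \<noteq> Infty"
proof -
  have "open {w. G w = Infty}"
  proof (rule Topological_Spaces.openI)
    fix z assume "z \<in> {w. G w = Infty}"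
    then show "\<exists>T. open T \<and> z \<in> T \<and> T \<subseteq> {w. G w = Infty}"
      using Infty_open [of z] unfolding eventually_nhds by auto
  qed
  moreover have "closed {w. G w = Infty}"
    using continuous by (intro closed_Collect_eq continuous_intros) auto
  ultimately have "{w. G w = Infty} = {} \<or> {w. G w = Infty} = UNIV"
    using connected_UNIV unfolding connected_clopen by auto
  then show ?thesis using not_identically_Infty by auto
qed

abbreviation (input) "\<gamma> \<equiv> \<lambda>w. fin_part (G w)"

lemma local_limit:
  obtains r where "r > 0" "\<forall>\<^sub>F n in sequentially. g n holomorphic_on ball z0 r"
    "\<forall>\<^sub>F n in sequentially. \<forall>w\<in>cball z0 r. \<not> is_pole (g n) w"
    "uniform_limit (cball z0 r) g \<gamma> sequentially"
    "uniform_limit (cball z0 r) (\<lambda>n. deriv (g n)) (deriv \<gamma>) sequentially"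
    "\<gamma> holomorphic_on ball z0 r"
proof (rule local_finite [OF UNIV_I finite_everywhere])
  fix \<delta> :: real
  assume \<delta>: "\<delta> > 0" and hol: "\<forall>\<^sub>F n in sequentially. g n holomorphic_on ball z0 \<delta>"
    and np: "\<forall>\<^sub>F n in sequentially. \<forall>w\<in>ball z0 \<delta>. \<not> is_pole (g n) w"
    and ul: "uniform_limit (ball z0 \<delta>) g \<gamma> sequentially" and k: "\<gamma> holomorphic_on ball z0 \<delta>"
  have sub: "cball z0 (\<delta>/2) \<subseteq> ball z0 \<delta>" "ball z0 (\<delta>/2) \<subseteq> ball z0 \<delta>" using \<delta> by auto
  show thesis
  proof (rule that)
    show "\<delta> / 2 > 0" using \<delta> by simp
    show "\<forall>\<^sub>F n in sequentially. g n holomorphic_on ball z0 (\<delta>/2)"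
      using hol by eventually_elim (rule holomorphic_on_subset [OF _ sub(2)])
    show "\<forall>\<^sub>F n in sequentially. \<forall>w\<in>cball z0 (\<delta>/2). \<not> is_pole (g n) w"
      using np by eventually_elim (use sub in blast)
    show "uniform_limit (cball z0 (\<delta>/2)) g \<gamma> sequentially"
      using ul sub(1) by (rule uniform_limit_on_subset)
    show "uniform_limit (cball z0 (\<delta>/2)) (\<lambda>n. deriv (g n)) (deriv \<gamma>) sequentially"
      using ul hol k by (rule uniform_limit_deriv) (use \<delta> in simp)
    show "\<gamma> holomorphic_on ball z0 (\<delta>/2)" using k sub(2) by (rule holomorphic_on_subset)
  qed
qed

lemma entire: "\<gamma> holomorphic_on UNIV"
proof -
  have "\<gamma> field_differentiable at z" for z
    by (rule local_limit [of z]) (meson centre_in_ball holomorphic_on_imp_differentiable_at open_ball)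
  then show ?thesis by (simp add: holomorphic_on_def field_differentiable_at_within)
qed

lemma pointwise_limit:
  "(\<lambda>n. g n z) \<longlonglongrightarrow> \<gamma> z" "(\<lambda>n. deriv (g n) z) \<longlonglongrightarrow> deriv \<gamma> z"
  "\<forall>\<^sub>F n in sequentially. \<not> is_pole (g n) z"
proof -
  show "(\<lambda>n. g n z) \<longlonglongrightarrow> \<gamma> z"
    by (rule local_limit [of z], erule tendsto_uniform_limitI) simp
  show "(\<lambda>n. deriv (g n) z) \<longlonglongrightarrow> deriv \<gamma> z"
  proof (rule local_limit [of z])
    fix r :: real assume "r > 0" "uniform_limit (cball z r) (\<lambda>n. deriv (g n)) (deriv \<gamma>) sequentially"
    then show ?thesis by (intro tendsto_uniform_limitI [where S = "cball z r"]) auto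
  qed
  show "\<forall>\<^sub>F n in sequentially. \<not> is_pole (g n) z"
  proof (rule local_limit [of z])
    fix r :: real assume r: "r > 0" "\<forall>\<^sub>F n in sequentially. \<forall>w\<in>cball z r. \<not> is_pole (g n) w"
    from r(2) show ?thesis by eventually_elim (use r(1) in auto)
  qed
qed

lemma limit_deriv_bound: "cmod (deriv \<gamma> z) \<le> (L + 1) * (1 + (cmod (\<gamma> z))\<^sup>2)"
proof -
  have *: "cmod (deriv \<gamma> z) \<le> c * ((L + 1) * (1 + (cmod (\<gamma> z))\<^sup>2))" if "c > 1" for c
  proof (rule tendsto_le [OF sequentially_bot])
    show "(\<lambda>n. c * ((L + 1) * (1 + (cmod (g n z))\<^sup>2))) \<longlonglongrightarrow> c * ((L + 1) * (1 + (cmod (\<gamma> z))\<^sup>2))"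
      "(\<lambda>n. cmod (deriv (g n) z)) \<longlonglongrightarrow> cmod (deriv \<gamma> z)"
      by (intro tendsto_intros pointwise_limit)+
    show "\<forall>\<^sub>F n in sequentially. cmod (deriv (g n) z) \<le> c * ((L + 1) * (1 + (cmod (g n z))\<^sup>2))"
      using deriv_bound [of "{z}" c, OF _ that] pointwise_limit(3)[of z]
      by (auto simp: mult.assoc elim: eventually_elim2)
  qed
  show ?thesis
  proof (rule field_le_mult_one_interval)
    fix t :: real assume t: "0 < t" "t < 1"
    then have "cmod (deriv \<gamma> z) \<le> 1 / t * ((L + 1) * (1 + (cmod (\<gamma> z))\<^sup>2))" by (intro *) simp
    then show "t * cmod (deriv \<gamma> z) \<le> (L + 1) * (1 + (cmod (\<gamma> z))\<^sup>2)"
      using t by (simp add: pos_le_divide_eq mult.commute)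
  qed
qed

lemma limit_deriv_0: "L + 1 \<le> cmod (deriv \<gamma> 0)"
proof (rule tendsto_lowerbound)
  show "(\<lambda>n. cmod (deriv (g n) 0)) \<longlonglongrightarrow> cmod (deriv \<gamma> 0)" by (intro tendsto_intros pointwise_limit)
  show "\<forall>\<^sub>F n in sequentially. L + 1 \<le> cmod (deriv (g n) 0)"
    using pointwise_limit(3)[of 0] by eventually_elim (rule at_0)
qed simp

text \<open>Near \<open>z0\<close> the \<open>g n\<close> are uniformly bounded, whereas
  \<open>deriv (g n) = b\<close> forces the value \<open>a / \<rho> n\<close>, which tends to
  infinity. So \<open>deriv (g n) - b\<close> is eventually zero-free, and Hurwitz applies.\<close>

lemma limit_deriv_omits: "deriv \<gamma> z0 \<noteq> b"
proof (rule local_limit [of z0])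
  fix r :: real
  assume r: "r > 0" and hol: "\<forall>\<^sub>F n in sequentially. g n holomorphic_on ball z0 r"
    and np: "\<forall>\<^sub>F n in sequentially. \<forall>w\<in>cball z0 r. \<not> is_pole (g n) w"
    and ul: "uniform_limit (cball z0 r) g \<gamma> sequentially"
    and ul': "uniform_limit (cball z0 r) (\<lambda>n. deriv (g n)) (deriv \<gamma>) sequentially"
  have hol\<gamma>': "deriv \<gamma> holomorphic_on UNIV" by (intro holomorphic_deriv entire) auto
  have "continuous_on (cball z0 r) \<gamma>" using entire by (meson continuous_on_subset holomorphic_on_imp_continuous_on subset_UNIV)
  then have "bounded (\<gamma> ` cball z0 r)" by (simp add: compact_continuous_image compact_imp_bounded)
  then obtain B where B: "\<And>w. w \<in> cball z0 r \<Longrightarrow> cmod (\<gamma> w) \<le> B" unfolding bounded_iff by (metis imageI)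
  have B0: "B \<ge> 0" using order_trans [OF norm_ge_zero B, of z0] r by simp
  have "cmod a / (B + 1) > 0" using B0 ab by simp
  then have "\<forall>\<^sub>F n in sequentially. \<rho> n < cmod a / (B + 1)" using \<rho>(2) by (rule order_tendstoD(2) [rotated])
  moreover have "\<forall>\<^sub>F n in sequentially. \<forall>w\<in>cball z0 r. dist (g n w) (\<gamma> w) < 1"
    by (rule uniform_limitD [OF ul]) simp
  ultimately have nz: "\<forall>\<^sub>F n in sequentially. \<forall>w\<in>ball z0 r. deriv (g n) w - b \<noteq> 0"
    using deriv_imp [OF compact_cball [of z0 r]] np
  proof eventually_elim
    case (elim n)
    show ?case
    proof (intro ballI notI)
      fix w assume "w \<in> ball z0 r" "deriv (g n) w - b = 0"
      then have w: "w \<in> cball z0 r" "deriv (g n) w = b" by auto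
      then have "g n w = a / \<rho> n" using elim by blast
      then have "cmod (g n w) = cmod a / \<rho> n" using \<rho>(1)[of n] by (simp add: norm_divide)
      moreover have "cmod (g n w) < B + 1"
      proof -
        have "cmod (g n w - \<gamma> w) < 1" using elim(2) w(1) by (simp only: dist_norm)
        then show ?thesis using B[OF w(1)] norm_triangle_sub[of "g n w" "\<gamma> w"] by linarith
      qed
      ultimately have "cmod a < (B + 1) * \<rho> n" using \<rho>(1)[of n] by (simp add: pos_divide_less_eq)
      moreover have "(B + 1) * \<rho> n < cmod a" using elim(1) B0 by (simp add: pos_less_divide_eq mult.commute)
      ultimately show False by simp
    qed
  qed
  show ?thesis
  proof (cases "(\<lambda>w. deriv \<gamma> w - b) constant_on ball z0 r")
    case False
    have "deriv \<gamma> z0 - b \<noteq> 0"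
    proof (rule Hurwitz_eventually_no_zeros [where S = "ball z0 r" and f = "\<lambda>n w. deriv (g n) w - b"
          and g = "\<lambda>w. deriv \<gamma> w - b"])
      show "\<forall>\<^sub>F n in sequentially. (\<lambda>w. deriv (g n) w - b) holomorphic_on ball z0 r"
        using hol by eventually_elim (intro holomorphic_intros holomorphic_deriv; auto)
      show "(\<lambda>w. deriv \<gamma> w - b) holomorphic_on ball z0 r"
        by (intro holomorphic_intros holomorphic_on_subset [OF hol\<gamma>']) auto
      show "uniform_limit K (\<lambda>n w. deriv (g n) w - b) (\<lambda>w. deriv \<gamma> w - b) sequentially" if "compact K" "K \<subseteq> ball z0 r" for K
      proof (intro uniform_limit_intros)
        show "uniform_limit K (\<lambda>n. deriv (g n)) (deriv \<gamma>) sequentially"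
          using ul' by (rule uniform_limit_on_subset) (use that in auto)
      qed
    qed (use False nz r in auto)
    then show ?thesis by simp
  next
    \<comment> \<open>Hurwitz says nothing about a constant limit. If the derivative were
      \<open>b\<close> near \<open>z0\<close>, it would be \<open>b\<close> everywhere by the
      identity theorem, against its size at least \<open>L + 1 > \<bar>b\<bar>\<close> at the
      origin.\<close>
    case True
    then obtain c where c: "\<And>w. w \<in> ball z0 r \<Longrightarrow> deriv \<gamma> w - b = c" by (auto simp: constant_on_def)
    show ?thesis
    proof
      assume "deriv \<gamma> z0 = b"
      then have "c = 0" using c[of z0] r by simp
      then have "deriv \<gamma> w - b = 0" if "w \<in> ball z0 r" for w using c that by simp
      then have "deriv \<gamma> 0 - b = 0"
      proof (intro analytic_continuation_open [of "ball z0 r" UNIV "\<lambda>w. deriv \<gamma> w - b" "\<lambda>_. 0" 0])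
        show "(\<lambda>w. deriv \<gamma> w - b) holomorphic_on UNIV" by (intro holomorphic_intros hol\<gamma>')
      qed (use r in \<open>auto simp: connected_UNIV\<close>)
      then show False using limit_deriv_0 L by simp
    qed
  qed
qed

theorem contradiction: False
proof -
  obtain c d where cd: "\<And>z. \<gamma> z = c * z + d"
    using entire_bounded_spherical_derivative_omitting [OF entire limit_deriv_bound ab(2) limit_deriv_omits] by blast
  have \<gamma>: "\<gamma> = (\<lambda>z. c * z + d)" using cd by auto
  have der: "deriv \<gamma> z = c" for z unfolding \<gamma> by (rule DERIV_imp_deriv) (auto intro!: derivative_eq_intros)
  have c: "L + 1 \<le> cmod c" using limit_deriv_0 der by simp
  then have "0 < cmod c" using L norm_ge_zero [of b] by linarith
  then have c0: "c \<noteq> 0" by simp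
  define z0 where "z0 = - d / c"
  have z0: "\<gamma> z0 = 0" using c0 by (simp add: cd z0_def)
  show False
  proof (rule local_limit [of z0])
    fix r :: real
    assume r: "r > 0" and hol: "\<forall>\<^sub>F n in sequentially. g n holomorphic_on ball z0 r"
      and np: "\<forall>\<^sub>F n in sequentially. \<forall>w\<in>cball z0 r. \<not> is_pole (g n) w"
      and ul: "uniform_limit (cball z0 r) g \<gamma> sequentially"
      and ul': "uniform_limit (cball z0 r) (\<lambda>n. deriv (g n)) (deriv \<gamma>) sequentially"
    have "\<forall>\<^sub>F n in sequentially. \<forall>w\<in>cball z0 r. dist (deriv (g n) w) (deriv \<gamma> w) < 1"
      by (rule uniform_limitD [OF ul']) simp
    \<comment> \<open>At a zero of \<open>g n\<close> the derivative is at most \<open>L\<close> in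
      modulus, yet it lies within distance less than 1 of the slope \<open>c\<close>, and
      \<open>\<bar>c\<bar> \<ge> L + 1\<close>. By Hurwitz the limit then has no zero at
      \<open>z0\<close> either.\<close>
    then have nz: "\<forall>\<^sub>F n in sequentially. \<forall>w\<in>ball z0 r. g n w \<noteq> 0"
      using zero_imp [OF compact_cball [of z0 r]] np
    proof eventually_elim
      case (elim n)
      show ?case
      proof (intro ballI notI)
        fix w assume "w \<in> ball z0 r" "g n w = 0"
        then have w: "w \<in> cball z0 r" "g n w = 0" by auto
        then have "cmod (deriv (g n) w) \<le> L" using elim by blast
        moreover have "cmod (c - deriv (g n) w) < 1"
          using elim(1) w by (auto simp: dist_norm der norm_minus_commute)
        ultimately show False using c norm_triangle_sub[of c "deriv (g n) w"] by linarith
      qed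
    qed
    have "\<gamma> z0 \<noteq> 0"
    proof (rule Hurwitz_eventually_no_zeros [where S = "ball z0 r" and f = g and g = \<gamma>])
      show "\<gamma> holomorphic_on ball z0 r" using entire by (rule holomorphic_on_subset) auto
      show "uniform_limit K g \<gamma> sequentially" if "compact K" "K \<subseteq> ball z0 r" for K
        using ul by (rule uniform_limit_on_subset) (use that in auto)
      show "\<not> \<gamma> constant_on ball z0 r"
      proof
        assume "\<gamma> constant_on ball z0 r"
        then obtain e where e: "\<And>w. w \<in> ball z0 r \<Longrightarrow> \<gamma> w = e" by (auto simp: constant_on_def)
        have "z0 + of_real (r / 2) \<in> ball z0 r" using r by (simp add: dist_norm)
        then have "\<gamma> (z0 + of_real (r / 2)) = \<gamma> z0" using e r by simp
        then show False using c0 r by (simp add: cd algebra_simps)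
      qed
    qed (use nz hol r in auto)
    then show False using z0 by simp
  qed
qed

end

section \<open>Rescaling and normality\<close>

text \<open>For \<open>c = 1\<close> this says that the spherical derivative of \<open>f\<close> at \<open>z\<close> is at most \<open>L + 1\<close>, except
  that the bound required at zeros is \<open>L\<close>.\<close>

definition spherical_bound :: "real \<Rightarrow> real \<Rightarrow> (complex \<Rightarrow> complex) \<Rightarrow> complex \<Rightarrow> bool" where
  "spherical_bound L c f z \<longleftrightarrow>
    (if sphere_value f z = Fin 0 then cmod (deriv f z) \<le> L
     else cmod (deriv (\<lambda>w. inverse (f w)) z) \<le> (L + 1) * (c + (cmod (inverse (f z)))\<^sup>2))"

lemma deriv_inverse_analytic:
  assumes "f analytic_on {z}" "f z \<noteq> 0"
  shows "deriv (\<lambda>w. inverse (f w)) z = - (deriv f z / (f z)\<^sup>2)"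
proof -
  have "(f has_field_derivative deriv f z) (at z)"
    using assms(1) by (simp add: DERIV_deriv_iff_field_differentiable analytic_on_imp_differentiable_at)
  then have "((\<lambda>w. inverse (f w)) has_field_derivative - (inverse (f z) * deriv f z * inverse (f z))) (at z)"
    using assms(2) by (rule DERIV_inverse')
  then show ?thesis by (simp add: DERIV_imp_deriv field_simps power2_eq_square)
qed

text \<open>Away from zeros, the bound for \<open>1 / f\<close> is multiplied by
  \<open>\<bar>f\<bar>\<^sup>2\<close>. Since \<open>c \<ge> 1\<close>, the factor \<open>c\<close>
  may be put on both summands, which gives the symmetric form
  \<open>1 + \<bar>f\<bar>\<^sup>2\<close>.\<close>

lemma spherical_bound_imp_deriv_le:
  assumes f: "f nicely_meromorphic_on A" "z \<in> A" "\<not> is_pole f z" and b: "spherical_bound L c f z" and Lc: "L \<ge> 0" "c \<ge> 1"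
  shows "cmod (deriv f z) \<le> c * (L + 1) * (1 + (cmod (f z))\<^sup>2)"
proof (cases "f z = 0")
  case True
  then have "cmod (deriv f z) \<le> L" using b f(3) by (simp add: spherical_bound_def sphere_value_def)
  also have "\<dots> \<le> c * (L + 1)"
  proof -
    have "1 * (L + 1) \<le> c * (L + 1)" using Lc by (intro mult_right_mono) auto
    then show ?thesis by simp
  qed
  finally show ?thesis using True by simp
next
  case False
  have an: "f analytic_on {z}" using f nicely_meromorphic_on_imp_analytic_at by blast
  have "cmod (deriv f z) / (cmod (f z))\<^sup>2 \<le> (L + 1) * (c + (cmod (inverse (f z)))\<^sup>2)"
    using b False f(3) deriv_inverse_analytic [OF an False]
    by (simp add: spherical_bound_def sphere_value_def norm_divide norm_power)
  also have "\<dots> \<le> (L + 1) * (c + c * (cmod (inverse (f z)))\<^sup>2)"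
    using Lc by (intro mult_left_mono add_left_mono) (auto simp: mult_le_cancel_right1)
  finally have *: "cmod (deriv f z) / (cmod (f z))\<^sup>2 \<le> (L + 1) * (c + c * (cmod (inverse (f z)))\<^sup>2)" .
  have "0 < (cmod (f z))\<^sup>2" using False by simp
  with * have "cmod (deriv f z) \<le> (L + 1) * (c + c * (cmod (inverse (f z)))\<^sup>2) * (cmod (f z))\<^sup>2"
    by (simp only: pos_divide_le_eq)
  also have "\<dots> = c * (L + 1) * ((cmod (f z))\<^sup>2 + (cmod (inverse (f z)))\<^sup>2 * (cmod (f z))\<^sup>2)"
    by (simp only: distrib_left distrib_right mult_ac)
  also have "(cmod (inverse (f z)))\<^sup>2 * (cmod (f z))\<^sup>2 = 1"
    by (simp only: power_mult_distrib [symmetric] norm_mult [symmetric] left_inverse [OF False] norm_one power_one)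
  also have "c * (L + 1) * ((cmod (f z))\<^sup>2 + 1) = c * (L + 1) * (1 + (cmod (f z))\<^sup>2)" by (simp only: add.commute)
  finally show ?thesis .
qed

lemma spherical_bound_imp_dilatation_le:
  assumes f: "f nicely_meromorphic_on A" "z \<in> A" and b: "spherical_bound L c f z" and Lc: "L \<ge> 0" "c \<ge> 1"
  shows "dilatation_le (sphere_value f) z (c * (L + 1))"
proof (cases "sphere_value f z = Fin 0")
  case True
  then have np: "\<not> is_pole f z" "f z = 0" by (auto simp: sphere_value_eq_Fin_iff)
  then have an: "f analytic_on {z}" using f nicely_meromorphic_on_imp_analytic_at by blast
  then have "(f has_field_derivative deriv f z) (at z)"
    by (simp add: DERIV_deriv_iff_field_differentiable analytic_on_imp_differentiable_at)
  then have "dilatation_le (\<lambda>w. Fin (f w)) z (cmod (deriv f z) / (1 + (cmod (f z))\<^sup>2))" by (rule dilatation_le_Fin)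
  then have "dilatation_le (sphere_value f) z (cmod (deriv f z) / (1 + (cmod (f z))\<^sup>2))"
    using dilatation_le_cong [OF eventually_sphere_value_eq_Fin [OF an]] by blast
  moreover have "cmod (deriv f z) / (1 + (cmod (f z))\<^sup>2) \<le> c * (L + 1)"
    using spherical_bound_imp_deriv_le [OF f np(1) b Lc] by (simp only: pos_divide_le_eq one_plus_cmod_pos)
  ultimately show ?thesis by (rule dilatation_le_mono)
next
  case False
  define h where "h = (\<lambda>w. inverse (f w))"
  have "h analytic_on {z}" unfolding h_def using f False by (rule analytic_at_inverse_nicely_meromorphic)
  then have "(h has_field_derivative deriv h z) (at z)"
    by (simp add: DERIV_deriv_iff_field_differentiable analytic_on_imp_differentiable_at)
  then have "dilatation_le (\<lambda>w. Fin (h w)) z (cmod (deriv h z) / (1 + (cmod (h z))\<^sup>2))" by (rule dilatation_le_Fin)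
  then have "dilatation_le (\<lambda>w. sphere_inverse (Fin (h w))) z (cmod (deriv h z) / (1 + (cmod (h z))\<^sup>2))"
    by (simp only: dilatation_le_sphere_inverse)
  then have "dilatation_le (sphere_value f) z (cmod (deriv h z) / (1 + (cmod (h z))\<^sup>2))"
    using dilatation_le_cong [OF eventually_sphere_value_eq_inverse [OF f False]] unfolding h_def by blast
  moreover have "cmod (deriv h z) \<le> c * (L + 1) * (1 + (cmod (h z))\<^sup>2)"
  proof -
    have "cmod (deriv h z) \<le> (L + 1) * (c + (cmod (h z))\<^sup>2)"
      using b False unfolding spherical_bound_def h_def by simp
    also have "\<dots> \<le> (L + 1) * (c + c * (cmod (h z))\<^sup>2)"
      using Lc by (intro mult_left_mono add_left_mono) (auto simp: mult_le_cancel_right1)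
    finally show ?thesis by (simp add: algebra_simps)
  qed
  then have "cmod (deriv h z) / (1 + (cmod (h z))\<^sup>2) \<le> c * (L + 1)"
    by (simp only: pos_divide_le_eq one_plus_cmod_pos)
  ultimately show ?thesis by (rule dilatation_le_mono)
qed

text \<open>Where it is positive, \<open>concentration L f z\<close> is the number \<open>m\<close> for which rescaling \<open>f\<close> at \<open>z\<close> by the factor
  \<open>\<rho> = 1 / sqrt m\<close> in domain and range gives spherical derivative exactly \<open>L + 1\<close>.\<close>

definition concentration :: "real \<Rightarrow> (complex \<Rightarrow> complex) \<Rightarrow> complex \<Rightarrow> real" where
  "concentration L f z =
    (if sphere_value f z = Fin 0 then 0
     else max 0 (cmod (deriv (\<lambda>w. inverse (f w)) z) / (L + 1) - (cmod (inverse (f z)))\<^sup>2))"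

lemma concentration_nonneg: "concentration L f z \<ge> 0"
  by (simp add: concentration_def)

lemma concentration_le_imp_spherical_bound:
  assumes "L \<ge> 0" "concentration L f z \<le> c" "sphere_value f z = Fin 0 \<Longrightarrow> cmod (deriv f z) \<le> L"
  shows "spherical_bound L c f z"
  using assms by (auto simp: spherical_bound_def concentration_def pos_divide_le_eq algebra_simps)

text \<open>In terms of \<open>f\<close> the expression is
  \<open>(\<bar>f'\<bar> / (L + 1) - 1) / \<bar>f\<bar>\<^sup>2\<close>, singular at zeros. There
  \<open>\<bar>f'\<bar> \<le> L < L + 1\<close>, so nearby the numerator is negative and the maximum
  with 0 vanishes.\<close>

lemma concentration_continuous:
  assumes f: "f nicely_meromorphic_on D" and z: "z \<in> D" and L: "L \<ge> 0"
    and zero: "sphere_value f z = Fin 0 \<Longrightarrow> cmod (deriv f z) \<le> L"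
  shows "isCont (concentration L f) z"
proof (cases "sphere_value f z = Fin 0")
  case False
  define h where "h = (\<lambda>w. inverse (f w))"
  have an: "h analytic_on {z}" unfolding h_def using f z False by (rule analytic_at_inverse_nicely_meromorphic)
  have "isCont h z" "isCont (deriv h) z"
    using an analytic_deriv [OF an] by (auto intro: analytic_at_imp_isCont)
  then have "isCont (\<lambda>w. max 0 (cmod (deriv h w) / (L + 1) - (cmod (h w))\<^sup>2)) z"
    using L by (intro continuous_intros) auto
  moreover have "\<forall>\<^sub>F w in nhds z. concentration L f w = max 0 (cmod (deriv h w) / (L + 1) - (cmod (h w))\<^sup>2)"
    using eventually_sphere_value_eq_inverse [OF f z False]
  proof eventually_elim
    case (elim w)
    then have "sphere_value f w \<noteq> Fin 0" by (simp split: if_splits)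
    then show ?case by (simp add: concentration_def h_def)
  qed
  ultimately show ?thesis by (rule isCont_cong [THEN iffD2, rotated])
next
  case True
  then have an: "f analytic_on {z}"
    using f z nicely_meromorphic_on_imp_analytic_at by (simp add: sphere_value_eq_Fin_iff)
  then obtain S where S: "open S" "z \<in> S" "f holomorphic_on S"
    by (metis analytic_at)
  have "isCont (\<lambda>w. cmod (deriv f w)) z"
    using analytic_deriv [OF an] by (intro continuous_intros analytic_at_imp_isCont)
  then have "\<forall>\<^sub>F w in at z. cmod (deriv f w) < L + 1"
    unfolding isCont_def by (rule order_tendstoD) (use zero [OF True] in simp)
  then have "\<forall>\<^sub>F w in nhds z. cmod (deriv f w) < L + 1"
    using zero [OF True] by (simp add: eventually_nhds_conv_at)
  moreover have "\<forall>\<^sub>F w in nhds z. w \<in> S" using S by (simp add: eventually_nhds_in_open)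
  moreover have "\<forall>\<^sub>F w in nhds z. sphere_value f w = Fin (f w)" by (rule eventually_sphere_value_eq_Fin [OF an])
  ultimately have "\<forall>\<^sub>F w in nhds z. concentration L f w = 0"
  proof eventually_elim
    case (elim w)
    show ?case
    proof (cases "f w = 0")
      case False
      have "f analytic_on {w}" using S elim by (meson analytic_at)
      then have "deriv (\<lambda>w. inverse (f w)) w = - (deriv f w / (f w)\<^sup>2)" using False by (rule deriv_inverse_analytic)
      then have "cmod (deriv (\<lambda>w. inverse (f w)) w) / (L + 1) - (cmod (inverse (f w)))\<^sup>2
          = (cmod (deriv f w) / (L + 1) - 1) / (cmod (f w))\<^sup>2"
        using False by (simp add: norm_divide norm_power norm_inverse power_one_over diff_divide_distrib inverse_eq_divide mult.commute)
      also have "\<dots> \<le> 0" using elim L by (intro divide_nonpos_nonneg) auto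
      finally show ?thesis by (simp add: concentration_def)
    qed (use elim in \<open>simp add: concentration_def\<close>)
  qed
  then show ?thesis using isCont_cong [of "concentration L f" "\<lambda>_. 0" z] by simp
qed

section \<open>Choice of centre and scale\<close>

text \<open>At a maximum of \<open>\<mu>\<close> weighted by the squared distance to the boundary,
  \<open>\<mu>\<close> can grow only as fast as that distance shrinks. With \<rho> as unit of
  length, \<open>z1\<close> is at distance \<open>S\<close> from the boundary, and moving by
  \<open>R\<close> reduces the distance at most by the factor \<open>1 - R / S\<close>.\<close>

lemma doubling:
  fixes \<mu> :: "complex \<Rightarrow> real"
  assumes cont: "continuous_on (cball z0 r) \<mu>" and "\<And>z. \<mu> z \<ge> 0" and "r > 0"
    and zs: "zs \<in> cball z0 (r / 2)" "\<mu> zs > 0"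
  obtains z1 \<rho> S where "\<rho> > 0" "z1 \<in> ball z0 r" "\<rho>\<^sup>2 * \<mu> z1 = 1" "r / 2 * sqrt (\<mu> zs) \<le> S" "0 < S" "\<rho> * S \<le> r"
    "\<And>R \<zeta>. R < S \<Longrightarrow> cmod \<zeta> \<le> R \<Longrightarrow> z1 + \<rho> * \<zeta> \<in> ball z0 r \<and> \<rho>\<^sup>2 * \<mu> (z1 + \<rho> * \<zeta>) \<le> 1 / (1 - R / S)\<^sup>2"
proof -
  \<comment> \<open>The exponent 2 matches the scale \<open>1 / sqrt \<mu>\<close>: \<phi> is the
    square of the distance to the boundary measured in that scale.\<close>
  define \<phi> where "\<phi> = (\<lambda>z. (r - dist z0 z)\<^sup>2 * \<mu> z)"
  have "continuous_on (cball z0 r) \<phi>" unfolding \<phi>_def by (intro continuous_intros cont)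
  then obtain z1 where z1: "z1 \<in> cball z0 r" and max: "\<And>z. z \<in> cball z0 r \<Longrightarrow> \<phi> z \<le> \<phi> z1"
    using continuous_attains_sup [of "cball z0 r" \<phi>] \<open>r > 0\<close> by auto
  define S where "S = sqrt (\<phi> z1)"
  define d where "d = r - dist z0 z1"
  have "(r / 2)\<^sup>2 * \<mu> zs \<le> \<phi> zs"
    unfolding \<phi>_def using zs \<open>r > 0\<close> by (intro mult_right_mono power_mono) auto
  also have "\<dots> \<le> \<phi> z1" using zs \<open>r > 0\<close> by (intro max) auto
  finally have low: "(r / 2)\<^sup>2 * \<mu> zs \<le> \<phi> z1" .
  have "0 < (r / 2)\<^sup>2 * \<mu> zs" using zs \<open>r > 0\<close> by simp
  then have \<phi>pos: "\<phi> z1 > 0" using low by linarith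
  then have S: "S > 0" "S\<^sup>2 = \<phi> z1" by (auto simp: S_def)
  have d: "d > 0" using \<phi>pos z1 by (cases "d = 0") (auto simp: \<phi>_def d_def)
  have \<mu>1: "\<mu> z1 = (S / d)\<^sup>2" using S d by (simp add: \<phi>_def d_def power_divide)
  define \<rho> where "\<rho> = d / S"
  have \<rho>: "\<rho> > 0" using d S by (simp add: \<rho>_def)
  show ?thesis
  proof
    show "\<rho> > 0" by (rule \<rho>)
    show "z1 \<in> ball z0 r" using d by (simp add: d_def)
    show "\<rho>\<^sup>2 * \<mu> z1 = 1" using d S(1) by (simp add: \<mu>1 \<rho>_def power_divide)
    show "r / 2 * sqrt (\<mu> zs) \<le> S"
      using real_sqrt_le_mono [OF low] \<open>r > 0\<close> by (simp add: real_sqrt_mult S_def)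
    show "0 < S" by (rule S)
    show "\<rho> * S \<le> r" using S by (simp add: \<rho>_def d_def)
    fix R :: real and \<zeta> :: complex
    assume R: "R < S" "cmod \<zeta> \<le> R"
    define w where "w = z1 + \<rho> * \<zeta>"
    have R0: "R \<ge> 0" using R(2) norm_ge_zero order_trans by blast
    define t where "t = 1 - R / S"
    have t: "t > 0" using R S by (simp add: t_def)
    have "dist z1 w \<le> \<rho> * R" using R \<rho> by (simp add: w_def dist_norm norm_mult)
    then have "dist z0 w \<le> dist z0 z1 + \<rho> * R" using dist_triangle[of z0 w z1] by linarith
    moreover have "\<rho> * R = d * (1 - t)" by (simp add: \<rho>_def t_def)
    ultimately have dt: "d * t \<le> r - dist z0 w" by (simp add: d_def algebra_simps)
    have "0 < d * t" using d t by simp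
    then have wb: "w \<in> ball z0 r" using dt by simp
    have "(d * t)\<^sup>2 * \<mu> w \<le> (r - dist z0 w)\<^sup>2 * \<mu> w"
      using dt d t assms(2) by (intro mult_right_mono power_mono) auto
    also have "\<dots> \<le> S\<^sup>2" using max[of w] wb S by (simp add: \<phi>_def)
    finally have "(d * t)\<^sup>2 * \<mu> w \<le> S\<^sup>2" .
    then have "\<rho>\<^sup>2 * \<mu> w \<le> 1 / t\<^sup>2"
      using S(1) t by (simp add: \<rho>_def power_divide power_mult_distrib field_simps)
    then show "z1 + \<rho> * \<zeta> \<in> ball z0 r \<and> \<rho>\<^sup>2 * \<mu> (z1 + \<rho> * \<zeta>) \<le> 1 / (1 - R / S)\<^sup>2"
      using wb by (simp add: w_def t_def)
  qed
qed

section \<open>Affine rescaling of one function\<close>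

locale rescaling =
  fixes f :: "complex \<Rightarrow> complex" and D :: "complex set" and z1 :: complex and \<rho> :: real
  assumes open_D: "open D" and nice: "f nicely_meromorphic_on D" and \<rho>: "\<rho> > 0"
begin

definition aff :: "complex \<Rightarrow> complex" where "aff \<zeta> = z1 + complex_of_real \<rho> * \<zeta>"
definition resc :: "complex \<Rightarrow> complex" where "resc \<zeta> = f (z1 + complex_of_real \<rho> * \<zeta>) / complex_of_real \<rho>"

lemma resc_eq: "resc \<zeta> = f (aff \<zeta>) / \<rho>" by (simp add: resc_def aff_def)

lemma aff_analytic: "aff analytic_on A"
  unfolding aff_def by (intro analytic_intros)

lemma aff_deriv: "(aff has_field_derivative of_real \<rho>) (at \<zeta>)"
  unfolding aff_def by (auto intro!: derivative_eq_intros)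

lemma aff_eq_iff: "aff x = aff y \<longleftrightarrow> x = y" using \<rho> by (simp add: aff_def)

lemma resc_analytic:
  assumes "f analytic_on {aff \<zeta>}"
  shows "resc analytic_on {\<zeta>}"
proof -
  have "(f \<circ> aff) analytic_on {\<zeta>}"
    using aff_analytic assms by (intro analytic_on_compose) auto
  then have "(\<lambda>x. f (aff x)) analytic_on {\<zeta>}" by (simp only: o_def)
  then have "(\<lambda>x. f (aff x) / \<rho>) analytic_on {\<zeta>}"
    by (rule analytic_on_divide) (use \<rho> in auto)
  then show ?thesis by (simp add: resc_eq[abs_def])
qed

lemma resc_pole:
  assumes "is_pole f (aff \<zeta>)"
  shows "is_pole resc \<zeta>"
proof -
  have "isCont aff \<zeta>" using aff_deriv DERIV_isCont by blast
  then have "filterlim aff (at (aff \<zeta>)) (at \<zeta>)"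
    by (auto simp: filterlim_at isCont_def eventually_at_filter aff_eq_iff)
  then have "filterlim (\<lambda>x. f (aff x)) at_infinity (at \<zeta>)"
    using assms unfolding is_pole_def by (rule filterlim_compose [rotated])
  then have "is_pole (\<lambda>x. f (aff x)) \<zeta>" by (simp add: is_pole_def)
  then have "is_pole (\<lambda>x. inverse (of_real \<rho>) * f (aff x)) \<zeta>" using \<rho> by simp
  then show ?thesis by (simp add: resc_eq[abs_def] divide_inverse mult.commute)
qed

lemma is_pole_resc_iff:
  assumes "aff \<zeta> \<in> D"
  shows "is_pole resc \<zeta> \<longleftrightarrow> is_pole f (aff \<zeta>)"
  using resc_pole resc_analytic nicely_meromorphic_on_imp_analytic_at [OF nice assms] analytic_at_imp_no_pole by blast

lemma resc_nice: "resc nicely_meromorphic_on aff -` D"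
proof (rule nicely_meromorphic_onI_open [where pts = "{\<zeta>. aff \<zeta> \<in> D \<and> is_pole f (aff \<zeta>)}"])
  have "continuous_on UNIV aff" by (intro holomorphic_on_imp_continuous_on analytic_imp_holomorphic aff_analytic)
  then show "open (aff -` D)" using open_D by (simp add: open_vimage)
  show "resc analytic_on aff -` D - {\<zeta>. aff \<zeta> \<in> D \<and> is_pole f (aff \<zeta>)}"
    using nicely_meromorphic_on_imp_analytic_at [OF nice]
    by (subst analytic_on_analytic_at) (auto intro!: resc_analytic)
  show "is_pole resc x \<and> resc x = 0" if "x \<in> {\<zeta>. aff \<zeta> \<in> D \<and> is_pole f (aff \<zeta>)}" for x
    using that resc_pole nicely_meromorphic_on_pole_eq_0 [OF nice] by (auto simp: resc_eq)
  fix x assume "x \<in> aff -` D"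
  then have "isolated_singularity_at f (aff x)"
    using nice unfolding nicely_meromorphic_on_def
    by (meson meromorphic_on_isolated_singularity meromorphic_on_subset empty_subsetI insert_subset vimageD)
  then obtain r where r: "r > 0" "f analytic_on ball (aff x) r - {aff x}"
    by (auto simp: isolated_singularity_at_def)
  have "resc analytic_on {y}" if "y \<in> ball x (r / \<rho>) - {x}" for y
  proof (rule resc_analytic)
    have "aff x - aff y = \<rho> * (x - y)" by (simp add: aff_def algebra_simps)
    then have "dist (aff x) (aff y) = \<rho> * dist x y" using \<rho> by (simp add: dist_norm norm_mult)
    also have "\<dots> < r" using that \<rho> by (simp add: field_simps)
    finally have "aff y \<in> ball (aff x) r - {aff x}" using that by (simp add: aff_eq_iff)
    then show "f analytic_on {aff y}" by (intro analytic_on_subset [OF r(2)]) simp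
  qed
  then have "resc analytic_on ball x (r / \<rho>) - {x}" by (subst analytic_on_analytic_at) blast
  then show "isolated_singularity_at resc x"
    using r(1) \<rho> unfolding isolated_singularity_at_def by (intro exI [of _ "r / \<rho>"]) simp
qed

lemma sphere_value_resc_eq_0_iff:
  assumes "aff \<zeta> \<in> D"
  shows "sphere_value resc \<zeta> = Fin 0 \<longleftrightarrow> sphere_value f (aff \<zeta>) = Fin 0"
  using \<rho> by (auto simp: sphere_value_eq_Fin_iff is_pole_resc_iff [OF assms] resc_eq)

lemma deriv_resc:
  assumes "f analytic_on {aff \<zeta>}"
  shows "deriv resc \<zeta> = deriv f (aff \<zeta>)"
proof -
  have "(f has_field_derivative deriv f (aff \<zeta>)) (at (aff \<zeta>))"
    using assms by (simp add: DERIV_deriv_iff_field_differentiable analytic_on_imp_differentiable_at)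
  then have "((\<lambda>x. f (aff x)) has_field_derivative deriv f (aff \<zeta>) * of_real \<rho>) (at \<zeta>)"
    using aff_deriv by (rule DERIV_chain2)
  then have "((\<lambda>x. f (aff x) / \<rho>) has_field_derivative deriv f (aff \<zeta>) * of_real \<rho> / of_real \<rho>) (at \<zeta>)"
    by (rule DERIV_cdivide)
  then show ?thesis using \<rho> by (simp add: DERIV_imp_deriv resc_eq[abs_def])
qed

text \<open>One factor \<rho> comes from the chain rule and the other from the rescaling of the
  range.\<close>

lemma deriv_inverse_resc:
  assumes "aff \<zeta> \<in> D" "sphere_value f (aff \<zeta>) \<noteq> Fin 0"
  shows "deriv (\<lambda>x. inverse (resc x)) \<zeta> = \<rho>\<^sup>2 * deriv (\<lambda>x. inverse (f x)) (aff \<zeta>)"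
proof -
  define h where "h = (\<lambda>x. inverse (f x))"
  have "h analytic_on {aff \<zeta>}" unfolding h_def using nice assms by (rule analytic_at_inverse_nicely_meromorphic)
  then have "(h has_field_derivative deriv h (aff \<zeta>)) (at (aff \<zeta>))"
    by (simp add: DERIV_deriv_iff_field_differentiable analytic_on_imp_differentiable_at)
  then have "((\<lambda>x. h (aff x)) has_field_derivative deriv h (aff \<zeta>) * of_real \<rho>) (at \<zeta>)"
    using aff_deriv by (rule DERIV_chain2)
  then have "((\<lambda>x. of_real \<rho> * h (aff x)) has_field_derivative of_real \<rho> * (deriv h (aff \<zeta>) * of_real \<rho>)) (at \<zeta>)"
    by (rule DERIV_cmult)
  moreover have "(\<lambda>x. of_real \<rho> * h (aff x)) = (\<lambda>x. inverse (resc x))"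
    by (simp add: h_def resc_eq fun_eq_iff divide_inverse)
  ultimately show ?thesis by (simp add: DERIV_imp_deriv h_def power2_eq_square mult_ac)
qed

lemma norm_inverse_resc: "cmod (inverse (resc \<zeta>)) = \<rho> * cmod (inverse (f (aff \<zeta>)))"
  using \<rho> by (simp add: resc_eq norm_mult norm_divide norm_inverse divide_inverse)

text \<open>Multiplication by \<open>\<rho>\<^sup>2\<close> turns the bound for \<open>1 / f\<close>
  into that for its rescaling: the term \<open>\<bar>1 / f\<bar>\<^sup>2\<close> becomes
  \<open>\<bar>1 / resc\<bar>\<^sup>2\<close>, and the concentration is multiplied by
  \<open>\<rho>\<^sup>2\<close>.\<close>

lemma spherical_bound_resc:
  assumes D: "aff \<zeta> \<in> D" and L: "L \<ge> 0" and c: "\<rho>\<^sup>2 * concentration L f (aff \<zeta>) \<le> c"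
    and zero: "sphere_value f (aff \<zeta>) = Fin 0 \<Longrightarrow> cmod (deriv f (aff \<zeta>)) \<le> L"
  shows "spherical_bound L c resc \<zeta>"
proof (cases "sphere_value f (aff \<zeta>) = Fin 0")
  case True
  then have "f analytic_on {aff \<zeta>}"
    using nicely_meromorphic_on_imp_analytic_at [OF nice D] by (simp add: sphere_value_eq_Fin_iff)
  then show ?thesis using True zero by (simp add: spherical_bound_def sphere_value_resc_eq_0_iff [OF D] deriv_resc)
next
  case False
  have "spherical_bound L (concentration L f (aff \<zeta>)) f (aff \<zeta>)"
    using L zero by (intro concentration_le_imp_spherical_bound) auto
  then have "cmod (deriv (\<lambda>x. inverse (f x)) (aff \<zeta>)) \<le> (L + 1) * (concentration L f (aff \<zeta>) + (cmod (inverse (f (aff \<zeta>))))\<^sup>2)"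
    using False by (simp add: spherical_bound_def)
  then have "\<rho>\<^sup>2 * cmod (deriv (\<lambda>x. inverse (f x)) (aff \<zeta>)) \<le> \<rho>\<^sup>2 * ((L + 1) * (concentration L f (aff \<zeta>) + (cmod (inverse (f (aff \<zeta>))))\<^sup>2))"
    by (intro mult_left_mono) auto
  also have "\<dots> = (L + 1) * (\<rho>\<^sup>2 * concentration L f (aff \<zeta>) + (cmod (inverse (resc \<zeta>)))\<^sup>2)"
    unfolding norm_inverse_resc by (simp only: power_mult_distrib distrib_left mult.left_commute)
  also have "\<dots> \<le> (L + 1) * (c + (cmod (inverse (resc \<zeta>)))\<^sup>2)"
    using c L by (intro mult_left_mono add_right_mono) auto
  finally show ?thesis
    using False \<rho> by (simp add: spherical_bound_def sphere_value_resc_eq_0_iff [OF D] deriv_inverse_resc [OF D False] norm_mult norm_power)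
qed

lemma at_centre:
  assumes D: "z1 \<in> D" and L: "L \<ge> 0" and one: "\<rho>\<^sup>2 * concentration L f z1 = 1"
  shows "L + 1 \<le> cmod (deriv (\<lambda>x. inverse (resc x)) 0)"
    and "\<not> is_pole resc 0 \<Longrightarrow> L + 1 \<le> cmod (deriv resc 0)"
proof -
  have a0: "aff 0 = z1" by (simp add: aff_def)
  have ne: "sphere_value f z1 \<noteq> Fin 0" using one by (auto simp: concentration_def)
  define k where "k = cmod (inverse (resc 0))"
  define q i where "q = cmod (deriv (\<lambda>w. inverse (f w)) z1)" and "i = (cmod (inverse (f z1)))\<^sup>2"
  have "concentration L f z1 = q / (L + 1) - i"
  proof -
    have "concentration L f z1 \<noteq> 0" using one by auto
    then show ?thesis using ne by (auto simp: concentration_def max_def q_def i_def split: if_splits)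
  qed
  then have "q = (L + 1) * (concentration L f z1 + i)"
    using L by (simp add: nonzero_divide_eq_eq)
  then have "\<rho>\<^sup>2 * q = (L + 1) * (\<rho>\<^sup>2 * concentration L f z1 + \<rho>\<^sup>2 * i)"
    by (simp add: algebra_simps)
  also have "\<dots> = (L + 1) * (1 + k\<^sup>2)"
    by (simp only: one k_def i_def norm_inverse_resc a0 power_mult_distrib)
  finally have eq: "cmod (deriv (\<lambda>x. inverse (resc x)) 0) = (L + 1) * (1 + k\<^sup>2)"
    using deriv_inverse_resc [of 0] D ne \<rho> by (simp add: a0 norm_mult norm_power q_def)
  then show "L + 1 \<le> cmod (deriv (\<lambda>x. inverse (resc x)) 0)"
    using L by (simp add: mult_le_cancel_left1)
  assume np: "\<not> is_pole resc 0"
  then have an: "f analytic_on {aff 0}"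
    using nicely_meromorphic_on_imp_analytic_at [OF nice D] is_pole_resc_iff [of 0] D by (simp add: a0)
  have "f z1 \<noteq> 0" using np ne is_pole_resc_iff [of 0] D by (auto simp: a0 sphere_value_def)
  then have nz: "resc 0 \<noteq> 0" using \<rho> by (simp add: resc_eq a0)
  then have kpos: "k > 0" by (simp add: k_def)
  \<comment> \<open>The reciprocal has derivative of modulus
    \<open>\<bar>resc'\<bar> * k\<^sup>2\<close>. The exact normalisation thus amounts to
    \<open>\<bar>resc'\<bar> = (L + 1) * (1 + 1 / k\<^sup>2)\<close>, which exceeds
    \<open>L + 1\<close>.\<close>
  have "cmod (deriv resc 0) * k\<^sup>2 = (L + 1) * (1 + k\<^sup>2)"
    using eq unfolding deriv_inverse_analytic [OF resc_analytic [OF an] nz]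
    by (simp add: k_def norm_mult norm_inverse norm_power power_inverse divide_inverse)
  moreover have "(L + 1) * k\<^sup>2 \<le> (L + 1) * (1 + k\<^sup>2)" using L by (intro mult_left_mono) auto
  ultimately have "(L + 1) * k\<^sup>2 \<le> cmod (deriv resc 0) * k\<^sup>2" by simp
  then show "L + 1 \<le> cmod (deriv resc 0)" using kpos by simp
qed

end

section \<open>Normality of the family\<close>

locale shared_value_family =
  fixes D :: "complex set" and \<F> :: "(complex \<Rightarrow> complex) set" and a b :: complex and L :: real
  assumes open_D: "open D"
    and nice: "\<And>f. f \<in> \<F> \<Longrightarrow> f nicely_meromorphic_on D"
    and ab: "a \<noteq> 0" "b \<noteq> 0" and L: "cmod b \<le> L"
    and shared: "\<And>f z. f \<in> \<F> \<Longrightarrow> z \<in> D \<Longrightarrow> \<not> is_pole f z \<Longrightarrow> f z = a \<longleftrightarrow> deriv f z = b"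
    and zero: "\<And>f z. f \<in> \<F> \<Longrightarrow> z \<in> D \<Longrightarrow> sphere_value f z = Fin 0 \<Longrightarrow> cmod (deriv f z) \<le> L"
begin

lemma L_nonneg: "L \<ge> 0" using L norm_ge_zero order_trans by blast

text \<open>Unboundedness near \<open>z0\<close> provides, through \<open>doubling\<close>, centres
  and scales whose rescaled functions have a spherical limit by Marty's criterion. Such a limit is
  an instance of the contradictory locale \<open>rescaled_limit\<close>.\<close>

lemma concentration_locally_bounded:
  assumes z0: "z0 \<in> D"
  shows "\<exists>r>0. \<exists>B. \<forall>f\<in>\<F>. \<forall>z\<in>cball z0 r. concentration L f z \<le> B"
proof (rule ccontr)
  assume unbounded: "\<not> ?thesis"
  obtain r where r: "r > 0" "cball z0 r \<subseteq> D" using open_D z0 open_contains_cball by blast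
  have "\<exists>f\<in>\<F>. \<exists>z\<in>cball z0 (r / 2). concentration L f z > real n + 1" for n
  proof -
    have "r / 2 > 0" using r by simp
    then show ?thesis using unbounded by (meson not_le)
  qed
  then obtain f zs where f: "\<And>n. f n \<in> \<F>" and zs: "\<And>n. zs n \<in> cball z0 (r / 2)"
    and big: "\<And>n. concentration L (f n) (zs n) > real n + 1" by metis
  have "\<exists>z1 \<rho> S. \<rho> > 0 \<and> z1 \<in> ball z0 r \<and> \<rho>\<^sup>2 * concentration L (f n) z1 = 1 \<and>
      r / 2 * sqrt (concentration L (f n) (zs n)) \<le> S \<and> 0 < S \<and> \<rho> * S \<le> r \<and>
      (\<forall>R \<zeta>. R < S \<longrightarrow> cmod \<zeta> \<le> R \<longrightarrow> z1 + of_real \<rho> * \<zeta> \<in> ball z0 r \<and>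
        \<rho>\<^sup>2 * concentration L (f n) (z1 + of_real \<rho> * \<zeta>) \<le> 1 / (1 - R / S)\<^sup>2)" for n
  proof -
    have "continuous_on (cball z0 r) (concentration L (f n))"
    proof (intro continuous_at_imp_continuous_on ballI)
      fix z assume "z \<in> cball z0 r"
      then have "z \<in> D" using r by blast
      then show "isCont (concentration L (f n)) z"
        using concentration_continuous [OF nice [OF f] _ L_nonneg zero [OF f]] by blast
    qed
    moreover have "concentration L (f n) (zs n) > 0" using big[of n] by linarith
    ultimately obtain z1 \<rho> S where "\<rho> > 0" "z1 \<in> ball z0 r" "\<rho>\<^sup>2 * concentration L (f n) z1 = 1"
      "r / 2 * sqrt (concentration L (f n) (zs n)) \<le> S" "0 < S" "\<rho> * S \<le> r"
      "\<And>R \<zeta>. R < S \<Longrightarrow> cmod \<zeta> \<le> R \<Longrightarrow> z1 + of_real \<rho> * \<zeta> \<in> ball z0 r \<and>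
        \<rho>\<^sup>2 * concentration L (f n) (z1 + of_real \<rho> * \<zeta>) \<le> 1 / (1 - R / S)\<^sup>2"
      using doubling [of z0 r "concentration L (f n)" "zs n"] concentration_nonneg r(1) zs[of n] by metis
    then show ?thesis by blast
  qed
  then obtain z1 \<rho> S where \<rho>: "\<And>n. \<rho> n > 0" and z1: "\<And>n. z1 n \<in> ball z0 r"
    and one: "\<And>n. (\<rho> n)\<^sup>2 * concentration L (f n) (z1 n) = 1"
    and Slow: "\<And>n. r / 2 * sqrt (concentration L (f n) (zs n)) \<le> S n" and Spos: "\<And>n. 0 < S n"
    and \<rho>S: "\<And>n. \<rho> n * S n \<le> r"
    and dbl: "\<And>n R \<zeta>. R < S n \<Longrightarrow> cmod \<zeta> \<le> R \<Longrightarrow> z1 n + of_real (\<rho> n) * \<zeta> \<in> ball z0 r \<and>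
        (\<rho> n)\<^sup>2 * concentration L (f n) (z1 n + of_real (\<rho> n) * \<zeta>) \<le> 1 / (1 - R / S n)\<^sup>2"
    by metis
  \<comment> \<open>The concentration at \<open>zs n\<close> exceeds \<open>n + 1\<close>, so
    \<open>S n \<ge> r / 2 * sqrt n\<close>. Hence the rescaled discs exhaust the plane, and
    \<open>\<rho> n \<le> r / S n\<close> tends to 0.\<close>
  have Slim: "filterlim S at_top sequentially"
  proof (rule filterlim_at_top_mono)
    show "filterlim (\<lambda>n. r / 2 * sqrt (real n)) at_top sequentially" using r(1) by real_asymp
    have "r / 2 * sqrt (real n) \<le> S n" for n
    proof -
      have "sqrt (real n) \<le> sqrt (concentration L (f n) (zs n))" using big[of n] by (intro real_sqrt_le_mono) linarith
      then have "r / 2 * sqrt (real n) \<le> r / 2 * sqrt (concentration L (f n) (zs n))"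
        using r(1) by (intro mult_left_mono) auto
      then show ?thesis using Slow[of n] by linarith
    qed
    then show "\<forall>\<^sub>F n in sequentially. r / 2 * sqrt (real n) \<le> S n" by simp
  qed
  have \<rho>lim: "\<rho> \<longlonglongrightarrow> 0"
  proof (rule tendsto_sandwich [of "\<lambda>_. 0" _ _ "\<lambda>n. r / S n"])
    show "(\<lambda>n. r / S n) \<longlonglongrightarrow> 0" using Slim by (rule real_tendsto_divide_at_top [OF tendsto_const])
    show "\<forall>\<^sub>F n in sequentially. \<rho> n \<le> r / S n" using \<rho>S Spos by (simp add: pos_le_divide_eq)
  qed (use \<rho> in \<open>simp_all add: less_imp_le\<close>)
  interpret R: rescaling "f n" D "z1 n" "\<rho> n" for n
    by unfold_locales (use open_D nice f \<rho> in auto)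
  \<comment> \<open>If \<open>R\<close> bounds \<open>C\<close>, the factor
    \<open>1 / (1 - R / S n)\<^sup>2\<close> supplied by \<open>doubling\<close> tends to 1, so any
    fixed \<open>c > 1\<close> eventually dominates it.\<close>
  have affD: "\<forall>\<^sub>F n in sequentially. \<forall>\<zeta>\<in>C. R.aff n \<zeta> \<in> D \<and> spherical_bound L c (R.resc n) \<zeta>"
    if C: "compact C" and c: "c > 1" for C c
  proof -
    obtain R where R: "\<And>\<zeta>. \<zeta> \<in> C \<Longrightarrow> cmod \<zeta> \<le> R"
      using compact_imp_bounded [OF C] unfolding bounded_iff by blast
    have "(\<lambda>n. 1 / (1 - R / S n)\<^sup>2) \<longlonglongrightarrow> 1 / (1 - 0)\<^sup>2"
      using Slim by (intro tendsto_intros real_tendsto_divide_at_top [OF tendsto_const]) auto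
    then have "\<forall>\<^sub>F n in sequentially. 1 / (1 - R / S n)\<^sup>2 < c" by (rule order_tendstoD(2)) (use c in simp)
    moreover have "\<forall>\<^sub>F n in sequentially. R < S n" using Slim by (simp add: filterlim_at_top_dense)
    ultimately show ?thesis
    proof eventually_elim
      case (elim n)
      show ?case
      proof
        fix \<zeta> assume "\<zeta> \<in> C"
        then have *: "R.aff n \<zeta> \<in> ball z0 r" "(\<rho> n)\<^sup>2 * concentration L (f n) (R.aff n \<zeta>) \<le> c"
          using dbl [OF elim(2) R] elim(1) by (force simp: R.aff_def)+
        then have "R.aff n \<zeta> \<in> D" using r(2) by auto
        then show "R.aff n \<zeta> \<in> D \<and> spherical_bound L c (R.resc n) \<zeta>"
          using R.spherical_bound_resc [OF _ L_nonneg *(2)] zero [OF f] by blast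
      qed
    qed
  qed
  have affD2: "\<forall>\<^sub>F n in sequentially. \<forall>\<zeta>\<in>C. R.aff n \<zeta> \<in> D" if C: "compact C" for C
    using affD [OF C, of 2] by (auto elim: eventually_mono)
  have bound: "\<exists>M. \<forall>\<^sub>F n in sequentially. \<forall>\<zeta>\<in>C. dilatation_le (sphere_value (R.resc n)) \<zeta> M" if C: "compact C" for C
  proof -
    have "\<forall>\<^sub>F n in sequentially. \<forall>\<zeta>\<in>C. dilatation_le (sphere_value (R.resc n)) \<zeta> (2 * (L + 1))"
      using affD [OF C, of 2, simplified]
    proof eventually_elim
      case (elim n)
      then show ?case
        by (intro ballI spherical_bound_imp_dilatation_le [OF R.resc_nice]) (use L_nonneg in auto)
    qed
    then show ?thesis by blast
  qed
  obtain s G where s: "strict_mono (s :: nat \<Rightarrow> nat)"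
    and lim: "\<And>C. compact C \<Longrightarrow> C \<subseteq> UNIV \<Longrightarrow> uniform_limit C (\<lambda>n. sphere_value (R.resc (s n))) G sequentially"
    using Marty_subsequence [of UNIV "\<lambda>n. sphere_value (R.resc n)"] bound by auto
  interpret rescaled_limit "\<lambda>n. R.resc (s n)" G a b "\<lambda>n. \<rho> (s n)" L
  proof
    fix C :: "complex set"
    assume C: "compact C"
    show "uniform_limit C (\<lambda>n. sphere_value (R.resc (s n))) G sequentially" using lim C by simp
    have ev: "\<forall>\<^sub>F n in sequentially. \<forall>\<zeta>\<in>C. R.aff (s n) \<zeta> \<in> D"
      by (rule eventually_subseq [OF s affD2 [OF C]])
    have an: "f n analytic_on {R.aff n w}" "\<not> is_pole (f n) (R.aff n w)" if "\<not> is_pole (R.resc n) w" "R.aff n w \<in> D" for n w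
      using that R.is_pole_resc_iff nicely_meromorphic_on_imp_analytic_at [OF nice [OF f]] by blast+
    show "\<forall>\<^sub>F n in sequentially. R.resc (s n) nicely_meromorphic_on C"
      using ev by eventually_elim (rule nicely_meromorphic_on_subset [OF R.resc_nice], auto)
    show "\<forall>\<^sub>F n in sequentially. \<forall>w\<in>C. \<not> is_pole (R.resc (s n)) w \<longrightarrow>
        R.resc (s n) w = a / of_real (\<rho> (s n)) \<longrightarrow> deriv (R.resc (s n)) w = b"
      using ev
    proof eventually_elim
      case (elim n)
      show ?case
      proof (intro ballI impI)
        fix w assume w: "w \<in> C" "\<not> is_pole (R.resc (s n)) w" "R.resc (s n) w = a / of_real (\<rho> (s n))"
        have "f (s n) (R.aff (s n) w) = a" using w(3) \<rho>[of "s n"] by (simp add: R.resc_eq)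
        then show "deriv (R.resc (s n)) w = b"
          using shared [OF f] an elim w by (simp add: R.deriv_resc)
      qed
    qed
    show "\<forall>\<^sub>F n in sequentially. \<forall>w\<in>C. \<not> is_pole (R.resc (s n)) w \<longrightarrow>
        deriv (R.resc (s n)) w = b \<longrightarrow> R.resc (s n) w = a / of_real (\<rho> (s n))"
      using ev
    proof eventually_elim
      case (elim n)
      show ?case
      proof (intro ballI impI)
        fix w assume w: "w \<in> C" "\<not> is_pole (R.resc (s n)) w" "deriv (R.resc (s n)) w = b"
        then have "f (s n) (R.aff (s n) w) = a"
          using shared [OF f] an elim by (simp add: R.deriv_resc)
        then show "R.resc (s n) w = a / of_real (\<rho> (s n))" by (simp add: R.resc_eq)
      qed
    qed
    show "\<forall>\<^sub>F n in sequentially. \<forall>w\<in>C. \<not> is_pole (R.resc (s n)) w \<longrightarrow>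
        R.resc (s n) w = 0 \<longrightarrow> cmod (deriv (R.resc (s n)) w) \<le> L"
      using ev
    proof eventually_elim
      case (elim n)
      show ?case
      proof (intro ballI impI)
        fix w assume w: "w \<in> C" "\<not> is_pole (R.resc (s n)) w" "R.resc (s n) w = 0"
        have wD: "R.aff (s n) w \<in> D" using elim w by blast
        have "sphere_value (f (s n)) (R.aff (s n) w) = Fin 0"
          using R.sphere_value_resc_eq_0_iff [OF wD] w by (simp add: sphere_value_eq_Fin_iff)
        then show "cmod (deriv (R.resc (s n)) w) \<le> L"
          using zero [OF f wD] an [OF w(2) wD] by (simp add: R.deriv_resc)
      qed
    qed
    fix c :: real assume c: "c > 1"
    show "\<forall>\<^sub>F n in sequentially. \<forall>w\<in>C. \<not> is_pole (R.resc (s n)) w \<longrightarrow>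
        cmod (deriv (R.resc (s n)) w) \<le> c * (L + 1) * (1 + (cmod (R.resc (s n) w))\<^sup>2)"
      using eventually_subseq [OF s affD [OF C c]]
    proof eventually_elim
      case (elim n)
      then show ?case
        using spherical_bound_imp_deriv_le [OF R.resc_nice] L_nonneg c by simp
    qed
  next
    have zD: "z1 n \<in> D" for n using z1 r(2) by (meson ball_subset_cball subsetD)
    show "L + 1 \<le> cmod (deriv (\<lambda>w. inverse (R.resc (s n) w)) 0)" for n
      using R.at_centre(1) [OF zD L_nonneg one] .
    show "L + 1 \<le> cmod (deriv (R.resc (s n)) 0)" if "\<not> is_pole (R.resc (s n)) 0" for n
      using R.at_centre(2) [OF zD L_nonneg one that] .
    show "(\<lambda>n. \<rho> (s n)) \<longlonglongrightarrow> 0" using LIMSEQ_subseq_LIMSEQ [OF \<rho>lim s] by (simp add: o_def)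
  qed (use ab L \<rho> in auto)
  show False by (rule contradiction)
qed

lemma concentration_bounded_on_compact:
  assumes "compact C" "C \<subseteq> D"
  obtains B where "\<And>f z. f \<in> \<F> \<Longrightarrow> z \<in> C \<Longrightarrow> concentration L f z \<le> B"
proof -
  obtain r B where r: "\<And>z. z \<in> D \<Longrightarrow> r z > 0"
    and B: "\<And>z0 f z. z0 \<in> D \<Longrightarrow> f \<in> \<F> \<Longrightarrow> z \<in> cball z0 (r z0) \<Longrightarrow> concentration L f z \<le> B z0"
    using concentration_locally_bounded by metis
  have "C \<subseteq> (\<Union>z\<in>C. ball z (r z))" using r assms(2) by force
  then obtain T where T: "T \<subseteq> C" "finite T" "C \<subseteq> (\<Union>z\<in>T. ball z (r z))"
    using compactE_image [OF assms(1), of C "\<lambda>z. ball z (r z)"] by auto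
  have "concentration L f z \<le> (\<Sum>x\<in>T. \<bar>B x\<bar>)" if f: "f \<in> \<F>" and z: "z \<in> C" for f z
  proof -
    obtain x where x: "x \<in> T" "z \<in> ball x (r x)" using T(3) z by blast
    then have "concentration L f z \<le> B x" using B[of x f z] T(1) assms(2) f by auto
    also have "\<dots> \<le> \<bar>B x\<bar>" by simp
    also have "\<dots> \<le> (\<Sum>x\<in>T. \<bar>B x\<bar>)" using T(2) x(1) by (intro member_le_sum) auto
    finally show ?thesis .
  qed
  then show ?thesis by (rule that)
qed

theorem normal:
  assumes "connected D"
  shows "normal_family D \<F>"
  unfolding normal_family_def
proof (intro allI impI)
  fix f :: "nat \<Rightarrow> complex \<Rightarrow> complex" assume f: "range f \<subseteq> \<F>"
  have "\<exists>M. \<forall>\<^sub>F n in sequentially. \<forall>z\<in>C. dilatation_le (sphere_value (f n)) z M" if C: "compact C" "C \<subseteq> D" for C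
  proof -
    obtain B where B: "\<And>f z. f \<in> \<F> \<Longrightarrow> z \<in> C \<Longrightarrow> concentration L f z \<le> B"
      using concentration_bounded_on_compact [OF C] by blast
    \<comment> \<open>The maximum with 1 meets the requirement \<open>c \<ge> 1\<close> of
      \<open>spherical_bound_imp_dilatation_le\<close>.\<close>
    have "dilatation_le (sphere_value (f n)) z (max 1 B * (L + 1))" if z: "z \<in> C" for n z
    proof (rule spherical_bound_imp_dilatation_le)
      have fn: "f n \<in> \<F>" using f by auto
      show "f n nicely_meromorphic_on D" by (rule nice [OF fn])
      show "z \<in> D" using z C by blast
      show "spherical_bound L (max 1 B) (f n) z"
        using B[OF fn z] zero [OF fn \<open>z \<in> D\<close>] L_nonneg
        by (intro concentration_le_imp_spherical_bound) auto
    qed (use L_nonneg in auto)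
    then show ?thesis by (intro exI [of _ "max 1 B * (L + 1)"]) simp
  qed
  then obtain r G where r: "strict_mono (r :: nat \<Rightarrow> nat)"
    and lim: "\<And>C. compact C \<Longrightarrow> C \<subseteq> D \<Longrightarrow> uniform_limit C (\<lambda>n. sphere_value (f (r n))) G sequentially"
    using Marty_subsequence [OF open_D, of "\<lambda>n. sphere_value (f n)"] by blast
  interpret spherical_limit D "\<lambda>n. f (r n)" G
  proof
    show "\<forall>\<^sub>F n in sequentially. f (r n) nicely_meromorphic_on C" if "compact C" "C \<subseteq> D" for C
      using f nice nicely_meromorphic_on_subset [OF _ that(2)] by (intro always_eventually) blast
  qed (use open_D lim in auto)
  show "\<exists>r g. strict_mono (r :: nat \<Rightarrow> nat) \<and>
      ((\<exists>h. h nicely_meromorphic_on D \<and> (\<forall>z\<in>D. g z = sphere_value h z)) \<or> (\<forall>z\<in>D. g z = Infty)) \<and>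
      (\<forall>C. compact C \<and> C \<subseteq> D \<longrightarrow> uniform_limit C (\<lambda>n. sphere_value (f (r n))) g sequentially)"
    using r lim limit_nicely_meromorphic [OF assms] by blast
qed

end

theorem theorem2p1:
  fixes D :: "complex set" and \<F> :: "(complex \<Rightarrow> complex) set"
    and a b :: complex and K :: real
  assumes "open D" and "connected D" and "D \<noteq> {}"
    and "\<And>f. f \<in> \<F> \<Longrightarrow> f nicely_meromorphic_on D"
    and "a \<noteq> 0" and "b \<noteq> 0" and "K \<ge> 1"
    and "\<And>f z. f \<in> \<F> \<Longrightarrow> z \<in> D \<Longrightarrow>
           sphere_value f z = Fin a \<longleftrightarrow> sphere_value (deriv f) z = Fin b"
    and "\<And>f z. f \<in> \<F> \<Longrightarrow> z \<in> D \<Longrightarrow>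
           sphere_value f z = Fin 0 \<Longrightarrow> cmod (deriv f z) \<le> K"
  shows "normal_family D \<F>"
proof -
  interpret shared_value_family D \<F> a b "max K (cmod b)"
  proof
    fix f z assume f: "f \<in> \<F>" and z: "z \<in> D"
    show "cmod (deriv f z) \<le> max K (cmod b)" if "sphere_value f z = Fin 0"
      using assms(9) [OF f z that] by simp
    assume np: "\<not> is_pole f z"
    have "f meromorphic_on {z}"
      using assms(4) [OF f] z meromorphic_on_subset [of f D "{z}"] by (simp add: nicely_meromorphic_on_def)
    \<comment> \<open>A derivative has poles only where the function has them, so at a finite point
      both sphere-valued conditions become plain equations.\<close>
    then have "\<not> is_pole (deriv f) z" using np is_pole_deriv_iff by blast
    then show "f z = a \<longleftrightarrow> deriv f z = b" using assms(8) [OF f z] np by (simp add: sphere_value_eq_Fin_iff)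
  qed (use assms in auto)
  show ?thesis by (rule normal [OF assms(2)])
qed

end
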